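(* Let $\tilde C$ be the minimum makespan of a feasible unimodal schedule in which $R_0$ reclaims exactly the stockpiles assigned to $R_0$ by the rules below and $R_1$ reclaims the others. Then $\tilde C\le 2K^*$, where $K^*$ is the optimal makespan of a preemptive schedule; in particular this schedule is a $2$-approximation for scheduling two reclaimers with given stockpile positions and arbitrary reclaim order. The factor $2$ is asymptotically best possible as $s\to\infty$: for every $\varepsilon>0$ there is an instance on which $\tilde C\ge(2-\varepsilon)C^{\mathrm{opt}}$, where $C^{\mathrm{opt}}$ is the optimal (non-preemptive) makespan.
   Context: Reclaimer scheduling model. Two pads $P_1,P_2$ are each modeled as $[0,L]$, $L$ a positive integer. Stockpiles $1,\dots,n_1$ lie on $P_1$ and $n_1+1,\dots,n$ on $P_2$; stockpile $j$ occupies $[l_j,r_j]\subseteq[0,L]$ with integers $l_j<r_j$, non-overlapping and indexed left to right on each pad. Reclaimers $R_0,R_1$ move on a rail represented by $[0,L]$; $R_0$ starts and ends at $0$, $R_1$ at $L$. Reclaim speed $1$, travel speed $s\ge1$. A schedule of $R_k$ with makespan $C_k$ is a continuous piecewise linear $H_k:[0,C_k]\to[0,L]$, $H_k(0)=H_k(C_k)=kL$ (extended by $kL$ afterwards), with pieces of slope $0$, $\pm s$ (travel) or $\pm1$ (reclaiming on one pad). Normally each stockpile must be reclaimed by one reclaimer traversing all of $[l_j,r_j]$ once at speed $1$; feasibility requires $H_0(t)\le H_1(t)$ for all $t$; makespan $\max(C_0,C_1)$. In a preemptive schedule stockpiles may be split: it suffices that each point of each pad's occupied set be covered by a reclaiming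 piece of either reclaimer designated to that pad. A unimodal schedule for a given assignment: each reclaimer changes direction exactly once; $R_0$ reclaims all its stockpiles on one pad while moving right and all its stockpiles on the other pad while moving left; $R_1$ reclaims all its stockpiles on one pad while moving left and all its stockpiles on the other pad while moving right. Notation: $S_1=\bigcup_{j\le n_1}[l_j,r_j]$, $S_2=\bigcup_{j>n_1}[l_j,r_j]$, $Q_1=S_1\triangle S_2$, $Q_2=S_1\cap S_2$, $E=[0,L]\setminus(S_1\cup S_2)$, $\ell$ = total length. Define $f(x)=2\ell(Q_2\cap[0,x])+(1+1/s)\ell(Q_1\cap[0,x])+2\ell(E\cap[0,x])/s$ and $g(x)=2\ell(Q_2\cap[x,L])+(1+1/s)\ell(Q_1\cap[x,L])+2\ell(E\cap[x,L])/s$; $f$ is strictly increasing, $g$ strictly decreasing, and $x^*$ is the unique point with $f(x^* )=g(x^* )$. Assignment rules: (1) every stockpile $j$ with $r_j\le x^*$ is assigned to $R_0$ and every $j$ with $l_j\ge x^*$ to $R_1$; (2) if exactly one stockpile $j$ has $l_j\le x^*\le r_j$, it is assigned to $R_0$ if $x^*-l_j\ge r_j-x^*$ and to $R_1$ otherwise; (3) if there are $j\in\{1,\dots,n_1\}$ and $j'\in\{n_1+1,\dots,n\}$ with $l_j\le x^*\le r_j$ and $l_{j'}\le x^*\le r_{j'}$, both are assigned to $R_0$ if $(x^*-l_j)+(x^*-l_{j'})+|l_j-l_{j'}|/s\ge(r_j-x^* )+(r_{j'}-x^* )+|r_j-r_{j'}|/s$, and otherwise both to $R_1$.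
   Formalization: Rules (1) and (3) can conflict when x* is an endpoint of a stockpile; here rule (1) takes precedence, rule (3) binds only stockpiles with x* strictly inside, and if two touching partners give different verdicts the result is shown for either choice. At least one stockpile is assumed. *)

theory Defs
  imports "HOL-Analysis.Analysis"
begin

datatype pad = P1 | P2
datatype reclaimer = R0 | R1
datatype dir = Leftward | Rightward

record reclaim_inst =
  plen :: int                  \<comment> \<open>length \<open>L\<close> of both pads\<close>
  num1 :: nat                  \<comment> \<open>stockpiles \<open>1..num1\<close> lie on the first pad\<close>
  num :: nat
  lpos :: "nat \<Rightarrow> int"
  rpos :: "nat \<Rightarrow> int"
  speed :: real                \<comment> \<open>travel speed \<open>s\<close>; the reclaim speed is 1\<close>

definition stockpiles :: "reclaim_inst \<Rightarrow> nat set" where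
  "stockpiles I = {1..num I}"

fun piles :: "reclaim_inst \<Rightarrow> pad \<Rightarrow> nat set" where
  "piles I P1 = {1..num1 I}"
| "piles I P2 = {num1 I<..num I}"

definition valid_inst :: "reclaim_inst \<Rightarrow> bool" where
  "valid_inst I \<longleftrightarrow>
     0 < plen I \<and> 1 \<le> speed I \<and> num1 I \<le> num I \<and> 1 \<le> num I \<and>
     (\<forall>j\<in>stockpiles I. 0 \<le> lpos I j \<and> lpos I j < rpos I j \<and> rpos I j \<le> plen I) \<and>
     (\<forall>p. \<forall>i\<in>piles I p. \<forall>j\<in>piles I p. i < j \<longrightarrow> rpos I i \<le> lpos I j)"

definition pile :: "reclaim_inst \<Rightarrow> nat \<Rightarrow> real set" where
  "pile I j = {real_of_int (lpos I j)..real_of_int (rpos I j)}"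

definition occupied :: "reclaim_inst \<Rightarrow> pad \<Rightarrow> real set" where
  "occupied I p = (\<Union>j\<in>piles I p. pile I j)"

fun home :: "reclaim_inst \<Rightarrow> reclaimer \<Rightarrow> real" where
  "home I R0 = 0"
| "home I R1 = real_of_int (plen I)"

text \<open>The explicit activity labels record on which pad a piece of slope \<open>\<plusminus>1\<close> reclaims,
  and tell reclaiming from travelling when the travel speed is 1.\<close>

datatype activity = Wait | Travel dir | Reclaim pad dir

fun sgn_dir :: "dir \<Rightarrow> real" where
  "sgn_dir Leftward = - 1"
| "sgn_dir Rightward = 1"

fun slope :: "real \<Rightarrow> activity \<Rightarrow> real" where
  "slope s Wait = 0"
| "slope s (Travel d) = sgn_dir d * s"
| "slope s (Reclaim p d) = sgn_dir d"

fun heading :: "activity \<Rightarrow> dir option" where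
  "heading Wait = None"
| "heading (Travel d) = Some d"
| "heading (Reclaim p d) = Some d"

text \<open>A piecewise linear path: \<open>pos\<close> is linear between consecutive elements of \<open>breaks\<close>, and
  \<open>acts ! i\<close> is what happens between \<open>breaks ! i\<close> and \<open>breaks ! Suc i\<close>.  Consecutive pieces may
  have the same slope.\<close>

record rpath =
  pos :: "real \<Rightarrow> real"
  breaks :: "real list"
  acts :: "activity list"

definition finish :: "rpath \<Rightarrow> real" where
  "finish H = last (breaks H)"

definition reclaimer_path :: "reclaim_inst \<Rightarrow> reclaimer \<Rightarrow> rpath \<Rightarrow> bool" where
  "reclaimer_path I k H \<longleftrightarrow>
     length (breaks H) = Suc (length (acts H)) \<and>
     hd (breaks H) = 0 \<and> sorted_wrt (<) (breaks H) \<and>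
     (\<forall>i<length (acts H). \<forall>t\<in>{breaks H ! i..breaks H ! Suc i}.
        pos H t = pos H (breaks H ! i) + slope (speed I) (acts H ! i) * (t - breaks H ! i)) \<and>
     (\<forall>t\<in>{0..finish H}. 0 \<le> pos H t \<and> pos H t \<le> real_of_int (plen I)) \<and>
     pos H 0 = home I k \<and> (\<forall>t\<ge>finish H. pos H t = home I k)"

type_synonym schedule = "reclaimer \<Rightarrow> rpath"

definition makespan :: "schedule \<Rightarrow> real" where
  "makespan \<sigma> = max (finish (\<sigma> R0)) (finish (\<sigma> R1))"

definition clash_free_schedule :: "reclaim_inst \<Rightarrow> schedule \<Rightarrow> bool" where
  "clash_free_schedule I \<sigma> \<longleftrightarrow>
     (\<forall>k. reclaimer_path I k (\<sigma> k)) \<and> (\<forall>t\<ge>0. pos (\<sigma> R0) t \<le> pos (\<sigma> R1) t)"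

definition reclaiming_piece :: "rpath \<Rightarrow> nat \<Rightarrow> pad \<Rightarrow> bool" where
  "reclaiming_piece H i p \<longleftrightarrow> i < length (acts H) \<and> (\<exists>d. acts H ! i = Reclaim p d)"

definition piece_range :: "rpath \<Rightarrow> nat \<Rightarrow> real set" where
  "piece_range H i = pos H ` {breaks H ! i..breaks H ! Suc i}"

definition preemptive_schedule :: "reclaim_inst \<Rightarrow> schedule \<Rightarrow> bool" where
  "preemptive_schedule I \<sigma> \<longleftrightarrow>
     clash_free_schedule I \<sigma> \<and>
     (\<forall>p. \<forall>x\<in>occupied I p. \<exists>k i. reclaiming_piece (\<sigma> k) i p \<and> x \<in> piece_range (\<sigma> k) i)"

definition reclaims_pile :: "reclaim_inst \<Rightarrow> rpath \<Rightarrow> nat \<Rightarrow> nat \<Rightarrow> bool" where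
  "reclaims_pile I H i j \<longleftrightarrow>
     (\<exists>p. reclaiming_piece H i p \<and> j \<in> piles I p \<and> piece_range H i = pile I j)"

text \<open>Every reclaiming piece traverses exactly one whole stockpile, and every stockpile is
  traversed by exactly one piece \<open>snd q\<close> of exactly one reclaimer \<open>fst q\<close>.\<close>

definition nonpreemptive_schedule :: "reclaim_inst \<Rightarrow> schedule \<Rightarrow> bool" where
  "nonpreemptive_schedule I \<sigma> \<longleftrightarrow>
     clash_free_schedule I \<sigma> \<and>
     (\<forall>k i p. reclaiming_piece (\<sigma> k) i p \<longrightarrow> (\<exists>j. reclaims_pile I (\<sigma> k) i j)) \<and>
     (\<forall>j\<in>stockpiles I. \<exists>!q. reclaims_pile I (\<sigma> (fst q)) (snd q) j)"

fun outward :: "reclaimer \<Rightarrow> dir" where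
  "outward R0 = Rightward"
| "outward R1 = Leftward"

fun inward :: "reclaimer \<Rightarrow> dir" where
  "inward R0 = Leftward"
| "inward R1 = Rightward"

text \<open>Both blocks are nonempty, so even a reclaimer without stockpiles leaves its home; it may
  do so for an arbitrarily short trip.\<close>

definition turns_once :: "reclaimer \<Rightarrow> rpath \<Rightarrow> bool" where
  "turns_once k H \<longleftrightarrow>
     (\<exists>us vs. List.map_filter heading (acts H) = us @ vs \<and>
              set us = {outward k} \<and> set vs = {inward k})"

definition unimodal_schedule ::
    "reclaim_inst \<Rightarrow> (nat \<Rightarrow> reclaimer) \<Rightarrow> schedule \<Rightarrow> bool" where
  "unimodal_schedule I a \<sigma> \<longleftrightarrow>
     nonpreemptive_schedule I \<sigma> \<and>
     (\<forall>j\<in>stockpiles I. \<forall>k. (\<exists>i. reclaims_pile I (\<sigma> k) i j) \<longleftrightarrow> a j = k) \<and>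
     (\<forall>k. turns_once k (\<sigma> k) \<and>
          (\<exists>p. \<forall>q d. Reclaim q d \<in> set (acts (\<sigma> k)) \<longrightarrow>
                  d = (if q = p then outward k else inward k)))"

text \<open>The optimal values are infima.  A minimum is obtained by asserting in addition that some
  schedule attains the value.\<close>

definition preemptive_opt :: "reclaim_inst \<Rightarrow> real" where
  "preemptive_opt I = Inf (makespan ` {\<sigma>. preemptive_schedule I \<sigma>})"

definition nonpreemptive_opt :: "reclaim_inst \<Rightarrow> real" where
  "nonpreemptive_opt I = Inf (makespan ` {\<sigma>. nonpreemptive_schedule I \<sigma>})"

definition unimodal_opt :: "reclaim_inst \<Rightarrow> (nat \<Rightarrow> reclaimer) \<Rightarrow> real" where
  "unimodal_opt I a = Inf (makespan ` {\<sigma>. unimodal_schedule I a \<sigma>})"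

definition workload :: "reclaim_inst \<Rightarrow> real set \<Rightarrow> real" where
  "workload I A =
     (let S1 = occupied I P1; S2 = occupied I P2;
          Q1 = (S1 - S2) \<union> (S2 - S1); Q2 = S1 \<inter> S2;
          E = {0..real_of_int (plen I)} - (S1 \<union> S2)
      in 2 * measure lborel (Q2 \<inter> A) + (1 + 1 / speed I) * measure lborel (Q1 \<inter> A)
         + 2 * measure lborel (E \<inter> A) / speed I)"

definition f_left :: "reclaim_inst \<Rightarrow> real \<Rightarrow> real" where
  "f_left I x = workload I {0..x}"

definition g_right :: "reclaim_inst \<Rightarrow> real \<Rightarrow> real" where
  "g_right I x = workload I {x..real_of_int (plen I)}"

definition xstar :: "reclaim_inst \<Rightarrow> real" where
  "xstar I = (THE x. x \<in> {0..real_of_int (plen I)} \<and> f_left I x = g_right I x)"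

definition verdict_single :: "reclaim_inst \<Rightarrow> nat \<Rightarrow> reclaimer" where
  "verdict_single I j =
     (let x = xstar I; l = real_of_int (lpos I j); r = real_of_int (rpos I j)
      in if x - l \<ge> r - x then R0 else R1)"

definition verdict_pair :: "reclaim_inst \<Rightarrow> nat \<Rightarrow> nat \<Rightarrow> reclaimer" where
  "verdict_pair I j j' =
     (let x = xstar I; s = speed I;
          l = real_of_int (lpos I j); r = real_of_int (rpos I j);
          l' = real_of_int (lpos I j'); r' = real_of_int (rpos I j')
      in if (x - l) + (x - l') + \<bar>l - l'\<bar> / s \<ge> (r - x) + (r' - x) + \<bar>r - r'\<bar> / s
         then R0 else R1)"

text \<open>If \<open>x\<^sup>*\<close> is an endpoint of a stockpile, the rules read literally can contradict each
  other: a stockpile with \<open>r\<^sub>j = x\<^sup>*\<close> goes to \<open>R0\<close> by the first rule, but the pair rule may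
  send it to \<open>R1\<close> together with a stockpile of the other pad.  Here the first rule takes
  precedence, so the pair rule only concerns stockpiles with \<open>x\<^sup>*\<close> in their interior (its
  partner in the comparison may still merely touch \<open>x\<^sup>*\<close>).  If two touching partners give
  different verdicts, both are admitted.  Whenever the literal rules are consistent, this
  is exactly what they say.\<close>

definition rule_assignment :: "reclaim_inst \<Rightarrow> (nat \<Rightarrow> reclaimer) \<Rightarrow> bool" where
  "rule_assignment I a \<longleftrightarrow>
     (\<forall>j\<in>stockpiles I. (real_of_int (rpos I j) \<le> xstar I \<longrightarrow> a j = R0) \<and>
                        (xstar I \<le> real_of_int (lpos I j) \<longrightarrow> a j = R1)) \<and>
     (\<forall>j. {i \<in> stockpiles I. xstar I \<in> pile I i} = {j} \<longrightarrow> a j = verdict_single I j) \<and>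
     (let pairs = {(i, i'). i \<in> piles I P1 \<and> i' \<in> piles I P2 \<and>
                            xstar I \<in> pile I i \<and> xstar I \<in> pile I i'}
      in \<forall>j\<in>stockpiles I.
           real_of_int (lpos I j) < xstar I \<and> xstar I < real_of_int (rpos I j) \<and>
           (\<exists>(i, i')\<in>pairs. j \<in> {i, i'}) \<longrightarrow>
           (\<exists>(i, i')\<in>pairs. j \<in> {i, i'} \<and> a j = verdict_pair I i i'))"

end

theory Submission
  imports Defs
begin

text \<open>Each reclaimer is described in coordinates that measure the distance from its home, so that
  both do the same kind of trip, and two trips \<open>A\<close>, \<open>B\<close> are free of clashes iff
  \<open>A(t) + B(t) \<le> L\<close> for all \<open>t\<close>.  In these terms \<open>f(x) = 2x/s + (1 - 1/s) (\<bar>S\<^sub>1 \<inter> [0,x]\<bar> + \<bar>S\<^sub>2 \<inter> [0,x]\<bar>)\<close>,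
  and \<open>f(x\<^sup>*) = f(L)/2\<close>.

  Lower bound: counting distances, the two reclaimers together need time \<open>f(L)\<close> unless they leave
  a gap without stockpiles between them; then one of them passes \<open>x\<^sup>*\<close>, which takes time \<open>f(x\<^sup>*)\<close>,
  or \<open>x\<^sup>*\<close> lies in the gap, and then both reclaimers do the work assigned by the rules.

  Upper bound: if no stockpile contains \<open>x\<^sup>*\<close> in its interior, both reclaimers run independently.
  Otherwise let \<open>A\<close> be the reclaimer that gets the crossing stockpiles and \<open>p\<close> the pad where it
  has to go farther.  Both reclaim pad \<open>p\<close> on the way out, \<open>A\<close> does not wait, and \<open>B\<close> waits at
  home just long enough to follow \<open>A\<close> on its way back.  Rules (2) and (3) bound the overlap of the
  two working ranges, and this makes the makespan at most \<open>f(L)\<close>.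

  The minimum is attained because any unimodal schedule can be replaced by one in which the
  reclaimer that turns first never waits and the other one waits only at home.\<close>

section \<open>Trips of a single reclaimer\<close>

text \<open>The common yardstick is a potential that grows at rate 1 on the piles of a pad and at
  rate 1/s off them: along one leg no path gains potential faster than time passes, and the fastest
  leg gains exactly at that rate. The delicate moment of the upper bound comes after A has turned. A
  has to give way as fast as B can advance, so A must have nothing to reclaim on its way back until
  it reaches a point \<open>b\<close> that B never passes. The delay of B then makes it finish later
  than f(L) only if the overlap \<open>extent V - b\<close> is large, and the comparison comes down
  to \<open>2 * (extent V - b) \<le> L + (s - 1) * total_length (V (other p))\<close>, where V is
  the work of A and p its outward pad. This is what the rules have to provide. Two details force
  separate cases. A reclaimer without piles must still go out and back, so its trip cannot be
  canonical with extent 0. And a pile that merely touches x* may be a partner in the pair rule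
  although it does not cross x*.\<close>

fun flip_dir :: "dir \<Rightarrow> dir" where
  "flip_dir Leftward = Rightward"
| "flip_dir Rightward = Leftward"

fun flip :: "activity \<Rightarrow> activity" where
  "flip Wait = Wait"
| "flip (Travel d) = Travel (flip_dir d)"
| "flip (Reclaim p d) = Reclaim p (flip_dir d)"

fun other :: "pad \<Rightarrow> pad" where
  "other P1 = P2"
| "other P2 = P1"

text \<open>This is \<open>reclaimer_path\<close> of R0 with speed and length as parameters;
  \<open>view\<close> brings the paths of R1 into the same form.\<close>

definition trip :: "real \<Rightarrow> real \<Rightarrow> rpath \<Rightarrow> bool" where
  "trip s L H \<longleftrightarrow>
     length (breaks H) = Suc (length (acts H)) \<and>
     hd (breaks H) = 0 \<and> sorted_wrt (<) (breaks H) \<and>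
     (\<forall>i<length (acts H). \<forall>t\<in>{breaks H ! i..breaks H ! Suc i}.
        pos H t = pos H (breaks H ! i) + slope s (acts H ! i) * (t - breaks H ! i)) \<and>
     (\<forall>t\<in>{0..finish H}. 0 \<le> pos H t \<and> pos H t \<le> L) \<and>
     pos H 0 = 0 \<and> (\<forall>t\<ge>finish H. pos H t = 0)"

lemma flip_dir_flip_dir [simp]: "flip_dir (flip_dir d) = d"
  by (cases d) auto

lemma flip_flip [simp]: "flip (flip a) = a"
  by (cases a) auto

lemma slope_flip [simp]: "slope s (flip a) = - slope s a"
proof -
  have "sgn_dir (flip_dir d) = - sgn_dir d" for d
    by (cases d) auto
  then show ?thesis
    by (cases a) auto
qed

lemma other_neq [simp]: "other p \<noteq> p" "p \<noteq> other p"
  by (cases p; simp)+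

lemma other_other [simp]: "other (other p) = p"
  by (cases p) auto

lemma neq_iff_other: "q \<noteq> p \<longleftrightarrow> q = other p"
  by (cases p; cases q) auto

lemma trip_lengthD: "trip s L H \<Longrightarrow> length (breaks H) = Suc (length (acts H))"
  and trip_sortedD: "trip s L H \<Longrightarrow> sorted_wrt (<) (breaks H)"
  by (auto simp: trip_def)

lemma trip_linear:
  assumes "trip s L H" "i < length (acts H)" "breaks H ! i \<le> t" "t \<le> breaks H ! Suc i"
  shows "pos H t = pos H (breaks H ! i) + slope s (acts H ! i) * (t - breaks H ! i)"
  using assms unfolding trip_def by (meson atLeastAtMost_iff)

lemma trip_breaks_0: "trip s L H \<Longrightarrow> breaks H ! 0 = 0"
  unfolding trip_def by (metis hd_conv_nth length_greater_0_conv zero_less_Suc)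

lemma trip_breaks_last: "trip s L H \<Longrightarrow> breaks H ! length (acts H) = finish H"
  unfolding trip_def finish_def
  by (metis diff_Suc_1 last_conv_nth length_0_conv nat.distinct(1))

lemma trip_breaks_mono:
  assumes "trip s L H" "i \<le> j" "j \<le> length (acts H)"
  shows "breaks H ! i \<le> breaks H ! j"
  using assms sorted_wrt_nth_less[OF trip_sortedD[OF assms(1)], of i j] trip_lengthD[OF assms(1)]
  by (cases "i = j") auto

lemma trip_breaks_Suc:
  assumes "trip s L H" "i < length (acts H)"
  shows "breaks H ! i < breaks H ! Suc i"
  using assms sorted_wrt_nth_less[OF trip_sortedD[OF assms(1)], of i "Suc i"]
    trip_lengthD[OF assms(1)] by auto

lemma trip_finish_nonneg: "trip s L H \<Longrightarrow> 0 \<le> finish H"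
  using trip_breaks_mono[of s L H 0 "length (acts H)"] trip_breaks_0 trip_breaks_last by fastforce

lemma trip_nonneg: "trip s L H \<Longrightarrow> 0 \<le> t \<Longrightarrow> 0 \<le> pos H t"
  unfolding trip_def by (cases "t \<le> finish H") (auto simp: not_le)

lemma trip_after: "trip s L H \<Longrightarrow> finish H \<le> t \<Longrightarrow> pos H t = 0"
  by (simp add: trip_def)

text \<open>On one piece time is mapped affinely onto the range, so the two end positions determine
  it in either direction of motion.\<close>

lemma trip_piece_range:
  assumes H: "trip s L H" and i: "i < length (acts H)"
  shows "piece_range H i =
    closed_segment (pos H (breaks H ! i)) (pos H (breaks H ! Suc i))"
proof -
  define b c k where "b = breaks H ! i" and "c = breaks H ! Suc i" and "k = slope s (acts H ! i)"
  have bc: "b < c"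
    using trip_breaks_Suc[OF H i] by (simp add: b_def c_def)
  have lin: "pos H t = pos H b + k * (t - b)" if "b \<le> t" "t \<le> c" for t
    using trip_linear[OF H i, of t] that by (simp add: b_def c_def k_def)
  have eq: "pos H b + u * (pos H c - pos H b) = pos H (b + u * (c - b))" if "0 \<le> u" "u \<le> 1" for u
  proof -
    have "u * (c - b) \<le> c - b"
      using that bc by (simp add: mult_left_le_one_le)
    then have "b + u * (c - b) \<le> c"
      by linarith
    moreover have "b \<le> b + u * (c - b)"
      using that bc by simp
    ultimately have "pos H (b + u * (c - b)) = pos H b + k * (u * (c - b))"
      using lin[of "b + u * (c - b)"] by simp
    then show ?thesis
      using lin[of c] bc by (simp add: mult.left_commute)
  qed
  have "pos H ` {b..c} = (\<lambda>u. pos H b + u * (pos H c - pos H b)) ` {0..1}"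
  proof (intro equalityI subsetI)
    fix x assume "x \<in> pos H ` {b..c}"
    then obtain t where t: "b \<le> t" "t \<le> c" "x = pos H t" by auto
    have "x = pos H b + ((t - b) / (c - b)) * (pos H c - pos H b)"
      using eq[of "(t - b) / (c - b)"] t bc by simp
    then show "x \<in> (\<lambda>u. pos H b + u * (pos H c - pos H b)) ` {0..1}"
      using t bc by (intro image_eqI[where x = "(t - b) / (c - b)"]) auto
  next
    fix x assume "x \<in> (\<lambda>u. pos H b + u * (pos H c - pos H b)) ` {0..1}"
    then obtain u where u: "0 \<le> u" "u \<le> 1" "x = pos H b + u * (pos H c - pos H b)" by auto
    have "u * (c - b) \<le> c - b" "0 \<le> u * (c - b)"
      using u bc by (simp_all add: mult_left_le_one_le)
    then show "x \<in> pos H ` {b..c}"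
      using eq[OF u(1,2)] u(3) by (intro image_eqI[where x = "b + u * (c - b)"]) auto
  qed
  moreover have "(\<lambda>u. pos H b + u * (pos H c - pos H b)) = (\<lambda>u. (1 - u) *\<^sub>R pos H b + u *\<^sub>R pos H c)"
    by (rule ext) (simp add: algebra_simps)
  ultimately show ?thesis
    unfolding piece_range_def closed_segment_image_interval b_def c_def by (simp only:)
qed

text \<open>Induction over the breakpoints: a reflexive relation that holds inside every piece and
  composes along the time axis holds across pieces. It is applied to monotonicity of the position
  and to the speed limit on the potential.\<close>

lemma glue_pieces:
  fixes bs :: "real list"
  assumes "u \<le> v"
    and piece: "\<And>i t t'. \<lbrakk>u \<le> i; i < v; bs ! i \<le> t; t \<le> t'; t' \<le> bs ! Suc i\<rbrakk> \<Longrightarrow> Q t t'"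
    and trans: "\<And>t t' t''. \<lbrakk>t \<le> t'; t' \<le> t''; Q t t'; Q t' t''\<rbrakk> \<Longrightarrow> Q t t''"
    and refl: "\<And>t. Q t t"
    and "bs ! u \<le> t" "t \<le> t'" "t' \<le> bs ! v"
  shows "Q t t'"
  using assms(1) piece \<open>bs ! u \<le> t\<close> \<open>t \<le> t'\<close> \<open>t' \<le> bs ! v\<close>
proof (induction "v - u" arbitrary: v t t')
  case 0
  then show ?case using refl by (metis diff_is_0_eq order.antisym order.trans)
next
  case (Suc n)
  then obtain w where w: "v = Suc w" "u \<le> w"
    by (cases v) auto
  have IH: "Q a b" if "bs ! u \<le> a" "a \<le> b" "b \<le> bs ! w" for a b
    by (rule Suc.hyps(1)[of w]) (use Suc.hyps(2) Suc.prems w that in auto)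
  have last: "Q a b" if "bs ! w \<le> a" "a \<le> b" "b \<le> bs ! v" for a b
    using Suc.prems(2)[of w a b] that w by auto
  consider "t' \<le> bs ! w" | "bs ! w \<le> t" | "t < bs ! w" "bs ! w < t'" by linarith
  then show ?case
  proof cases
    case 1 then show ?thesis using IH Suc.prems by auto
  next
    case 2 then show ?thesis using last Suc.prems by auto
  next
    case 3
    then show ?thesis
      using trans[of t "bs ! w" t'] IH[of t "bs ! w"] last[of "bs ! w" t'] Suc.prems by auto
  qed
qed

section \<open>Piles ordered by distance, and the time potential\<close>

definition pile_chain :: "real \<Rightarrow> real \<Rightarrow> (real \<times> real) list \<Rightarrow> bool" where
  "pile_chain a X xs \<longleftrightarrow>
     sorted_wrt (\<lambda>I J. snd I \<le> fst J) xs \<and> (\<forall>(l, r)\<in>set xs. a \<le> l \<and> l < r \<and> r \<le> X)"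

text \<open>The clamp \<open>max l (min x r) - l\<close> is the length of the pile to the left of
  \<open>x\<close>. In a chain piles share at most endpoints, so the sum is the Lebesgue measure of
  their union left of \<open>x\<close>.\<close>

definition covered_length :: "(real \<times> real) list \<Rightarrow> real \<Rightarrow> real" where
  "covered_length xs x = (\<Sum>(l, r)\<leftarrow>xs. max l (min x r) - l)"

text \<open>The time needed to move from \<open>0\<close> to \<open>x\<close> while reclaiming the piles \<open>xs\<close>.\<close>

definition pot :: "real \<Rightarrow> (real \<times> real) list \<Rightarrow> real \<Rightarrow> real" where
  "pot s xs x = x / s + (1 - 1 / s) * covered_length xs x"

lemma pile_chain_Nil [simp]: "pile_chain a X []"
  by (simp add: pile_chain_def)

lemma pile_chain_Cons:
  "pile_chain a X ((l, r) # xs) \<longleftrightarrow> a \<le> l \<and> l < r \<and> r \<le> X \<and> pile_chain r X xs"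
  unfolding pile_chain_def by fastforce

lemma covered_length_Nil [simp]: "covered_length [] x = 0"
  and covered_length_Cons [simp]:
    "covered_length ((l, r) # xs) x = max l (min x r) - l + covered_length xs x"
  by (simp_all add: covered_length_def)

lemma covered_length_mono: "x \<le> y \<Longrightarrow> covered_length xs x \<le> covered_length xs y"
  unfolding covered_length_def by (intro sum_list_mono) auto

text \<open>Piles of a chain do not overlap, so moving from \<open>x\<close> to \<open>y\<close>
  covers at most \<open>y - x\<close>. Clamping at \<open>a\<close> records that nothing lies left
  of \<open>a\<close>; the induction moves \<open>a\<close> to the end of the first pile.\<close>

lemma covered_length_diff_le:
  assumes "pile_chain a X xs" "x \<le> y"
  shows "covered_length xs y - covered_length xs x \<le> max a y - max a x"
  using assms
proof (induction xs arbitrary: a)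
  case Nil
  then show ?case by auto
next
  case (Cons z xs)
  obtain l r where z: "z = (l, r)" by (cases z)
  have c: "a \<le> l" "l < r" "pile_chain r X xs"
    using Cons.prems by (auto simp: z pile_chain_Cons)
  show ?case
    using Cons.IH[OF c(3) \<open>x \<le> y\<close>] c(1,2) \<open>x \<le> y\<close> unfolding z by (auto simp: max_def min_def)
qed

lemma covered_length_below: "pile_chain a X xs \<Longrightarrow> x \<le> a \<Longrightarrow> covered_length xs x = 0"
  by (induction xs arbitrary: a) (auto simp: pile_chain_Cons)

lemma covered_length_above:
  assumes "\<forall>(l, r)\<in>set xs. l < r \<and> r \<le> x"
  shows "covered_length xs x = (\<Sum>(l, r)\<leftarrow>xs. r - l)"
  unfolding covered_length_def using assms by (intro arg_cong[where f = sum_list] map_cong) auto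

text \<open>The rate of the potential is 1 on piles and 1/s elsewhere. This is the lower rate;
  \<open>pot_diff_le\<close> gives the upper one.\<close>

lemma pot_diff_ge:
  assumes "1 \<le> s" "x \<le> y"
  shows "(y - x) / s \<le> pot s xs y - pot s xs x"
proof -
  have "0 \<le> (1 - 1 / s) * (covered_length xs y - covered_length xs x)"
    using assms covered_length_mono[of x y xs] by (intro mult_nonneg_nonneg) auto
  then show ?thesis unfolding pot_def by (simp add: algebra_simps diff_divide_distrib)
qed

lemma pot_diff_le:
  assumes "1 \<le> s" "x \<le> y" "pile_chain a X xs"
  shows "pot s xs y - pot s xs x \<le> y - x"
proof -
  have "(1 - 1 / s) * (covered_length xs y - covered_length xs x) \<le> (1 - 1 / s) * (y - x)"
    using assms covered_length_diff_le[OF assms(3,2)] by (intro mult_left_mono) auto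
  then show ?thesis unfolding pot_def by (simp add: algebra_simps diff_divide_distrib)
qed

lemma pot_mono: "1 \<le> s \<Longrightarrow> x \<le> y \<Longrightarrow> pot s xs x \<le> pot s xs y"
  using pot_diff_ge[of s x y xs] by (smt (verit) divide_nonneg_pos)

lemma pot_0: "pile_chain 0 X xs \<Longrightarrow> pot s xs 0 = 0"
  by (simp add: pot_def covered_length_below)

text \<open>While only one direction is used, the potential runs no faster than time. Reclaiming has
  speed 1, and the rate of the potential is at most 1. Travelling has speed \<open>s\<close>, but it
  cannot pass over any of the piles, each of which is traversed by a different piece of the same
  phase; off the piles the rate is 1/s.\<close>

lemma phase_of_trip:
  assumes H: "trip s L H" and s: "1 \<le> s" and xs: "pile_chain a X xs"
    and uv: "u \<le> v" "v \<le> length (acts H)"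
    and head: "\<And>i. u \<le> i \<Longrightarrow> i < v \<Longrightarrow> heading (acts H ! i) \<in> {None, Some d}"
    and piles: "\<And>l r. (l, r) \<in> set xs \<Longrightarrow>
      \<exists>i p. u \<le> i \<and> i < v \<and> reclaiming_piece H i p \<and> piece_range H i = {l..r}"
    and t: "breaks H ! u \<le> t" "t \<le> t'" "t' \<le> breaks H ! v"
  shows "sgn_dir d * pos H t \<le> sgn_dir d * pos H t'"
    and "\<bar>pot s xs (pos H t') - pot s xs (pos H t)\<bar> \<le> t' - t"
proof -
  have slope: "0 \<le> sgn_dir d * slope s (acts H ! i)" if "u \<le> i" "i < v" for i
    using head[OF that] s by (cases "acts H ! i"; cases d) auto
  have mono: "sgn_dir d * pos H a \<le> sgn_dir d * pos H b"
    if "breaks H ! w \<le> a" "a \<le> b" "b \<le> breaks H ! z" "u \<le> w" "w \<le> z" "z \<le> v" for a b w z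
  proof (rule glue_pieces[of w z "breaks H" "\<lambda>a b. sgn_dir d * pos H a \<le> sgn_dir d * pos H b"])
    fix i t t'
    assume i: "w \<le> i" "i < z" "breaks H ! i \<le> t" "t \<le> t'" "t' \<le> breaks H ! Suc i"
    then have "i < length (acts H)" "u \<le> i" "i < v" using uv that by auto
    note lin = trip_linear[OF H this(1)]
    have "pos H t' - pos H t = slope s (acts H ! i) * (t' - t)"
      using lin[of t] lin[of t'] i by (simp add: algebra_simps)
    then have "sgn_dir d * pos H t' - sgn_dir d * pos H t
        = (sgn_dir d * slope s (acts H ! i)) * (t' - t)"
      by (metis (no_types) mult.assoc right_diff_distrib)
    moreover have "0 \<le> (sgn_dir d * slope s (acts H ! i)) * (t' - t)"
      using slope[of i] \<open>u \<le> i\<close> \<open>i < v\<close> i by (simp add: mult_nonneg_nonneg)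
    ultimately show "sgn_dir d * pos H t \<le> sgn_dir d * pos H t'" by linarith
  qed (use that in auto)
  show "sgn_dir d * pos H t \<le> sgn_dir d * pos H t'"
    using mono[OF t] uv by auto
  show "\<bar>pot s xs (pos H t') - pot s xs (pos H t)\<bar> \<le> t' - t"
  proof (rule glue_pieces[of u v "breaks H" "\<lambda>t t'. \<bar>pot s xs (pos H t') - pot s xs (pos H t)\<bar> \<le> t' - t"])
    fix i t t'
    assume i: "u \<le> i" "i < v" "breaks H ! i \<le> t" "t \<le> t'" "t' \<le> breaks H ! Suc i"
    then have i': "i < length (acts H)" using uv by auto
    note lin = trip_linear[OF H i']
    have diff: "pos H t' - pos H t = slope s (acts H ! i) * (t' - t)"
      using lin[of t] lin[of t'] i by (simp add: algebra_simps)
    show "\<bar>pot s xs (pos H t') - pot s xs (pos H t)\<bar> \<le> t' - t"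
    proof (cases "acts H ! i")
      case Wait
      then show ?thesis using diff i by simp
    next
      case (Reclaim p e)
      have "\<bar>pot s xs y - pot s xs x\<bar> \<le> \<bar>y - x\<bar>" for x y
        using pot_diff_le[OF s _ xs, of x y] pot_diff_le[OF s _ xs, of y x]
          pot_mono[OF s, of x y xs] pot_mono[OF s, of y x xs] by (cases "x \<le> y") auto
      moreover have "\<bar>pos H t' - pos H t\<bar> = t' - t"
        using diff Reclaim i by (cases e) auto
      ultimately show ?thesis by metis
    next
      case (Travel e)
      \<comment> \<open>A travelling piece comes before or after the piece that reclaims this pile,
        so by monotonicity it stays on one side of the pile, where the clamp is constant.\<close>
      have const: "max l (min (pos H t') r) = max l (min (pos H t) r)" if lr_in: "(l, r) \<in> set xs" for l r
      proof -
        obtain j p where j: "u \<le> j" "j < v" "reclaiming_piece H j p" "piece_range H j = {l..r}"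
          using piles[OF lr_in] by blast
        have "i \<noteq> j" using j(3) Travel by (auto simp: reclaiming_piece_def)
        have lr: "l < r" using xs lr_in by (auto simp: pile_chain_def)
        have "l \<in> piece_range H j" "r \<in> piece_range H j" using j lr by auto
        then obtain tl tr where tl: "breaks H ! j \<le> tl" "tl \<le> breaks H ! Suc j" "pos H tl = l"
          and tr: "breaks H ! j \<le> tr" "tr \<le> breaks H ! Suc j" "pos H tr = r"
          by (auto simp: piece_range_def)
        have sep: "sgn_dir d * pos H a \<le> sgn_dir d * pos H b"
          if "breaks H ! i1 \<le> a" "a \<le> breaks H ! Suc i1" "breaks H ! i2 \<le> b" "b \<le> breaks H ! Suc i2"
            "u \<le> i1" "i1 < i2" "i2 < v" for i1 i2 a b
        proof (rule mono[of i1 a b "Suc i2"])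
          show "a \<le> b"
            using trip_breaks_mono[OF H, of "Suc i1" i2] uv that by auto
        qed (use that in auto)
        have "(pos H t \<le> l \<and> pos H t' \<le> l) \<or> (r \<le> pos H t \<and> r \<le> pos H t')"
        proof (cases "i < j")
          case True
          then show ?thesis
            using sep[of i t j tl] sep[of i t' j tl] sep[of i t j tr] sep[of i t' j tr] i j tl tr
            by (cases d) auto
        next
          case False
          then have "j < i" using \<open>i \<noteq> j\<close> by simp
          then show ?thesis
            using sep[of j tl i t] sep[of j tl i t'] sep[of j tr i t] sep[of j tr i t'] i j tl tr
            by (cases d) auto
        qed
        then show ?thesis using lr by auto
      qed
      have "covered_length xs (pos H t') = covered_length xs (pos H t)"
        unfolding covered_length_def
        by (intro arg_cong[where f = sum_list] map_cong) (auto simp: const)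
      then have "pot s xs (pos H t') - pot s xs (pos H t) = (pos H t' - pos H t) / s"
        by (simp add: pot_def diff_divide_distrib)
      moreover have "\<bar>(pos H t' - pos H t) / s\<bar> = t' - t"
        using diff Travel i s by (cases e) auto
      ultimately show ?thesis by simp
    qed
  qed (use uv t in auto)
qed

text \<open>A linear piece is highest at one of its ends, so breakpoints dominate all other
  positions.\<close>

lemma obtain_break:
  assumes H: "trip s L H" and s: "1 \<le> s" and t: "0 \<le> t" "t \<le> finish H"
  obtains m where "m \<le> length (acts H)" "pos H t \<le> pos H (breaks H ! m)"
proof -
  have "\<exists>m\<le>n. pos H t \<le> pos H (breaks H ! m)"
    if "t \<le> breaks H ! n" "n \<le> length (acts H)" for n
    using that
  proof (induction n)
    case 0
    then show ?case using trip_breaks_0[OF H] t by auto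
  next
    case (Suc n)
    show ?case
    proof (cases "t \<le> breaks H ! n")
      case True
      then show ?thesis using Suc by (metis Suc_leD le_SucI)
    next
      case False
      note lin = trip_linear[OF H, of n]
      show ?thesis
      proof (cases "0 \<le> slope s (acts H ! n)")
        case True
        have "slope s (acts H ! n) * (t - breaks H ! n)
            \<le> slope s (acts H ! n) * (breaks H ! Suc n - breaks H ! n)"
          using True Suc.prems by (intro mult_left_mono) auto
        then have "pos H t \<le> pos H (breaks H ! Suc n)"
          using lin[of t] lin[of "breaks H ! Suc n"] Suc.prems False by auto
        then show ?thesis by blast
      next
        case neg: False
        have "slope s (acts H ! n) * (t - breaks H ! n) \<le> 0"
          using neg False by (intro mult_nonpos_nonneg) auto
        then have "pos H t \<le> pos H (breaks H ! n)"
          using lin[of t] Suc.prems False by auto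
        then show ?thesis by (meson le_SucI order_refl)
      qed
    qed
  qed
  then show ?thesis
    using that t trip_breaks_last[OF H] by (metis order_refl)
qed

definition reclaimed :: "rpath \<Rightarrow> pad \<Rightarrow> real set" where
  "reclaimed H p = (\<Union>i\<in>{i. reclaiming_piece H i p}. piece_range H i)"

text \<open>Counting distances: the path covers the distance to its farthest point twice, and
  reclaiming a length \<open>\<lambda>\<close> costs \<open>(1 - 1/s) \<lambda>\<close> on top of the travel time.\<close>

lemma trip_cost:
  assumes H: "trip s L H" and s: "1 \<le> s" and t: "0 \<le> t"
  shows "2 * pos H t / s + (1 - 1 / s) *
      (measure lborel (reclaimed H P1) + measure lborel (reclaimed H P2)) \<le> finish H"
proof -
  define n where "n = length (acts H)"
  define dur where "dur i = breaks H ! Suc i - breaks H ! i" for i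
  define len where "len i = \<bar>pos H (breaks H ! Suc i) - pos H (breaks H ! i)\<bar>" for i
  define R where "R p = {i. reclaiming_piece H i p}" for p
  have R: "R p \<subseteq> {..<n}" "finite (R p)" for p
    by (auto simp: R_def reclaiming_piece_def n_def intro: finite_subset[of _ "{..<n}"])
  have disj: "R P1 \<inter> R P2 = {}"
    by (auto simp: R_def reclaiming_piece_def)
  have tele: "(\<Sum>i<n. dur i) = finish H"
    using sum_lessThan_telescope[of "\<lambda>i. breaks H ! i" n] trip_breaks_0[OF H] trip_breaks_last[OF H]
    by (simp add: dur_def n_def)
  \<comment> \<open>Equality holds for travelling, whose length is \<open>s\<close> times the
    duration, and for reclaiming, as 1/s + (1 - 1/s) = 1; waiting covers no distance.\<close>
  have dur: "len i / s + (1 - 1 / s) * (if i \<in> R P1 \<union> R P2 then len i else 0) \<le> dur i"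
    if "i < n" for i
  proof -
    have d: "dur i > 0"
      using trip_breaks_Suc[OF H] that by (simp add: dur_def n_def)
    have len: "len i = \<bar>slope s (acts H ! i)\<bar> * dur i"
      using trip_linear[OF H, of i "breaks H ! Suc i"] trip_breaks_Suc[OF H, of i] that
      by (simp add: len_def n_def dur_def abs_mult)
    show ?thesis
    proof (cases "acts H ! i")
      case (Travel e)
      then show ?thesis using len d s by (cases e) (auto simp: R_def reclaiming_piece_def)
    next
      case (Reclaim p e)
      then have "i \<in> R P1 \<union> R P2"
        using that by (cases p) (auto simp: R_def reclaiming_piece_def n_def)
      then show ?thesis using Reclaim len d s by (cases e) (auto simp: algebra_simps)
    qed (use len d s in \<open>auto simp: R_def reclaiming_piece_def\<close>)
  qed
  have meas: "measure lborel (reclaimed H p) \<le> (\<Sum>i\<in>R p. len i)" for p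
  proof -
    have seg: "piece_range H i = closed_segment (pos H (breaks H ! i)) (pos H (breaks H ! Suc i))"
      if "i \<in> R p" for i
      using trip_piece_range[OF H] R that by (auto simp: n_def)
    have "measure lborel (reclaimed H p) \<le> (\<Sum>i\<in>R p. measure lborel (piece_range H i))"
      unfolding reclaimed_def R_def[symmetric] using R seg
      by (intro measure_UNION_le) (auto simp: closed_segment_eq_real_ivl)
    also have "\<dots> = (\<Sum>i\<in>R p. len i)"
      by (intro sum.cong refl) (auto simp: seg len_def closed_segment_eq_real_ivl)
    finally show ?thesis .
  qed
  \<comment> \<open>The path leads from 0 to the position at breakpoint \<open>m\<close> and back to
    0, so the pieces before \<open>m\<close> and those after it each cover that distance.\<close>
  have two: "2 * pos H t \<le> (\<Sum>i<n. len i)"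
  proof (cases "t \<le> finish H")
    case True
    then obtain m where m: "m \<le> n" "pos H t \<le> pos H (breaks H ! m)"
      using obtain_break[OF H s t] n_def by blast
    have "pos H (breaks H ! m) = (\<Sum>i<m. pos H (breaks H ! Suc i) - pos H (breaks H ! i))"
      using sum_lessThan_telescope[of "\<lambda>i. pos H (breaks H ! i)" m] trip_breaks_0[OF H] H
      by (simp add: trip_def)
    also have "\<dots> \<le> (\<Sum>i<m. len i)"
      by (intro sum_mono) (simp add: len_def)
    finally have 1: "pos H t \<le> (\<Sum>i<m. len i)" using m by simp
    have "pos H (breaks H ! m) = - (\<Sum>i=m..<n. pos H (breaks H ! Suc i) - pos H (breaks H ! i))"
      using sum_Suc_diff'[OF m(1), of "\<lambda>i. pos H (breaks H ! i)"] trip_breaks_last[OF H] H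
      by (simp add: trip_def n_def)
    also have "\<dots> \<le> (\<Sum>i=m..<n. len i)"
      by (subst sum_negf[symmetric], intro sum_mono) (simp add: len_def)
    finally have 2: "pos H t \<le> (\<Sum>i=m..<n. len i)" using m by simp
    have "(\<Sum>i<n. len i) = (\<Sum>i<m. len i) + (\<Sum>i=m..<n. len i)"
      using m(1) by (metis atLeast0LessThan sum.atLeastLessThan_concat zero_le)
    then show ?thesis using 1 2 by simp
  next
    case False
    then show ?thesis using trip_after[OF H] by (simp add: sum_nonneg len_def)
  qed
  have "2 * pos H t / s + (1 - 1 / s) *
      (measure lborel (reclaimed H P1) + measure lborel (reclaimed H P2))
    \<le> (\<Sum>i<n. len i) / s + (1 - 1 / s) * ((\<Sum>i\<in>R P1. len i) + (\<Sum>i\<in>R P2. len i))"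
    using two meas[of P1] meas[of P2] s
    by (intro add_mono divide_right_mono mult_left_mono) auto
  also have "(\<Sum>i\<in>R P1. len i) + (\<Sum>i\<in>R P2. len i) = (\<Sum>i\<in>R P1 \<union> R P2. len i)"
    using R disj by (subst sum.union_disjoint) auto
  also have "\<dots> = (\<Sum>i<n. if i \<in> R P1 \<union> R P2 then len i else 0)"
    using R(1)[of P1] R(1)[of P2] by (subst sum.inter_restrict[symmetric]) (auto intro: sum.cong)
  also have "(\<Sum>i<n. len i) / s + (1 - 1 / s) * \<dots>
      = (\<Sum>i<n. len i / s + (1 - 1 / s) * (if i \<in> R P1 \<union> R P2 then len i else 0))"
    by (simp add: sum.distrib sum_divide_distrib sum_distrib_left)
  also have "\<dots> \<le> (\<Sum>i<n. dur i)"
    by (intro sum_mono dur) auto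
  finally show ?thesis by (simp add: tele)
qed

section \<open>Trips given by lists of pieces\<close>

text \<open>Every piece contributes its slope times the time already spent in it, clamped to its
  duration. For positive durations the function is constant before and after the run, which permits
  evaluation at shifted and reversed times.\<close>

fun course :: "real \<Rightarrow> (activity \<times> real) list \<Rightarrow> real \<Rightarrow> real" where
  "course s [] t = 0"
| "course s ((a, d) # ps) t = slope s a * max 0 (min t d) + course s ps (t - d)"

text \<open>This keeps the label of a piece together with the interval that it traverses, so that
  the reclaimed piles can be read off.\<close>

fun legs :: "real \<Rightarrow> real \<Rightarrow> (activity \<times> real) list \<Rightarrow> (activity \<times> real \<times> real) list" where
  "legs s x [] = []"
| "legs s x ((a, d) # ps) = (a, x, x + slope s a * d) # legs s (x + slope s a * d) ps"

definition duration :: "(activity \<times> real) list \<Rightarrow> real" where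
  "duration ps = (\<Sum>(a, d)\<leftarrow>ps. d)"

definition displacement :: "real \<Rightarrow> (activity \<times> real) list \<Rightarrow> real" where
  "displacement s ps = (\<Sum>(a, d)\<leftarrow>ps. slope s a * d)"

definition path_of :: "real \<Rightarrow> (activity \<times> real) list \<Rightarrow> rpath" where
  "path_of s ps = \<lparr>pos = course s ps,
     breaks = map (\<lambda>i. duration (take i ps)) [0..<Suc (length ps)], acts = map fst ps\<rparr>"

text \<open>Time reversal: a return leg is an outward leg played backwards.\<close>

definition backwards :: "(activity \<times> real) list \<Rightarrow> (activity \<times> real) list" where
  "backwards ps = rev (map (\<lambda>(a, d). (flip a, d)) ps)"

abbreviation lasting :: "(activity \<times> real) list \<Rightarrow> bool" where
  "lasting ps \<equiv> \<forall>(a, d)\<in>set ps. 0 < d"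

lemma duration_simps [simp]:
  "duration [] = 0" "duration ((a, d) # ps) = d + duration ps"
  "duration (ps @ qs) = duration ps + duration qs"
  by (simp_all add: duration_def)

lemma displacement_simps [simp]:
  "displacement s [] = 0" "displacement s ((a, d) # ps) = slope s a * d + displacement s ps"
  "displacement s (ps @ qs) = displacement s ps + displacement s qs"
  by (simp_all add: displacement_def)

lemma duration_backwards [simp]: "duration (backwards ps) = duration ps"
  by (induction ps) (auto simp: backwards_def)

lemma displacement_backwards [simp]: "displacement s (backwards ps) = - displacement s ps"
  by (induction ps) (auto simp: backwards_def)

lemma duration_nonneg: "lasting ps \<Longrightarrow> 0 \<le> duration ps"
  by (induction ps) fastforce+

lemma course_append: "course s (ps @ qs) t = course s ps t + course s qs (t - duration ps)"
  by (induction ps arbitrary: t) (auto simp: algebra_simps)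

lemma course_before: "lasting ps \<Longrightarrow> t \<le> 0 \<Longrightarrow> course s ps t = 0"
proof (induction ps arbitrary: t)
  case (Cons z ps)
  then show ?case by (cases z) (auto simp: max_def min_def)
qed auto

lemma course_after: "lasting ps \<Longrightarrow> duration ps \<le> t \<Longrightarrow> course s ps t = displacement s ps"
proof (induction ps arbitrary: t)
  case (Cons z ps)
  then show ?case using duration_nonneg[of ps] by (cases z) (auto simp: max_def min_def)
qed auto

text \<open>At time \<open>t\<close> the reversed run is where the original was at
  \<open>duration ps - t\<close>; subtracting the displacement makes it start from 0.\<close>

lemma course_backwards:
  "lasting ps \<Longrightarrow>
    course s (backwards ps) t = course s ps (duration ps - t) - displacement s ps"
proof (induction ps arbitrary: t)
  case (Cons z ps)
  obtain a d where z: "z = (a, d)" by (cases z)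
  have bw: "backwards (z # ps) = backwards ps @ [(flip a, d)]"
    by (simp add: backwards_def z)
  have "lasting ps" "0 < d" using Cons.prems by (auto simp: z)
  have "course s (backwards (z # ps)) t = course s ps (duration ps - t) - displacement s ps
      - slope s a * max 0 (min (t - duration ps) d)"
    using Cons.IH[OF \<open>lasting ps\<close>] by (simp add: bw course_append)
  moreover have "max 0 (min (t - duration ps) d) = d - max 0 (min (d + duration ps - t) d)"
    using \<open>0 < d\<close> by auto
  ultimately show ?case
    by (simp add: z algebra_simps)
qed (simp add: backwards_def)

lemma course_mono:
  assumes "\<forall>(a, d)\<in>set ps. 0 \<le> slope s a" "t \<le> t'"
  shows "course s ps t \<le> course s ps t'"
  using assms
proof (induction ps arbitrary: t t')
  case (Cons z ps)
  then show ?case by (cases z) (auto intro!: add_mono mult_left_mono)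
qed auto

lemma course_Lipschitz:
  assumes "lasting ps" "\<forall>(a, d)\<in>set ps. slope s a \<le> s" "0 \<le> s" "t \<le> t'"
  shows "course s ps t' - course s ps t \<le> s * (max 0 t' - max 0 t)"
  using assms
proof (induction ps arbitrary: t t')
  case Nil
  then show ?case by auto
next
  case (Cons z ps)
  obtain a d where z: "z = (a, d)" by (cases z)
  have d: "0 < d" "slope s a \<le> s" using Cons.prems by (auto simp: z)
  have le1: "slope s a * (max 0 (min t' d) - max 0 (min t d)) \<le> s * (max 0 (min t' d) - max 0 (min t d))"
    using d Cons.prems by (intro mult_right_mono) auto
  have le2: "course s ps (t' - d) - course s ps (t - d) \<le> s * (max 0 (t' - d) - max 0 (t - d))"
    using Cons.IH[of "t - d" "t' - d"] Cons.prems by auto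
  have "max 0 t' - max 0 t = (max 0 (min t' d) - max 0 (min t d)) + (max 0 (t' - d) - max 0 (t - d))"
    using d by auto
  then have "s * (max 0 t' - max 0 t) = s * (max 0 (min t' d) - max 0 (min t d))
      + s * (max 0 (t' - d) - max 0 (t - d))"
    by (simp only: distrib_left)
  moreover have "course s (z # ps) t' - course s (z # ps) t =
      slope s a * (max 0 (min t' d) - max 0 (min t d)) + (course s ps (t' - d) - course s ps (t - d))"
    by (simp add: z right_diff_distrib)
  ultimately show ?case
    using le1 le2 by linarith
qed

text \<open>Makes the set of admissible waiting times closed. The induction is over a general
  argument \<open>f t\<close>, as the tail of the list is evaluated at a delayed time.\<close>

lemma continuous_course: "continuous_on A (course s ps)"
proof -
  have "continuous_on A (\<lambda>t. course s ps (f t))" if "continuous_on A f" for f :: "real \<Rightarrow> real"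
    using that
  proof (induction ps arbitrary: f)
    case (Cons z ps)
    obtain a d where z: "z = (a, d)" by (cases z)
    have "continuous_on A (\<lambda>t. course s ps (f t - d))"
      by (intro Cons.IH continuous_intros Cons.prems)
    then have "continuous_on A (\<lambda>t. slope s a * max 0 (min (f t) d) + course s ps (f t - d))"
      by (intro continuous_intros Cons.prems)
    then show ?case by (simp add: z)
  qed auto
  from this[of "\<lambda>t. t"] show ?thesis by simp
qed

lemma legs_append: "legs s x (ps @ qs) = legs s x ps @ legs s (x + displacement s ps) qs"
  by (induction ps arbitrary: x) (auto simp: algebra_simps)

lemma legs_backwards:
  "legs s (x + displacement s ps) (backwards ps) =
     rev (map (\<lambda>(a, y, z). (flip a, z, y)) (legs s x ps))"
proof (induction ps arbitrary: x)
  case (Cons z ps)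
  obtain a d where z: "z = (a, d)" by (cases z)
  have bw: "backwards ((a, d) # ps) = backwards ps @ [(flip a, d)]"
    by (simp add: backwards_def)
  show ?case
    using Cons.IH[of "x + slope s a * d"] by (simp add: z bw legs_append algebra_simps)
qed (simp add: backwards_def)

lemma legs_nth:
  assumes "i < length ps"
  shows "legs s x ps ! i = (fst (ps ! i), x + displacement s (take i ps), x + displacement s (take (Suc i) ps))"
  using assms
proof (induction ps arbitrary: x i)
  case (Cons z ps)
  obtain a d where z: "z = (a, d)" by (cases z)
  show ?case using Cons by (cases i) (auto simp: z)
qed auto

lemma length_legs [simp]: "length (legs s x ps) = length ps"
  by (induction ps arbitrary: x) auto

lemma path_of_simps [simp]:
  "pos (path_of s ps) = course s ps" "acts (path_of s ps) = map fst ps"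
  "length (breaks (path_of s ps)) = Suc (length ps)"
  "i \<le> length ps \<Longrightarrow> breaks (path_of s ps) ! i = duration (take i ps)"
proof -
  show "breaks (path_of s ps) ! i = duration (take i ps)" if "i \<le> length ps"
    using that nth_map[of i "[0..<Suc (length ps)]"] by (simp add: path_of_def del: upt_Suc)
qed (simp_all add: path_of_def)

lemma finish_path_of [simp]: "finish (path_of s ps) = duration ps"
  by (simp add: finish_def path_of_def)

lemma path_of_piece:
  assumes "lasting ps" "i < length ps" "duration (take i ps) \<le> t" "t \<le> duration (take (Suc i) ps)"
  shows "course s ps t = displacement s (take i ps) + slope s (fst (ps ! i)) * (t - duration (take i ps))"
proof -
  obtain a d where ad: "ps ! i = (a, d)" by (cases "ps ! i")
  have split: "ps = take i ps @ (a, d) # drop (Suc i) ps"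
    using assms(2) ad by (metis id_take_nth_drop)
  have suc: "duration (take (Suc i) ps) = duration (take i ps) + d"
    using assms(2) ad by (simp add: take_Suc_conv_app_nth)
  have l: "lasting (take i ps)" "lasting (drop (Suc i) ps)"
    using assms(1) by (auto dest: in_set_takeD in_set_dropD)
  have "course s ps t = course s (take i ps) t + slope s a * max 0 (min (t - duration (take i ps)) d)
      + course s (drop (Suc i) ps) (t - duration (take i ps) - d)"
    by (subst split) (simp add: course_append)
  then show ?thesis
    using assms(3,4) course_after[OF l(1) assms(3)] course_before[OF l(2), of "t - duration (take i ps) - d"]
    by (simp add: ad suc)
qed

lemma course_break:
  assumes "lasting ps" "i \<le> length ps"
  shows "course s ps (duration (take i ps)) = displacement s (take i ps)"
proof (cases "i = length ps")
  case True
  then show ?thesis using course_after[OF assms(1)] by auto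
next
  case False
  then have i: "i < length ps" using assms by simp
  obtain a d where ad: "ps ! i = (a, d)" by (cases "ps ! i")
  then have "0 < d" using assms(1) i nth_mem by fastforce
  then have "duration (take i ps) \<le> duration (take (Suc i) ps)"
    using i ad by (simp add: take_Suc_conv_app_nth)
  then show ?thesis using path_of_piece[OF assms(1) i, of "duration (take i ps)"] by simp
qed

lemma trip_path_of:
  assumes ps: "lasting ps" and "displacement s ps = 0"
    and "\<And>t. 0 \<le> course s ps t \<and> course s ps t \<le> L"
  shows "trip s L (path_of s ps)"
  unfolding trip_def
proof (intro conjI)
  show "sorted_wrt (<) (breaks (path_of s ps))"
    unfolding sorted_wrt_iff_nth_less
  proof (intro allI impI)
    fix i j assume ij: "i < j" "j < length (breaks (path_of s ps))"
    have "take j ps = take i ps @ take (j - i) (drop i ps)"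
      using ij by (metis le_add_diff_inverse less_imp_le take_add)
    moreover have "take (j - i) (drop i ps) \<noteq> []" using ij by simp
    then obtain a d qs where "take (j - i) (drop i ps) = (a, d) # qs"
      by (metis list.exhaust surj_pair)
    moreover from this have "lasting ((a, d) # qs)"
      using ps by (metis in_set_takeD in_set_dropD)
    ultimately have "duration (take i ps) < duration (take j ps)"
      using duration_nonneg[of qs] by auto
    then show "breaks (path_of s ps) ! i < breaks (path_of s ps) ! j"
      using ij by simp
  qed
  show "\<forall>i<length (acts (path_of s ps)). \<forall>t\<in>{breaks (path_of s ps) ! i..breaks (path_of s ps) ! Suc i}.
      pos (path_of s ps) t = pos (path_of s ps) (breaks (path_of s ps) ! i) +
        slope s (acts (path_of s ps) ! i) * (t - breaks (path_of s ps) ! i)"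
    using path_of_piece[OF ps] course_break[OF ps] by simp
  show "hd (breaks (path_of s ps)) = 0"
    by (simp add: path_of_def hd_map del: upt_Suc)
  show "\<forall>t\<ge>finish (path_of s ps). pos (path_of s ps) t = 0"
    using course_after[OF ps] assms(2) by simp
qed (use assms course_before[OF ps, of 0] in auto)

lemma piece_range_path_of:
  assumes "trip s L (path_of s ps)" "lasting ps" "i < length ps"
    "legs s 0 ps ! i = (a, y, z)"
  shows "piece_range (path_of s ps) i = closed_segment y z" "fst (ps ! i) = a"
  using assms trip_piece_range[OF assms(1)] legs_nth[OF assms(3), of s 0] course_break[OF assms(2)]
  by auto

text \<open>Pieces of duration 0 are left out because breakpoints must increase strictly.\<close>

definition seg :: "activity \<Rightarrow> real \<Rightarrow> (activity \<times> real) list" where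
  "seg a d = (if 0 < d then [(a, d)] else [])"

text \<open>The fastest way out: full speed in every gap, including the one between the last pile
  and \<open>X\<close>.\<close>

fun out_pieces :: "real \<Rightarrow> pad \<Rightarrow> real \<Rightarrow> (real \<times> real) list \<Rightarrow> real \<Rightarrow> (activity \<times> real) list" where
  "out_pieces s p a [] X = seg (Travel Rightward) ((X - a) / s)"
| "out_pieces s p a ((l, r) # xs) X =
     seg (Travel Rightward) ((l - a) / s) @ (Reclaim p Rightward, r - l) # out_pieces s p r xs X"

lemma seg_simps [simp]:
  "0 \<le> d \<Longrightarrow> course s (seg a d) t = slope s a * max 0 (min t d)"
  "0 \<le> d \<Longrightarrow> duration (seg a d) = d"
  "0 \<le> d \<Longrightarrow> displacement s (seg a d) = slope s a * d"
  "lasting (seg a d)"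
  by (auto simp: seg_def)

lemma lasting_out_pieces: "pile_chain a X xs \<Longrightarrow> lasting (out_pieces s p a xs X)"
proof (induction xs arbitrary: a)
  case (Cons z xs)
  then show ?case by (cases z) (auto simp: pile_chain_Cons seg_def)
qed (auto simp: seg_def)

lemma out_pieces_acts:
  "(b, d) \<in> set (out_pieces s p a xs X) \<Longrightarrow> b = Travel Rightward \<or> b = Reclaim p Rightward"
proof (induction xs arbitrary: a)
  case (Cons z xs)
  then show ?case by (cases z) (auto simp: seg_def split: if_splits)
qed (auto simp: seg_def split: if_splits)

lemma out_pieces_slope:
  "1 \<le> s \<Longrightarrow> \<forall>(b, d)\<in>set (out_pieces s p a xs X). 0 \<le> slope s b \<and> slope s b \<le> s"
  using out_pieces_acts[of _ _ s p a xs X] by fastforce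

lemma displacement_out_pieces:
  assumes "pile_chain a X xs" "a \<le> X" "1 \<le> s"
  shows "displacement s (out_pieces s p a xs X) = X - a"
  using assms
proof (induction xs arbitrary: a)
  case (Cons z xs)
  then show ?case by (cases z) (auto simp: pile_chain_Cons)
qed auto

lemma duration_out_pieces:
  assumes "pile_chain a X xs" "a \<le> X" "1 \<le> s"
  shows "duration (out_pieces s p a xs X) = (X - a) / s + (1 - 1 / s) * covered_length xs X"
  using assms
proof (induction xs arbitrary: a)
  case (Cons z xs)
  obtain l r where z: "z = (l, r)" by (cases z)
  have c: "a \<le> l" "l < r" "r \<le> X" "pile_chain r X xs"
    using Cons.prems by (auto simp: z pile_chain_Cons)
  have "duration (out_pieces s p r xs X) = (X - r) / s + (1 - 1 / s) * covered_length xs X"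
    using Cons c by auto
  moreover have "covered_length (z # xs) X = r - l + covered_length xs X"
    using c by (simp add: z)
  moreover have "duration (out_pieces s p a (z # xs) X) =
      (l - a) / s + (r - l) + duration (out_pieces s p r xs X)"
    using c Cons.prems by (simp add: z)
  ultimately show ?case
    by (simp only:) (simp add: diff_divide_distrib algebra_simps)
qed auto

text \<open>The fastest run inverts the potential: it passes \<open>x\<close> when the elapsed time
  equals the potential gained since \<open>a\<close>. The induction places \<open>x\<close> before,
  inside or behind the first pile.\<close>

lemma course_out_pieces:
  assumes "pile_chain a X xs" "a \<le> x" "x \<le> X" "1 \<le> s"
  shows "course s (out_pieces s p a xs X) ((x - a) / s + (1 - 1 / s) * covered_length xs x) = x - a"
  using assms
proof (induction xs arbitrary: a)
  case Nil
  then have "max 0 (min ((x - a) / s) ((X - a) / s)) = (x - a) / s"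
    by (auto simp: divide_right_mono min_def)
  then show ?case using Nil by simp
next
  case (Cons z xs)
  obtain l r where z: "z = (l, r)" by (cases z)
  have c: "a \<le> l" "l < r" "r \<le> X" "pile_chain r X xs"
    using Cons.prems by (auto simp: z pile_chain_Cons)
  have last: "lasting (out_pieces s p r xs X)"
    by (rule lasting_out_pieces[OF c(4)])
  let ?t = "(x - a) / s + (1 - 1 / s) * covered_length (z # xs) x"
  have tr: "course s (out_pieces s p a (z # xs) X) t =
      s * max 0 (min t ((l - a) / s)) + max 0 (min (t - (l - a) / s) (r - l)) +
      course s (out_pieces s p r xs X) (t - (l - a) / s - (r - l))" for t
    using c Cons.prems by (simp add: z course_append)
  consider "x \<le> l" | "l < x" "x \<le> r" | "r < x" by linarith
  then show ?case
  proof cases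
    case 1
    then have "covered_length (z # xs) x = 0"
      using covered_length_below[OF c(4), of x] c by (simp add: z)
    then have t: "?t = (x - a) / s" by simp
    have "(x - a) / s \<le> (l - a) / s" "0 \<le> (x - a) / s"
      using 1 Cons.prems by (auto simp: divide_right_mono)
    then show ?thesis
      unfolding tr t using c Cons.prems course_before[OF last] by simp
  next
    case 2
    then have "covered_length (z # xs) x = x - l"
      using covered_length_below[OF c(4), of x] c by (simp add: z)
    then have t: "?t = (l - a) / s + (x - l)"
      by (simp only:) (simp add: diff_divide_distrib algebra_simps)
    have "0 \<le> (l - a) / s"
      using c Cons.prems by auto
    then show ?thesis
      unfolding tr t using 2 c Cons.prems course_before[OF last] by simp
  next
    case 3
    then have "covered_length (z # xs) x = r - l + covered_length xs x"
      using c by (simp add: z)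
    then have t: "?t = (l - a) / s + (r - l) + ((x - r) / s + (1 - 1 / s) * covered_length xs x)"
      by (simp only:) (simp add: diff_divide_distrib algebra_simps)
    have "0 \<le> (l - a) / s"
      using c Cons.prems by auto
    moreover have "0 \<le> (x - r) / s + (1 - 1 / s) * covered_length xs x"
      using 3 Cons.prems covered_length_mono[of r x xs] covered_length_below[OF c(4), of r] by simp
    ultimately show ?thesis
      unfolding tr t using 3 c Cons.prems Cons.IH[OF c(4)] by simp
  qed
qed

lemma legs_out_pieces:
  assumes "pile_chain a X xs" "1 \<le> s"
  shows "(Reclaim q d, y, z) \<in> set (legs s a (out_pieces s p a xs X)) \<longleftrightarrow>
    q = p \<and> d = Rightward \<and> (y, z) \<in> set xs"
  using assms
proof (induction xs arbitrary: a)
  case (Cons w xs)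
  obtain l r where w: "w = (l, r)" by (cases w)
  have c: "a \<le> l" "l < r" "r \<le> X" "pile_chain r X xs"
    using Cons.prems by (auto simp: w pile_chain_Cons)
  then have "0 \<le> (l - a) / s" using Cons.prems by auto
  then show ?case
    using Cons.IH[OF c(4)] Cons.prems c by (auto simp: w legs_append) (auto simp: seg_def split: if_splits)
qed (auto simp: seg_def)

section \<open>Unimodal trips\<close>

text \<open>The condition on one reclaimer in its own coordinates, with \<open>p\<close> the pad
  worked on the way out. Piles are identified by their intervals, which are distinct on one
  pad.\<close>

definition unimodal_trip ::
    "real \<Rightarrow> real \<Rightarrow> (pad \<Rightarrow> (real \<times> real) list) \<Rightarrow> pad \<Rightarrow> rpath \<Rightarrow> bool" where
  "unimodal_trip s L W p H \<longleftrightarrow>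
     trip s L H \<and> turns_once R0 H \<and>
     (\<forall>q d. Reclaim q d \<in> set (acts H) \<longrightarrow> d = (if q = p then Rightward else Leftward)) \<and>
     (\<forall>i q. reclaiming_piece H i q \<longrightarrow> (\<exists>(l, r)\<in>set (W q). piece_range H i = {l..r})) \<and>
     (\<forall>q. \<forall>(l, r)\<in>set (W q). \<exists>i. reclaiming_piece H i q \<and> piece_range H i = {l..r})"

text \<open>All that the comparison of trips needs: one turning time and, in each phase, the speed
  limit measured by the potential of the pad worked in that phase. The second phase has no upper
  limit, so it includes the time after the trip.\<close>

definition turns_at ::
    "real \<Rightarrow> (pad \<Rightarrow> (real \<times> real) list) \<Rightarrow> pad \<Rightarrow> rpath \<Rightarrow> real \<Rightarrow> bool" where
  "turns_at s W p H \<tau> \<longleftrightarrow>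
     0 \<le> \<tau> \<and> \<tau> \<le> finish H \<and>
     (\<forall>t t'. 0 \<le> t \<longrightarrow> t \<le> t' \<longrightarrow> t' \<le> \<tau> \<longrightarrow>
        pos H t \<le> pos H t' \<and> pot s (W p) (pos H t') - pot s (W p) (pos H t) \<le> t' - t) \<and>
     (\<forall>t t'. \<tau> \<le> t \<longrightarrow> t \<le> t' \<longrightarrow>
        pos H t' \<le> pos H t \<and>
        pot s (W (other p)) (pos H t) - pot s (W (other p)) (pos H t') \<le> t' - t) \<and>
     (\<forall>q. \<forall>(l, r)\<in>set (W q). r \<le> pos H \<tau>)"

definition total_length :: "(real \<times> real) list \<Rightarrow> real" where
  "total_length xs = (\<Sum>(l, r)\<leftarrow>xs. r - l)"

text \<open>The farthest point that has to be visited; the inserted 0 is the value for a reclaimer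
  without piles.\<close>

definition extent :: "(pad \<Rightarrow> (real \<times> real) list) \<Rightarrow> real" where
  "extent W = Max (insert 0 (snd ` (set (W P1) \<union> set (W P2))))"

lemma map_filter_append:
  "List.map_filter f (xs @ ys) = List.map_filter f xs @ List.map_filter f ys"
  by (simp add: List.map_filter_def)

lemma set_map_filter: "set (List.map_filter f xs) = {y. \<exists>x\<in>set xs. f x = Some y}"
  by (induction xs) (auto split: option.split)

text \<open>Waiting pieces have no heading, so a split of the list of headings has to be lifted to a
  split of the pieces.\<close>

lemma map_filter_eq_appendD:
  assumes "List.map_filter f xs = us @ vs"
  shows "\<exists>m\<le>length xs. List.map_filter f (take m xs) = us \<and> List.map_filter f (drop m xs) = vs"
  using assms
proof (induction xs arbitrary: us)
  case Nil
  then show ?case by auto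
next
  case (Cons x xs)
  show ?case
  proof (cases "us = []")
    case True
    then show ?thesis using Cons.prems by (intro exI[of _ 0]) auto
  next
    case False
    then obtain us' where us': "List.map_filter f xs = us' @ vs"
      "us = (case f x of None \<Rightarrow> us' | Some y \<Rightarrow> y # us')"
      using Cons.prems by (cases "f x") (auto simp: Cons_eq_append_conv)
    obtain m where "m \<le> length xs" "List.map_filter f (take m xs) = us'"
      "List.map_filter f (drop m xs) = vs"
      using Cons.IH[OF us'(1)] by blast
    then show ?thesis
      using us'(2) by (intro exI[of _ "Suc m"]) (auto split: option.splits)
  qed
qed

lemma unimodal_trip_phases:
  assumes "unimodal_trip s L W p H"
  obtains m where "m \<le> length (acts H)"
    "\<And>i. i < m \<Longrightarrow> heading (acts H ! i) \<in> {None, Some Rightward}"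
    "\<And>i. m \<le> i \<Longrightarrow> i < length (acts H) \<Longrightarrow> heading (acts H ! i) \<in> {None, Some Leftward}"
proof -
  obtain us vs where uv: "List.map_filter heading (acts H) = us @ vs"
    "set us = {Rightward}" "set vs = {Leftward}"
    using assms by (auto simp: unimodal_trip_def turns_once_def)
  obtain m where m: "m \<le> length (acts H)"
    "List.map_filter heading (take m (acts H)) = us" "List.map_filter heading (drop m (acts H)) = vs"
    using map_filter_eq_appendD[OF uv(1)] by blast
  have 1: "heading a \<in> {None, Some Rightward}" if "a \<in> set (take m (acts H))" for a
    using that uv(2) m(2) set_map_filter[of heading "take m (acts H)"] by (cases "heading a") auto
  have 2: "heading a \<in> {None, Some Leftward}" if "a \<in> set (drop m (acts H))" for a
    using that uv(3) m(3) set_map_filter[of heading "drop m (acts H)"] by (cases "heading a") auto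
  show thesis
  proof (rule that[OF m(1)])
    fix i assume "i < m"
    then show "heading (acts H ! i) \<in> {None, Some Rightward}"
      using 1[of "acts H ! i"] m(1) by (metis in_set_conv_nth length_take min.absorb2 nth_take)
  next
    fix i assume i: "m \<le> i" "i < length (acts H)"
    then have "acts H ! i = drop m (acts H) ! (i - m)" "i - m < length (drop m (acts H))" by auto
    then show "heading (acts H ! i) \<in> {None, Some Leftward}"
      using 2[of "acts H ! i"] by (metis nth_mem)
  qed
qed

text \<open>The turn is the breakpoint between the pieces heading out and those heading back. Piles
  of pad \<open>p\<close> are reclaimed by outward pieces, hence before it, and the others after it,
  so \<open>phase_of_trip\<close> applies to each phase with the matching pad.\<close>

lemma unimodal_trip_turns_at:
  assumes U: "unimodal_trip s L W p H" and s: "1 \<le> s" and W: "\<And>q. pile_chain 0 L (W q)"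
  obtains \<tau> where "turns_at s W p H \<tau>"
proof -
  have H: "trip s L H"
    using U by (simp add: unimodal_trip_def)
  let ?n = "length (acts H)"
  obtain m where m: "m \<le> ?n"
    "\<And>i. i < m \<Longrightarrow> heading (acts H ! i) \<in> {None, Some Rightward}"
    "\<And>i. m \<le> i \<Longrightarrow> i < ?n \<Longrightarrow> heading (acts H ! i) \<in> {None, Some Leftward}"
    using unimodal_trip_phases[OF U] by blast
  have dir: "d = (if q = p then Rightward else Leftward)"
    if "reclaiming_piece H i q" "acts H ! i = Reclaim q d" for i q d
    using U that by (metis nth_mem reclaiming_piece_def unimodal_trip_def)
  have out: "\<exists>i q. 0 \<le> i \<and> i < m \<and> reclaiming_piece H i q \<and> piece_range H i = {l..r}"
    if lr_in: "(l, r) \<in> set (W p)" for l r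
  proof -
    obtain i where i: "reclaiming_piece H i p" "piece_range H i = {l..r}"
      using U lr_in unfolding unimodal_trip_def by blast
    then obtain d where d: "acts H ! i = Reclaim p d" "i < ?n" by (auto simp: reclaiming_piece_def)
    then have "i < m"
      using dir[OF i(1) d(1)] m(3)[of i] by (cases "m \<le> i") auto
    then show ?thesis using i by blast
  qed
  have bwd: "\<exists>i q. m \<le> i \<and> i < ?n \<and> reclaiming_piece H i q \<and> piece_range H i = {l..r}"
    if lr_in: "(l, r) \<in> set (W (other p))" for l r
  proof -
    obtain i where i: "reclaiming_piece H i (other p)" "piece_range H i = {l..r}"
      using U lr_in unfolding unimodal_trip_def by blast
    then obtain d where d: "acts H ! i = Reclaim (other p) d" "i < ?n" by (auto simp: reclaiming_piece_def)
    then have "m \<le> i"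
      using dir[OF i(1) d(1)] m(2)[of i] by (cases "m \<le> i") auto
    then show ?thesis using i d by blast
  qed
  define \<tau> where "\<tau> = breaks H ! m"
  have \<tau>: "0 \<le> \<tau>" "\<tau> \<le> finish H"
    using trip_breaks_mono[OF H, of 0 m] trip_breaks_mono[OF H, of m ?n]
      trip_breaks_0[OF H] trip_breaks_last[OF H] m(1) by (auto simp: \<tau>_def)
  have rise: "pos H t \<le> pos H t' \<and> pot s (W p) (pos H t') - pot s (W p) (pos H t) \<le> t' - t"
    if "0 \<le> t" "t \<le> t'" "t' \<le> \<tau>" for t t'
    using phase_of_trip[OF H s W, of 0 m Rightward p t t'] out m trip_breaks_0[OF H] that
    by (auto simp: \<tau>_def)
  have fall': "pos H t' \<le> pos H t \<and>
      pot s (W (other p)) (pos H t) - pot s (W (other p)) (pos H t') \<le> t' - t"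
    if "\<tau> \<le> t" "t \<le> t'" "t' \<le> finish H" for t t'
    using phase_of_trip[OF H s W, of m ?n Leftward "other p" t t'] bwd m trip_breaks_last[OF H] that
    by (auto simp: \<tau>_def)
  have fall: "pos H t' \<le> pos H t \<and>
      pot s (W (other p)) (pos H t) - pot s (W (other p)) (pos H t') \<le> t' - t"
    if "\<tau> \<le> t" "t \<le> t'" for t t'
  proof (cases "t' \<le> finish H")
    case False
    have home: "pos H u = pos H (finish H)" if "finish H \<le> u" for u
      using that trip_after[OF H] by simp
    show ?thesis
    proof (cases "t \<le> finish H")
      case True
      then show ?thesis using fall'[of t "finish H"] that False home[of t'] by auto
    next
      case outside: False
      then show ?thesis using False that home[of t] home[of t'] by auto
    qed
  qed (use fall' that in auto)
  have top: "pos H t \<le> pos H \<tau>" if "0 \<le> t" for t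
    using rise[of t \<tau>] fall[of \<tau> t] that by (cases "t \<le> \<tau>") auto
  have "r \<le> pos H \<tau>" if lr_in: "(l, r) \<in> set (W q)" for q l r
  proof -
    obtain i where i: "reclaiming_piece H i q" "piece_range H i = {l..r}"
      using U lr_in unfolding unimodal_trip_def by blast
    moreover have "l < r" using W[of q] lr_in by (auto simp: pile_chain_def)
    ultimately have "r \<in> piece_range H i" by simp
    then obtain t where t: "r = pos H t" "breaks H ! i \<le> t" by (auto simp: piece_range_def)
    moreover have "0 \<le> breaks H ! i"
      using trip_breaks_mono[OF H, of 0 i] trip_breaks_0[OF H] i(1) by (auto simp: reclaiming_piece_def)
    ultimately show ?thesis using top by auto
  qed
  then have "turns_at s W p H \<tau>"
    unfolding turns_at_def using \<tau> rise fall by blast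
  then show thesis by (rule that)
qed

text \<open>Pieces on one pad have the same direction and so lie in one monotone phase, and a
  monotone path traverses an interval of positive length only once.\<close>

lemma unimodal_trip_unique_piece:
  assumes U: "unimodal_trip s L W p H" and s: "1 \<le> s"
    and "reclaiming_piece H i q" "reclaiming_piece H j q"
    and "piece_range H i = {l..r}" "piece_range H j = {l..r}" "l < r"
  shows "i = j"
proof -
  have H: "trip s L H"
    using U by (simp add: unimodal_trip_def)
  let ?n = "length (acts H)"
  obtain m where m: "m \<le> ?n"
    "\<And>i. i < m \<Longrightarrow> heading (acts H ! i) \<in> {None, Some Rightward}"
    "\<And>i. m \<le> i \<Longrightarrow> i < ?n \<Longrightarrow> heading (acts H ! i) \<in> {None, Some Leftward}"
    using unimodal_trip_phases[OF U] by blast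
  have "\<not> i < j" if i: "reclaiming_piece H i q" "piece_range H i = {l..r}"
    and j: "reclaiming_piece H j q" "piece_range H j = {l..r}" for i j
  proof
    assume "i < j"
    obtain d where d: "acts H ! i = Reclaim q d" "acts H ! j = Reclaim q d" "i < ?n" "j < ?n"
      using i j U unfolding unimodal_trip_def reclaiming_piece_def by (metis nth_mem)
    define u v where "u = (if d = Rightward then 0 else m)" and "v = (if d = Rightward then m else ?n)"
    have uv: "u \<le> i" "j < v" "v \<le> ?n" "u \<le> v"
      using d m \<open>i < j\<close> m(2)[of i] m(3)[of i] m(2)[of j] m(3)[of j]
      by (cases d; cases "i < m"; cases "j < m"; auto simp: u_def v_def)+
    have mono: "sgn_dir d * pos H t \<le> sgn_dir d * pos H t'"
      if "breaks H ! i \<le> t" "t \<le> t'" "t' \<le> breaks H ! Suc j" for t t'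
    \<comment> \<open>Only monotonicity is wanted, so the list of piles is taken to be
      empty.\<close>
    proof (rule phase_of_trip(1)[OF H s, of 0 L "[]" u v])
      show "heading (acts H ! k) \<in> {None, Some d}" if "u \<le> k" "k < v" for k
        using m(2)[of k] m(3)[of k] that by (cases d) (auto simp: u_def v_def)
      show "breaks H ! u \<le> t" "t' \<le> breaks H ! v"
        using trip_breaks_mono[OF H uv(1)] trip_breaks_mono[OF H, of "Suc j" v] uv that d by auto
    qed (use uv that in auto)
    have b: "breaks H ! i \<le> breaks H ! Suc i" "breaks H ! Suc i \<le> breaks H ! j"
      "breaks H ! j \<le> breaks H ! Suc j"
      using trip_breaks_mono[OF H] d \<open>i < j\<close> by auto
    have seg: "closed_segment (pos H (breaks H ! i)) (pos H (breaks H ! Suc i)) = {l..r}"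
      "closed_segment (pos H (breaks H ! j)) (pos H (breaks H ! Suc j)) = {l..r}"
      using trip_piece_range[OF H] d i j by auto
    have "sgn_dir d * pos H (breaks H ! i) \<le> sgn_dir d * pos H (breaks H ! Suc i)"
      "sgn_dir d * pos H (breaks H ! Suc i) \<le> sgn_dir d * pos H (breaks H ! j)"
      "sgn_dir d * pos H (breaks H ! j) \<le> sgn_dir d * pos H (breaks H ! Suc j)"
      using mono b by auto
    moreover have "l \<in> {l..r}" "r \<in> {l..r}" using \<open>l < r\<close> by auto
    then have "{l, r} \<subseteq> closed_segment (pos H (breaks H ! i)) (pos H (breaks H ! Suc i))"
      "{l, r} \<subseteq> closed_segment (pos H (breaks H ! j)) (pos H (breaks H ! Suc j))"
      unfolding seg by auto
    ultimately show False
      using \<open>l < r\<close> by (cases d) (auto simp: closed_segment_eq_real_ivl split: if_splits)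
  qed
  from this[of i j] this[of j i] show ?thesis
    using assms by (meson linorder_neqE_nat)
qed

section \<open>Canonical trips: a wait at home followed by two fastest legs\<close>

definition canonical_pieces ::
    "real \<Rightarrow> (pad \<Rightarrow> (real \<times> real) list) \<Rightarrow> real \<Rightarrow> pad \<Rightarrow> real \<Rightarrow> (activity \<times> real) list" where
  "canonical_pieces s W X p \<delta> =
     seg Wait \<delta> @ out_pieces s p 0 (W p) X @ backwards (out_pieces s (other p) 0 (W (other p)) X)"

definition canonical_trip ::
    "real \<Rightarrow> (pad \<Rightarrow> (real \<times> real) list) \<Rightarrow> real \<Rightarrow> pad \<Rightarrow> real \<Rightarrow> rpath" where
  "canonical_trip s W X p \<delta> = path_of s (canonical_pieces s W X p \<delta>)"

definition earliest :: "real \<Rightarrow> (pad \<Rightarrow> (real \<times> real) list) \<Rightarrow> real \<Rightarrow> pad \<Rightarrow> real \<Rightarrow> real" where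
  "earliest s W X p = course s (out_pieces s p 0 (W p) X)"

locale canonical =
  fixes s :: real and W :: "pad \<Rightarrow> (real \<times> real) list" and X :: real
  assumes s: "1 \<le> s" and X: "0 < X" and W: "\<And>q. pile_chain 0 X (W q)"
begin

abbreviation "e \<equiv> earliest s W X"
abbreviation "T p \<equiv> pot s (W p) X"

lemma duration_out: "duration (out_pieces s p 0 (W p) X) = T p"
  using duration_out_pieces[OF W _ s, of p p] X by (simp add: pot_def)

lemma displacement_out: "displacement s (out_pieces s p 0 (W p) X) = X"
  using displacement_out_pieces[OF W _ s] X by simp

lemma e_before: "t \<le> 0 \<Longrightarrow> e p t = 0"
  unfolding earliest_def by (rule course_before[OF lasting_out_pieces[OF W]])

lemma e_after: "T p \<le> t \<Longrightarrow> e p t = X"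
  unfolding earliest_def
  by (simp add: course_after[OF lasting_out_pieces[OF W]] duration_out displacement_out)

lemma e_mono: "t \<le> t' \<Longrightarrow> e p t \<le> e p t'"
  unfolding earliest_def using out_pieces_slope[OF s] by (intro course_mono) fastforce+

lemma e_nonneg: "0 \<le> e p t"
  using e_before[of "min t 0" p] e_mono[of "min t 0" t p] by simp

lemma e_le_X: "e p t \<le> X"
  using e_after[of p "max t (T p)"] e_mono[of t "max t (T p)" p] by simp

lemma e_pot: "0 \<le> x \<Longrightarrow> x \<le> X \<Longrightarrow> e p (pot s (W p) x) = x"
  unfolding earliest_def pot_def using course_out_pieces[OF W _ _ s, of x p p] by simp

text \<open>The run \<open>e p\<close> is monotone and passes \<open>x\<close> at time
  \<open>pot s (W p) x\<close>. In this form a lower bound on the potential of any other path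
  becomes a comparison of positions.\<close>

lemma e_le: "0 \<le> x \<Longrightarrow> t \<le> pot s (W p) x \<Longrightarrow> e p t \<le> x"
  using e_mono[of t "pot s (W p) x" p] e_pot[of x p] e_le_X[of p t] by (cases "x \<le> X") auto

lemma e_Lipschitz: "t \<le> t' \<Longrightarrow> e p t' - e p t \<le> s * (max 0 t' - max 0 t)"
  unfolding earliest_def using out_pieces_slope[OF s] s
  by (intro course_Lipschitz lasting_out_pieces[OF W]) fastforce+

lemma T_pos: "0 < T p"
  using pot_diff_ge[OF s, of 0 X "W p"] pot_0[OF W] X s by (smt (verit) divide_pos_pos)

lemma T_ge: "X / s \<le> T p"
  using pot_diff_ge[OF s, of 0 X "W p"] pot_0[OF W] X by simp

lemma lasting_canonical: "lasting (canonical_pieces s W X p \<delta>)"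
  using lasting_out_pieces[OF W, of s p p] lasting_out_pieces[OF W, of s "other p" "other p"]
  unfolding canonical_pieces_def by (auto simp: seg_def backwards_def split: if_splits)

lemma duration_canonical:
  "0 \<le> \<delta> \<Longrightarrow> duration (canonical_pieces s W X p \<delta>) = \<delta> + T p + T (other p)"
  by (simp add: canonical_pieces_def duration_out)

lemma finish_canonical:
  "0 \<le> \<delta> \<Longrightarrow> finish (canonical_trip s W X p \<delta>) = \<delta> + T p + T (other p)"
  by (simp add: canonical_trip_def duration_canonical)

text \<open>On the way out the second term is still \<open>X\<close>, on the way back the first one
  has reached \<open>X\<close>, so subtracting \<open>X\<close> leaves the current leg. A single
  formula for all times makes continuity in \<open>\<delta>\<close> visible.\<close>

lemma pos_canonical:
  assumes "0 \<le> \<delta>"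
  shows "pos (canonical_trip s W X p \<delta>) t = e p (t - \<delta>) + e (other p) (\<delta> + T p + T (other p) - t) - X"
proof -
  have "course s (backwards (out_pieces s q 0 (W q) X)) u = e q (T q - u) - X" for q u
    by (simp add: course_backwards[OF lasting_out_pieces[OF W]] earliest_def duration_out displacement_out)
  then show ?thesis
    using assms
    by (simp add: canonical_trip_def canonical_pieces_def course_append duration_out earliest_def[symmetric]
        algebra_simps)
qed

lemma pos_canonical_out:
  assumes "0 \<le> \<delta>" "t \<le> \<delta> + T p"
  shows "pos (canonical_trip s W X p \<delta>) t = e p (t - \<delta>)"
  using assms e_after[of "other p" "\<delta> + T p + T (other p) - t"] by (simp add: pos_canonical)

lemma pos_canonical_in:
  assumes "0 \<le> \<delta>" "\<delta> + T p \<le> t"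
  shows "pos (canonical_trip s W X p \<delta>) t = e (other p) (\<delta> + T p + T (other p) - t)"
  using assms e_after[of p "t - \<delta>"] by (simp add: pos_canonical)

lemma pos_canonical_bounds:
  assumes "0 \<le> \<delta>"
  shows "0 \<le> pos (canonical_trip s W X p \<delta>) t" "pos (canonical_trip s W X p \<delta>) t \<le> X"
  using pos_canonical_out[OF assms, of t p] pos_canonical_in[OF assms, of p t] e_nonneg e_le_X
  by (metis linear)+

lemma pos_canonical_after:
  assumes "0 \<le> \<delta>" "\<delta> + T p + T (other p) \<le> t"
  shows "pos (canonical_trip s W X p \<delta>) t = 0"
  using pos_canonical_in[OF assms(1), of p t] assms(2) T_pos[of "other p"]
    e_before[of "\<delta> + T p + T (other p) - t" "other p"] by simp

lemma trip_canonical: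
  assumes "0 \<le> \<delta>" "X \<le> L"
  shows "trip s L (canonical_trip s W X p \<delta>)"
  unfolding canonical_trip_def
proof (rule trip_path_of[OF lasting_canonical])
  show "displacement s (canonical_pieces s W X p \<delta>) = 0"
    using assms by (simp add: canonical_pieces_def displacement_out)
  show "0 \<le> course s (canonical_pieces s W X p \<delta>) t \<and> course s (canonical_pieces s W X p \<delta>) t \<le> L" for t
    using pos_canonical_bounds[OF assms(1), of p t] assms(2) by (simp add: canonical_trip_def)
qed

lemma legs_canonical:
  assumes "0 \<le> \<delta>"
  shows "(Reclaim q d, y, z) \<in> set (legs s 0 (canonical_pieces s W X p \<delta>)) \<longleftrightarrow>
    q = p \<and> d = Rightward \<and> (y, z) \<in> set (W p) \<or>
    q = other p \<and> d = Leftward \<and> (z, y) \<in> set (W (other p))"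
proof -
  have wait: "(Reclaim q d, y, z) \<notin> set (legs s 0 (seg Wait \<delta>))"
    by (simp add: seg_def)
  have bw: "legs s X (backwards (out_pieces s (other p) 0 (W (other p)) X)) =
      rev (map (\<lambda>(a, y, z). (flip a, z, y)) (legs s 0 (out_pieces s (other p) 0 (W (other p)) X)))"
    using legs_backwards[of s 0 "out_pieces s (other p) 0 (W (other p)) X"] by (simp add: displacement_out)
  have "(Reclaim q d, y, z) \<in> (\<lambda>(a, y, z). (flip a, z, y)) ` A \<longleftrightarrow> (Reclaim q (flip_dir d), z, y) \<in> A"
    for A
  proof
    assume "(Reclaim q d, y, z) \<in> (\<lambda>(a, y, z). (flip a, z, y)) ` A"
    then obtain a where a: "Reclaim q d = flip a" "(a, z, y) \<in> A" by auto
    then have "a = Reclaim q (flip_dir d)" by (metis flip.simps(3) flip_flip)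
    then show "(Reclaim q (flip_dir d), z, y) \<in> A" using a by simp
  next
    assume "(Reclaim q (flip_dir d), z, y) \<in> A"
    then show "(Reclaim q d, y, z) \<in> (\<lambda>(a, y, z). (flip a, z, y)) ` A"
      by (intro image_eqI[where x = "(Reclaim q (flip_dir d), z, y)"]) auto
  qed
  then show ?thesis
    using assms wait legs_out_pieces[OF W s, of q d y z p p]
      legs_out_pieces[OF W s, of q "flip_dir d" z y "other p" "other p"]
    by (cases d) (auto simp: canonical_pieces_def legs_append displacement_out bw)
qed

lemma unimodal_canonical:
  assumes \<delta>: "0 \<le> \<delta>" and "X \<le> L"
  shows "unimodal_trip s L W p (canonical_trip s W X p \<delta>)"
proof -
  let ?C = "canonical_pieces s W X p \<delta>" and ?H = "canonical_trip s W X p \<delta>"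
  let ?out = "\<lambda>q. out_pieces s q 0 (W q) X"
  have trip: "trip s L ?H" by (rule trip_canonical[OF assms])
  have acts: "acts ?H = map fst ?C" by (simp add: canonical_trip_def)
  have legs: "legs s 0 ?C ! i = (a, y, z) \<Longrightarrow> i < length ?C \<Longrightarrow>
      piece_range ?H i = closed_segment y z \<and> acts ?H ! i = a" for i a y z
    using piece_range_path_of[OF trip[unfolded canonical_trip_def] lasting_canonical]
    by (auto simp: canonical_trip_def)
  have leg_le: "y < z" if "(y, z) \<in> set (W q)" for y z q
    using W[of q] that by (auto simp: pile_chain_def)
  have "turns_once R0 ?H"
    unfolding turns_once_def
  proof (intro exI conjI)
    let ?us = "List.map_filter heading (map fst (?out p))"
    let ?vs = "List.map_filter heading (map fst (backwards (?out (other p))))"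
    have "List.map_filter heading (map fst (seg Wait \<delta>)) = []"
      by (simp add: seg_def)
    then show "List.map_filter heading (acts ?H) = ?us @ ?vs"
      by (simp add: acts canonical_pieces_def map_filter_append)
    \<comment> \<open>Since \<open>X\<close> is positive, each leg takes positive time, so neither
      block of headings is empty.\<close>
    have some: "\<exists>a d. (a, d) \<in> set (?out q)" for q
      using duration_out[of q] T_pos[of q] by (cases "?out q") auto
    have head: "heading a = Some Rightward" if "(a, d) \<in> set (?out q)" for a d q
      using out_pieces_acts[OF that] by auto
    have "set ?us \<subseteq> {Rightward}"
      using head by (fastforce simp: set_map_filter)
    moreover have "Rightward \<in> set ?us"
      using some[of p] head by (force simp: set_map_filter)
    ultimately show "set ?us = {outward R0}" by auto
    have flip: "heading (flip a) = Some Leftward" if "(a, d) \<in> set (?out q)" for a d q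
      using out_pieces_acts[OF that] by auto
    have "set ?vs \<subseteq> {Leftward}"
      using flip by (fastforce simp: set_map_filter backwards_def)
    moreover have "Leftward \<in> set ?vs"
      using some[of "other p"] flip by (force simp: set_map_filter backwards_def)
    ultimately show "set ?vs = {inward R0}" by auto
  qed
  moreover have leg_of: "\<exists>y z. (Reclaim q d, y, z) \<in> set (legs s 0 ?C) \<and> piece_range ?H i = closed_segment y z"
    if "i < length ?C" "acts ?H ! i = Reclaim q d" for i q d
  proof -
    obtain a y z where "legs s 0 ?C ! i = (a, y, z)" by (metis surj_pair)
    moreover from this have "(a, y, z) \<in> set (legs s 0 ?C)"
      using that(1) by (metis length_legs nth_mem)
    ultimately show ?thesis using legs[of i a y z] that by auto
  qed
  moreover have "d = (if q = p then Rightward else Leftward)" if act: "Reclaim q d \<in> set (acts ?H)" for q d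
  proof -
    obtain i where "i < length ?C" "acts ?H ! i = Reclaim q d"
      using act by (fastforce simp: acts in_set_conv_nth)
    then show ?thesis
      using leg_of legs_canonical[OF \<delta>, of q d _ _ p] by fastforce
  qed
  moreover have "\<exists>(l, r)\<in>set (W q). piece_range ?H i = {l..r}" if piece: "reclaiming_piece ?H i q" for i q
  proof -
    obtain d where "acts ?H ! i = Reclaim q d" "i < length ?C"
      using piece by (auto simp: reclaiming_piece_def acts)
    then obtain y z where "(Reclaim q d, y, z) \<in> set (legs s 0 ?C)" "piece_range ?H i = closed_segment y z"
      using leg_of by blast
    then show ?thesis
      unfolding legs_canonical[OF \<delta>]
      using leg_le[of y z q] leg_le[of z y q] by (fastforce simp: closed_segment_eq_real_ivl)
  qed
  moreover have "\<exists>i. reclaiming_piece ?H i q \<and> piece_range ?H i = {l..r}" if lr: "(l, r) \<in> set (W q)" for l r q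
  proof -
    obtain d y z where "(Reclaim q d, y, z) \<in> set (legs s 0 ?C)" "closed_segment y z = {l..r}"
    proof (cases "q = p")
      case True
      then show thesis
        using that[of Rightward l r] legs_canonical[OF \<delta>, of q Rightward l r p] lr leg_le[OF lr]
        by (auto simp: closed_segment_eq_real_ivl)
    next
      case False
      then show thesis
        using that[of Leftward r l] legs_canonical[OF \<delta>, of q Leftward r l p] lr leg_le[OF lr]
        by (auto simp: closed_segment_eq_real_ivl neq_iff_other)
    qed
    moreover from this obtain i where "i < length ?C" "legs s 0 ?C ! i = (Reclaim q d, y, z)"
      by (auto simp: in_set_conv_nth)
    ultimately have "reclaiming_piece ?H i q \<and> piece_range ?H i = {l..r}"
      using legs[of i "Reclaim q d" y z] by (auto simp: reclaiming_piece_def acts)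
    then show ?thesis by blast
  qed
  ultimately show ?thesis
    unfolding unimodal_trip_def using trip by blast
qed

end

section \<open>Pairs of unimodal trips\<close>

definition compatible :: "real \<Rightarrow> rpath \<Rightarrow> rpath \<Rightarrow> bool" where
  "compatible L A B \<longleftrightarrow> (\<forall>t\<ge>0. pos A t + pos B t \<le> L)"

definition unimodal_pair ::
    "real \<Rightarrow> real \<Rightarrow> (pad \<Rightarrow> (real \<times> real) list) \<Rightarrow> (pad \<Rightarrow> (real \<times> real) list) \<Rightarrow> rpath \<Rightarrow> rpath \<Rightarrow> bool"
  where "unimodal_pair s L V W A B \<longleftrightarrow>
    (\<exists>p. unimodal_trip s L V p A) \<and> (\<exists>p. unimodal_trip s L W p B) \<and> compatible L A B"

definition pair_makespan :: "rpath \<Rightarrow> rpath \<Rightarrow> real" where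
  "pair_makespan A B = max (finish A) (finish B)"

text \<open>The duration of a canonical trip without a wait and, by \<open>turn_bounds\<close>, a
  lower bound for every unimodal trip with this work. The order of the pads does not matter.\<close>

definition solo_time :: "real \<Rightarrow> (pad \<Rightarrow> (real \<times> real) list) \<Rightarrow> real" where
  "solo_time s W = pot s (W P1) (extent W) + pot s (W P2) (extent W)"

text \<open>With extent 0 a canonical trip would not move at all, contrary to
  \<open>turns_once\<close>, so this case is treated apart.\<close>

definition idle :: "(pad \<Rightarrow> (real \<times> real) list) \<Rightarrow> bool" where
  "idle W \<longleftrightarrow> (\<forall>q. W q = [])"

lemma compatible_commute: "compatible L A B \<longleftrightarrow> compatible L B A"
  by (simp add: compatible_def add.commute)

lemma unimodal_pair_commute: "unimodal_pair s L V W A B \<longleftrightarrow> unimodal_pair s L W V B A"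
  by (auto simp: unimodal_pair_def compatible_commute)

lemma pair_makespan_commute: "pair_makespan A B = pair_makespan B A"
  by (simp add: pair_makespan_def max.commute)

lemma extent_ge: "(l, r) \<in> set (W q) \<Longrightarrow> r \<le> extent W"
  unfolding extent_def by (cases q) (force intro!: Max_ge)+

lemma extent_le:
  assumes "\<And>q l r. (l, r) \<in> set (W q) \<Longrightarrow> r \<le> c" "0 \<le> c"
  shows "extent W \<le> c"
  unfolding extent_def using assms by (subst Max_le_iff) auto

lemma pile_chain_extent: "pile_chain 0 L (W q) \<Longrightarrow> pile_chain 0 (extent W) (W q)"
  using extent_ge by (fastforce simp: pile_chain_def)

lemma extent_pos:
  assumes "\<And>q. pile_chain 0 L (W q)" "\<not> idle W"
  shows "0 < extent W"
proof -
  obtain q l r where "(l, r) \<in> set (W q)"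
    using assms(2) by (metis idle_def list.set_intros(1) neq_Nil_conv surj_pair)
  then show ?thesis
    using extent_ge[of l r W q] assms(1)[of q] by (auto simp: pile_chain_def)
qed

lemma extent_le_length: "(\<And>q. pile_chain 0 L (W q)) \<Longrightarrow> 0 \<le> L \<Longrightarrow> extent W \<le> L"
  by (rule extent_le) (force simp: pile_chain_def)+

lemma canonical_extent:
  assumes "1 \<le> s" "\<And>q. pile_chain 0 L (W q)" "\<not> idle W"
  shows "canonical s W (extent W)"
  using assms extent_pos[OF assms(2,3)] pile_chain_extent[OF assms(2)] by unfold_locales

lemma pot_above:
  assumes "pile_chain a X xs" "\<And>l r. (l, r) \<in> set xs \<Longrightarrow> r \<le> x"
  shows "pot s xs x = x / s + (1 - 1 / s) * total_length xs"
  using covered_length_above[of xs x] assms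
  by (fastforce simp: pot_def pile_chain_def total_length_def)

lemma solo_time_other: "solo_time s W = pot s (W p) (extent W) + pot s (W (other p)) (extent W)"
  by (cases p) (auto simp: solo_time_def)

lemma solo_time_eq:
  assumes "\<And>q. pile_chain 0 L (W q)"
  shows "solo_time s W = 2 * extent W / s + (1 - 1 / s) * (total_length (W P1) + total_length (W P2))"
  using pot_above[OF assms[of P1] extent_ge] pot_above[OF assms[of P2] extent_ge]
  by (simp add: solo_time_def algebra_simps)

lemma total_length_nonneg: "pile_chain a X xs \<Longrightarrow> 0 \<le> total_length xs"
  unfolding total_length_def by (intro sum_list_nonneg) (auto simp: pile_chain_def)

lemma extent_le_turn:
  assumes H: "trip s L H" and "turns_at s W p H \<tau>"
  shows "extent W \<le> pos H \<tau>"
  using assms trip_nonneg[OF H, of \<tau>] by (intro extent_le) (auto simp: turns_at_def)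

text \<open>Up to the turn the potential of the outward pad rises from 0 to at least its value at
  the extent, which takes at least that much time; the return is symmetric.\<close>

lemma turn_bounds:
  assumes H: "trip s L H" and s: "1 \<le> s" and W: "\<And>q. pile_chain 0 L (W q)"
    and turn: "turns_at s W p H \<tau>"
  shows "pot s (W p) (extent W) \<le> \<tau>" "\<tau> + pot s (W (other p)) (extent W) \<le> finish H"
    "solo_time s W \<le> finish H"
proof -
  have \<tau>: "0 \<le> \<tau>" "\<tau> \<le> finish H" using turn by (auto simp: turns_at_def)
  note ext = extent_le_turn[OF H turn]
  have "pot s (W p) (pos H \<tau>) - pot s (W p) (pos H 0) \<le> \<tau> - 0"
    using turn \<tau> unfolding turns_at_def by blast
  moreover have "pos H 0 = 0" using H by (simp add: trip_def)
  ultimately show 1: "pot s (W p) (extent W) \<le> \<tau>"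
    using pot_mono[OF s ext, of "W p"] by (simp add: pot_0[OF W])
  have "pot s (W (other p)) (pos H \<tau>) - pot s (W (other p)) (pos H (finish H)) \<le> finish H - \<tau>"
    using turn \<tau> unfolding turns_at_def by blast
  then show 2: "\<tau> + pot s (W (other p)) (extent W) \<le> finish H"
    using pot_mono[OF s ext, of "W (other p)"] by (simp add: pot_0[OF W] trip_after[OF H])
  show "solo_time s W \<le> finish H"
    using 1 2 by (simp add: solo_time_other[of s W p])
qed

lemma solo_time_le_finish:
  assumes "unimodal_trip s L W p H" "1 \<le> s" "\<And>q. pile_chain 0 L (W q)"
  shows "solo_time s W \<le> finish H"
proof -
  obtain \<tau> where "turns_at s W p H \<tau>" using unimodal_trip_turns_at[OF assms] .
  then show ?thesis
    using turn_bounds(3)[OF _ assms(2,3)] assms(1) by (simp add: unimodal_trip_def)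
qed

text \<open>If \<open>A\<close> turns first, then \<open>A\<close> may as well run without any waiting, and \<open>B\<close> may do all its
  waiting at home.  Up to the turning time of \<open>A\<close> the new paths are bounded by the old positions
  at that time, later the new paths are both closer to home than the old ones.\<close>

lemma canonical_exchange:
  assumes s: "1 \<le> s" and V: "\<And>q. pile_chain 0 L (V q)" and W: "\<And>q. pile_chain 0 L (W q)"
    and ne: "\<not> idle V" "\<not> idle W"
    and A: "trip s L A" "turns_at s V p A \<tau>" and B: "trip s L B" "turns_at s W q B \<upsilon>"
    and AB: "compatible L A B" and order: "\<tau> \<le> \<upsilon>"
  shows "compatible L (canonical_trip s V (extent V) p 0)
    (canonical_trip s W (extent W) q (finish B - solo_time s W))"
proof -
  interpret V: canonical s V "extent V" by (rule canonical_extent[OF s V ne(1)])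
  interpret W: canonical s W "extent W" by (rule canonical_extent[OF s W ne(2)])
  \<comment> \<open>With this wait the new \<open>B\<close> finishes exactly when the old one
    did.\<close>
  define \<delta> where "\<delta> = finish B - solo_time s W"
  let ?A = "canonical_trip s V (extent V) p 0" and ?B = "canonical_trip s W (extent W) q \<delta>"
  note tA = turn_bounds[OF A(1) s V A(2)] and tB = turn_bounds[OF B(1) s W B(2)]
  have \<tau>: "0 \<le> \<tau>" using A(2) by (simp add: turns_at_def)
  have \<delta>: "0 \<le> \<delta>" "\<upsilon> \<le> \<delta> + W.T q"
    using tB by (simp_all add: \<delta>_def solo_time_other[of s W q])
  \<comment> \<open>The old \<open>B\<close> can gain at most \<open>\<upsilon> - t\<close> more
    until its turn, so at time \<open>t\<close> it has gained at least \<open>t - \<delta>\<close>,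
    which is all that the new one has gained if it has left home.\<close>
  have b_le: "pos ?B t \<le> pos B t" if "0 \<le> t" "t \<le> \<upsilon>" for t
  proof -
    have "pot s (W q) (pos B \<upsilon>) - pot s (W q) (pos B t) \<le> \<upsilon> - t"
      using B(2) that unfolding turns_at_def by blast
    then have "t - \<delta> \<le> pot s (W q) (pos B t)"
      using pot_mono[OF s extent_le_turn[OF B], of "W q"] \<delta> by linarith
    then show ?thesis
      using W.pos_canonical_out[of \<delta> t q] \<delta> that W.e_le[OF trip_nonneg[OF B(1)]] by simp
  qed
  \<comment> \<open>The same in reversed time: the potential left to the new \<open>A\<close> is its
    remaining running time, while the old \<open>A\<close> has lost at most
    \<open>t - \<tau>\<close> since its turn.\<close>
  have a_le: "pos ?A t \<le> pos A t" if "\<tau> \<le> t" for t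
  proof -
    have "pot s (V (other p)) (pos A \<tau>) - pot s (V (other p)) (pos A t) \<le> t - \<tau>"
      using A(2) that unfolding turns_at_def by blast
    then have "V.T p + V.T (other p) - t \<le> pot s (V (other p)) (pos A t)"
      using pot_mono[OF s extent_le_turn[OF A], of "V (other p)"] tA by linarith
    then show ?thesis
      using V.pos_canonical_in[of 0 p t] tA that \<tau> V.e_le[OF trip_nonneg[OF A(1)]] by simp
  qed
  have AB': "pos A t + pos B t \<le> L" if "0 \<le> t" for t
    using AB that by (simp add: compatible_def)
  have "pos ?A t + pos ?B t \<le> L" if t: "0 \<le> t" for t
  proof -
    consider "t \<le> \<tau>" | "\<tau> \<le> t" "t \<le> \<upsilon>" | "\<upsilon> \<le> t" by linarith
    then show ?thesis
    proof cases
      case 1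
      have "pos B t \<le> pos B \<tau>"
        using B(2) t 1 order unfolding turns_at_def by blast
      then show ?thesis
        using V.pos_canonical_bounds(2)[of 0 p t] extent_le_turn[OF A] b_le[of t] t 1 order AB'[OF \<tau>]
        by simp
    next
      case 2
      then show ?thesis
        using a_le[of t] b_le[of t] t AB'[of t] by simp
    next
      \<comment> \<open>Past both turns the new \<open>B\<close> is bounded by its extent, hence by
        the old position at \<open>\<upsilon>\<close>, and the new \<open>A\<close> is no farther
        out than it was at \<open>\<upsilon>\<close>.\<close>
      case 3
      have "pos ?A t \<le> pos ?A \<upsilon>"
        using V.pos_canonical_in[of 0 p t] V.pos_canonical_in[of 0 p \<upsilon>] tA order 3
        by (simp add: V.e_mono)
      also have "\<dots> \<le> pos A \<upsilon>" by (rule a_le[OF order])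
      finally show ?thesis
        using W.pos_canonical_bounds(2)[OF \<delta>(1), of q t] extent_le_turn[OF B] AB'[of \<upsilon>] \<tau> order
        by simp
    qed
  qed
  then show ?thesis by (simp add: compatible_def \<delta>_def)
qed

lemma unimodal_pair_canonical:
  assumes "1 \<le> s" "0 \<le> L" "\<And>q. pile_chain 0 L (V q)" "\<And>q. pile_chain 0 L (W q)"
    "\<not> idle V" "\<not> idle W" "0 \<le> \<delta>" "0 \<le> \<delta>'"
    "compatible L (canonical_trip s V (extent V) p \<delta>) (canonical_trip s W (extent W) q \<delta>')"
  shows "unimodal_pair s L V W (canonical_trip s V (extent V) p \<delta>) (canonical_trip s W (extent W) q \<delta>')"
    "pair_makespan (canonical_trip s V (extent V) p \<delta>) (canonical_trip s W (extent W) q \<delta>') =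
      max (\<delta> + solo_time s V) (\<delta>' + solo_time s W)"
proof -
  interpret V: canonical s V "extent V" by (rule canonical_extent[OF assms(1,3,5)])
  interpret W: canonical s W "extent W" by (rule canonical_extent[OF assms(1,4,6)])
  show "unimodal_pair s L V W (canonical_trip s V (extent V) p \<delta>) (canonical_trip s W (extent W) q \<delta>')"
    unfolding unimodal_pair_def
    using V.unimodal_canonical[OF assms(7)] W.unimodal_canonical[OF assms(8)]
      extent_le_length[where W = V, OF assms(3,2)] extent_le_length[where W = W, OF assms(4,2)] assms(9) by blast
  show "pair_makespan (canonical_trip s V (extent V) p \<delta>) (canonical_trip s W (extent W) q \<delta>') =
      max (\<delta> + solo_time s V) (\<delta>' + solo_time s W)"
    using assms(7,8) by (simp add: pair_makespan_def V.finish_canonical W.finish_canonical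
        solo_time_other[of s V p] solo_time_other[of s W q] add.assoc)
qed

text \<open>For fixed outward pads the wait of \<open>B\<close> is the only free parameter.
  Admissible waits form a closed set bounded below, so there is a smallest one. By
  \<open>canonical_exchange\<close> every pair in which \<open>A\<close> turns first is matched by
  one of these candidates, at most one for each choice of the two pads.\<close>

lemma first_turner_attained:
  assumes s: "1 \<le> s" and L: "0 \<le> L"
    and V: "\<And>q. pile_chain 0 L (V q)" and W: "\<And>q. pile_chain 0 L (W q)"
    and ne: "\<not> idle V" "\<not> idle W"
  obtains K where "finite K" "K \<noteq> {}" "\<And>A B. (A, B) \<in> K \<Longrightarrow> unimodal_pair s L V W A B"
    "\<And>A B p q \<tau> \<upsilon>. \<lbrakk>unimodal_pair s L V W A B; turns_at s V p A \<tau>; turns_at s W q B \<upsilon>; \<tau> \<le> \<upsilon>\<rbrakk> \<Longrightarrow>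
      \<exists>(A', B')\<in>K. pair_makespan A' B' \<le> pair_makespan A B"
proof -
  interpret V: canonical s V "extent V" by (rule canonical_extent[OF s V ne(1)])
  interpret W: canonical s W "extent W" by (rule canonical_extent[OF s W ne(2)])
  let ?A = "\<lambda>p. canonical_trip s V (extent V) p 0" and ?B = "canonical_trip s W (extent W)"
  define F where "F p q = {\<delta>. 0 \<le> \<delta> \<and> compatible L (?A p) (?B q \<delta>)}" for p q
  have closed: "closed (F p q)" for p q
  proof -
    \<comment> \<open>Freedom from clashes is an intersection over \<open>t\<close> of conditions
      that are closed because positions depend continuously on \<open>\<delta>\<close>.\<close>
    have "F p q = {\<delta>. 0 \<le> \<delta>} \<inter> {\<delta>. \<forall>t\<in>{0..}. pos (?A p) t +
        (W.e q (t - \<delta>) + W.e (other q) (\<delta> + W.T q + W.T (other q) - t) - extent W) \<le> L}"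
      using W.pos_canonical[of _ q] by (auto simp: F_def compatible_def)
    moreover have "continuous_on UNIV (W.e q')" for q'
      unfolding earliest_def by (rule continuous_course)
    then have cont: "continuous_on UNIV (\<lambda>\<delta>. W.e q' (g \<delta>))" if "continuous_on UNIV g" for q' and g :: "real \<Rightarrow> real"
      using continuous_on_compose2[of UNIV "W.e q'" UNIV g] that by auto
    have "closed {\<delta>. pos (?A p) t +
        (W.e q (t - \<delta>) + W.e (other q) (\<delta> + W.T q + W.T (other q) - t) - extent W) \<le> L}" for t
      by (intro closed_Collect_le continuous_intros cont)
    then have "closed {\<delta>. \<forall>t\<in>{0..}. pos (?A p) t +
        (W.e q (t - \<delta>) + W.e (other q) (\<delta> + W.T q + W.T (other q) - t) - extent W) \<le> L}"
      unfolding Ball_def by (intro closed_Collect_all closed_Collect_imp) auto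
    ultimately show ?thesis
      using closed_Int[OF closed_atLeast[of 0]] by (simp add: atLeast_def)
  qed
  have bdd: "bdd_below (F p q)" for p q
    by (intro bdd_belowI[of _ 0]) (simp add: F_def)
  have Inf_F: "Inf (F p q) \<in> F p q" if "F p q \<noteq> {}" for p q
    using closed_contains_Inf[OF that bdd closed] .
  have pads: "(UNIV :: pad set) = {P1, P2}"
    using pad.exhaust by auto
  define K where "K = (\<lambda>(p, q). (?A p, ?B q (Inf (F p q)))) ` {(p, q). F p q \<noteq> {}}"
  have pairs: "unimodal_pair s L V W (?A p) (?B q \<delta>)"
    "pair_makespan (?A p) (?B q \<delta>) = max (solo_time s V) (\<delta> + solo_time s W)" if "\<delta> \<in> F p q" for p q \<delta>
    using unimodal_pair_canonical[OF s L V W ne, of 0 \<delta> p q] that by (auto simp: F_def)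
  show thesis
  proof (rule that)
    have "finite (UNIV :: (pad \<times> pad) set)"
      by (metis finite.emptyI finite.insertI finite_Prod_UNIV pads)
    then have "finite {(p, q). F p q \<noteq> {}}"
      by (rule finite_subset[OF subset_UNIV])
    then show "finite K" by (simp add: K_def)
    \<comment> \<open>This wait is always admissible: \<open>B\<close> leaves home only when
      \<open>A\<close> is back.\<close>
    have "pos (?A P1) t + pos (?B P1 (solo_time s V)) t \<le> L" if "0 \<le> t" for t
    proof (cases "t \<le> solo_time s V")
      case True
      then show ?thesis
        using W.pos_canonical_out[of "solo_time s V" t P1] V.T_pos[of P1] V.T_pos[of P2] W.T_pos[of P1]
          W.e_before[of "t - solo_time s V" P1] V.pos_canonical_bounds(2)[of 0 P1 t]
          extent_le_length[where W = V, OF V L] by (simp add: solo_time_def)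
    next
      case False
      then show ?thesis
        using V.pos_canonical_after[of 0 P1 t] V.T_pos[of P1] V.T_pos[of P2]
          W.pos_canonical_bounds(2)[of "solo_time s V" P1 t] extent_le_length[where W = W, OF W L]
        by (simp add: solo_time_def)
    qed
    then have "solo_time s V \<in> F P1 P1"
      using V.T_pos[of P1] V.T_pos[of P2] by (simp add: F_def compatible_def solo_time_def)
    then show "K \<noteq> {}" by (auto simp: K_def)
    show "unimodal_pair s L V W A B" if AB: "(A, B) \<in> K" for A B
    proof -
      obtain p q where "F p q \<noteq> {}" "A = ?A p" "B = ?B q (Inf (F p q))"
        using AB by (auto simp: K_def)
      then show ?thesis using pairs(1)[OF Inf_F] by simp
    qed
    show "\<exists>(A', B')\<in>K. pair_makespan A' B' \<le> pair_makespan A B"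
      if AB: "unimodal_pair s L V W A B" "turns_at s V p A \<tau>" "turns_at s W q B \<upsilon>" "\<tau> \<le> \<upsilon>"
      for A B p q \<tau> \<upsilon>
    proof -
      have trips: "trip s L A" "trip s L B"
        using AB(1) by (auto simp: unimodal_pair_def unimodal_trip_def)
      have "finish B - solo_time s W \<in> F p q"
        using canonical_exchange[OF s V W ne trips(1) AB(2) trips(2) AB(3) _ AB(4)] AB(1)
          turn_bounds(3)[OF trips(2) s W AB(3)] by (auto simp: F_def unimodal_pair_def)
      then have "Inf (F p q) \<le> finish B - solo_time s W" and ne: "F p q \<noteq> {}"
        using cInf_lower[OF _ bdd] by auto
      then have "pair_makespan (?A p) (?B q (Inf (F p q))) \<le> pair_makespan A B"
        using turn_bounds(3)[OF trips(1) s V AB(2)] pairs(2)[OF Inf_F[OF ne]] by (auto simp: pair_makespan_def)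
      moreover have "(?A p, ?B q (Inf (F p q))) \<in> K"
        using ne by (auto simp: K_def)
      ultimately show ?thesis by blast
    qed
  qed
qed

text \<open>A reclaimer without work makes a short trip right at the start.\<close>

lemma idle_partner:
  assumes s: "1 \<le> s" and L: "0 < L" and W: "\<And>q. pile_chain 0 L (W q)"
    and "idle V" "\<not> idle W"
  shows "\<exists>A B. unimodal_pair s L V W A B \<and> pair_makespan A B = solo_time s W"
proof -
  interpret W: canonical s W "extent W" by (rule canonical_extent[OF s W \<open>\<not> idle W\<close>])
  \<comment> \<open>The short trip lasts \<open>2 * \<epsilon> / s\<close>, and until then
    \<open>B\<close> is at most \<open>2 * \<epsilon>\<close> away from its home; with
    \<open>3 * \<epsilon> \<le> L\<close> there is no clash. The bound by the extent makes the short
    trip end no later than \<open>B\<close>.\<close>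
  define \<epsilon> where "\<epsilon> = min (L / 3) (extent W)"
  have \<epsilon>: "0 < \<epsilon>" "3 * \<epsilon> \<le> L" "\<epsilon> \<le> extent W"
    using L W.X by (auto simp: \<epsilon>_def)
  interpret V: canonical s V \<epsilon>
    using s \<epsilon> \<open>idle V\<close> by unfold_locales (auto simp: idle_def)
  have T: "V.T p = \<epsilon> / s" for p
    using \<open>idle V\<close> by (simp add: pot_def idle_def)
  let ?A = "canonical_trip s V \<epsilon> P1 0" and ?B = "canonical_trip s W (extent W) P1 0"
  have "pos ?A t + pos ?B t \<le> L" if t: "0 \<le> t" for t
  proof (cases "t \<le> 2 * \<epsilon> / s")
    case True
    have "W.e P1 t \<le> s * t"
      using W.e_Lipschitz[of 0 t P1] W.e_before[of 0 P1] t by simp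
    also have "\<dots> \<le> 2 * \<epsilon>"
      using True s by (simp add: field_simps)
    finally have "pos ?B t \<le> 2 * \<epsilon>"
      using W.pos_canonical[of 0 P1 t] W.e_le_X[of P2 "W.T P1 + W.T P2 - t"] by simp
    then show ?thesis
      using V.pos_canonical_bounds(2)[of 0 P1 t] \<epsilon> by simp
  next
    case False
    then show ?thesis
      using V.pos_canonical_after[of 0 P1 t] W.pos_canonical_bounds(2)[of 0 P1 t]
        extent_le_length[where W = W, OF W] L by (simp add: T)
  qed
  then have "unimodal_pair s L V W ?A ?B"
    unfolding unimodal_pair_def compatible_def
    using V.unimodal_canonical[of 0 L P1] W.unimodal_canonical[of 0 L P1] \<epsilon> extent_le_length[where W = W, OF W] L
    by auto
  moreover have "\<epsilon> / s \<le> extent W / s"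
    using \<epsilon> s by (intro divide_right_mono) auto
  then have "pair_makespan ?A ?B = solo_time s W"
    using W.T_ge[of P1] W.T_ge[of P2] \<epsilon> s
    by (simp add: pair_makespan_def V.finish_canonical W.finish_canonical T solo_time_def)
  ultimately show ?thesis by blast
qed

text \<open>Either reclaimer may turn first. Both orders yield finitely many candidates, and a best
  one among them is optimal. If one reclaimer is idle, the solo time of the other is both attained
  and a lower bound.\<close>

lemma unimodal_pair_attained:
  assumes s: "1 \<le> s" and L: "0 < L"
    and V: "\<And>q. pile_chain 0 L (V q)" and W: "\<And>q. pile_chain 0 L (W q)"
    and "\<not> (idle V \<and> idle W)"
  shows "\<exists>A B. unimodal_pair s L V W A B \<and>
    (\<forall>A' B'. unimodal_pair s L V W A' B' \<longrightarrow> pair_makespan A B \<le> pair_makespan A' B')"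
proof -
  have solo: "solo_time s V \<le> pair_makespan A B" "solo_time s W \<le> pair_makespan A B" if "unimodal_pair s L V W A B" for A B
    using that solo_time_le_finish[OF _ s V] solo_time_le_finish[OF _ s W]
    unfolding unimodal_pair_def pair_makespan_def by (meson max.coboundedI1 max.coboundedI2)+
  consider "idle V" "\<not> idle W" | "\<not> idle V" "idle W" | "\<not> idle V" "\<not> idle W"
    using assms by blast
  then show ?thesis
  proof cases
    case 1
    then obtain A B where "unimodal_pair s L V W A B" "pair_makespan A B = solo_time s W"
      using idle_partner[where V = V and W = W, OF s L W 1] by blast
    then show ?thesis
      using solo by - (rule exI[of _ A], rule exI[of _ B], simp)
  next
    case 2
    then obtain A B where "unimodal_pair s L V W B A" "pair_makespan B A = solo_time s V"
      using idle_partner[where V = W and W = V, OF s L V 2(2,1)]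
      by (auto simp: unimodal_pair_commute[of s L W V] pair_makespan_commute)
    then show ?thesis
      using solo(1) by - (rule exI[of _ B], rule exI[of _ A], simp)
  next
    case 3
    obtain K where K: "finite K" "K \<noteq> {}" "\<And>A B. (A, B) \<in> K \<Longrightarrow> unimodal_pair s L V W A B"
      "\<And>A B p q \<tau> \<upsilon>. \<lbrakk>unimodal_pair s L V W A B; turns_at s V p A \<tau>; turns_at s W q B \<upsilon>; \<tau> \<le> \<upsilon>\<rbrakk> \<Longrightarrow>
        \<exists>(A', B')\<in>K. pair_makespan A' B' \<le> pair_makespan A B"
      by (rule first_turner_attained[where V = V and W = W, OF s less_imp_le[OF L] V W 3]) (rule that)
    obtain K' where K': "finite K'" "K' \<noteq> {}" "\<And>A B. (A, B) \<in> K' \<Longrightarrow> unimodal_pair s L W V A B"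
      "\<And>A B p q \<tau> \<upsilon>. \<lbrakk>unimodal_pair s L W V A B; turns_at s W p A \<tau>; turns_at s V q B \<upsilon>; \<tau> \<le> \<upsilon>\<rbrakk> \<Longrightarrow>
        \<exists>(A', B')\<in>K'. pair_makespan A' B' \<le> pair_makespan A B"
      by (rule first_turner_attained[where V = W and W = V, OF s less_imp_le[OF L] W V 3(2,1)]) (rule that)
    define M where "M = K \<union> prod.swap ` K'"
    have pairs: "unimodal_pair s L V W A B" if "(A, B) \<in> M" for A B
      using that K(3) K'(3) unimodal_pair_commute by (auto simp: M_def)
    have dominated: "\<exists>(A', B')\<in>M. pair_makespan A' B' \<le> pair_makespan A B" if AB: "unimodal_pair s L V W A B" for A B
    proof -
      obtain p q where pq: "unimodal_trip s L V p A" "unimodal_trip s L W q B"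
        using AB by (auto simp: unimodal_pair_def)
      obtain \<tau> where \<tau>: "turns_at s V p A \<tau>" using unimodal_trip_turns_at[OF pq(1) s V] .
      obtain \<upsilon> where \<upsilon>: "turns_at s W q B \<upsilon>" using unimodal_trip_turns_at[OF pq(2) s W] .
      show ?thesis
      proof (cases "\<tau> \<le> \<upsilon>")
        case True
        then show ?thesis using K(4)[OF AB \<tau> \<upsilon>] by (auto simp: M_def)
      next
        case False
        then obtain A' B' where "(B', A') \<in> K'" "pair_makespan B' A' \<le> pair_makespan B A"
          using K'(4)[OF AB[unfolded unimodal_pair_commute[of s L V W]] \<upsilon> \<tau>] by auto
        then show ?thesis
          by (intro bexI[of _ "(A', B')"]) (auto simp: M_def pair_makespan_commute)
      qed
    qed
    have "finite M" "M \<noteq> {}" using K K' by (auto simp: M_def)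
    then obtain A B where AB: "(A, B) \<in> M" and least: "\<And>A' B'. (A', B') \<in> M \<Longrightarrow> pair_makespan A B \<le> pair_makespan A' B'"
      using ex_min_if_finite[of "(\<lambda>(A, B). pair_makespan A B) ` M"] by (force simp: not_less)
    have "pair_makespan A B \<le> pair_makespan A' B'" if pair: "unimodal_pair s L V W A' B'" for A' B'
    proof -
      obtain A'' B'' where "(A'', B'') \<in> M" "pair_makespan A'' B'' \<le> pair_makespan A' B'"
        using dominated[OF pair] by auto
      then show ?thesis using least[of A'' B''] by simp
    qed
    then show ?thesis using pairs[OF AB] by blast
  qed
qed

section \<open>Upper bounds for the best pair of trips\<close>

lemma no_conflict:
  assumes s: "1 \<le> s" and L: "0 < L"
    and V: "\<And>q. pile_chain 0 L (V q)" and W: "\<And>q. pile_chain 0 L (W q)"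
    and "\<not> (idle V \<and> idle W)" "extent V + extent W \<le> L"
  shows "\<exists>A B. unimodal_pair s L V W A B \<and> pair_makespan A B \<le> max (solo_time s V) (solo_time s W)"
proof -
  consider "idle V" "\<not> idle W" | "\<not> idle V" "idle W" | "\<not> idle V" "\<not> idle W"
    using assms by blast
  then show ?thesis
  proof cases
    case 1
    then obtain A B where "unimodal_pair s L V W A B" "pair_makespan A B = solo_time s W"
      using idle_partner[where V = V and W = W, OF s L W 1] by blast
    then show ?thesis
      by - (rule exI[of _ A], rule exI[of _ B], simp)
  next
    case 2
    then obtain A B where "unimodal_pair s L V W B A" "pair_makespan B A = solo_time s V"
      using idle_partner[where V = W and W = V, OF s L V 2(2,1)]
      by (auto simp: unimodal_pair_commute[of s L W V] pair_makespan_commute)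
    then show ?thesis
      by - (rule exI[of _ B], rule exI[of _ A], simp)
  next
    case 3
    interpret V: canonical s V "extent V" by (rule canonical_extent[OF s V 3(1)])
    interpret W: canonical s W "extent W" by (rule canonical_extent[OF s W 3(2)])
    have "pos (canonical_trip s V (extent V) P1 0) t + pos (canonical_trip s W (extent W) P1 0) t \<le> L" for t
      using V.pos_canonical_bounds(2)[of 0 P1 t] W.pos_canonical_bounds(2)[of 0 P1 t] assms(6) by simp
    then show ?thesis
      using unimodal_pair_canonical[OF s _ V W 3, of 0 0 P1 P1] L
      by (intro exI[of _ "canonical_trip s V (extent V) P1 0"]
          exI[of _ "canonical_trip s W (extent W) P1 0"]) (auto simp: compatible_def)
  qed
qed

text \<open>In the coordinates of \<open>A\<close>, \<open>B\<close> never passes \<open>b\<close>,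
  and beyond \<open>b\<close> there is nothing for \<open>A\<close> to reclaim on the way back.
  \<open>B\<close> is delayed so that it does not get to the turning point of \<open>A\<close>
  before \<open>A\<close> turns there. Then \<open>A\<close> retreats at full speed as far as
  \<open>b\<close>, and \<open>B\<close> cannot close up. In the resulting bound the outward work of
  \<open>B\<close> cancels: it lies within \<open>L - extent V\<close>, so with a positive wait the
  time that \<open>B\<close> spends on it is hidden in the outward time of \<open>A\<close>.\<close>

lemma follow:
  assumes s: "1 \<le> s" and L: "0 < L"
    and V: "\<And>q. pile_chain 0 L (V q)" and W: "\<And>q. pile_chain 0 L (W q)"
    and ne: "\<not> idle V" "\<not> idle W"
    and b: "0 \<le> b" "b \<le> extent V" "extent W \<le> L - b" and conflict: "L < extent V + extent W"
    and Vb: "\<And>l r. (l, r) \<in> set (V (other p)) \<Longrightarrow> r \<le> b"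
    and Wp: "\<And>l r. (l, r) \<in> set (W p) \<Longrightarrow> r \<le> L - extent V"
  shows "\<exists>A B. unimodal_pair s L V W A B \<and> pair_makespan A B \<le> max (max (solo_time s V) (solo_time s W))
    ((2 * extent V + 2 * extent W - L) / s +
      (1 - 1 / s) * (total_length (V p) + total_length (W (other p))))"
proof -
  let ?X = "extent V" and ?Y = "extent W" and ?q = "other p"
  interpret V: canonical s V ?X by (rule canonical_extent[OF s V ne(1)])
  interpret W: canonical s W ?Y by (rule canonical_extent[OF s W ne(2)])
  have XL: "?X \<le> L" using extent_le_length[where W = V, OF V] L by simp
  \<comment> \<open>The amount by which \<open>B\<close>, starting at once, would be early at the
    turning point of \<open>A\<close>.\<close>
  define \<delta> where "\<delta> = max 0 (V.T p - pot s (W p) (L - ?X))"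
  let ?A = "canonical_trip s V ?X p 0" and ?B = "canonical_trip s W ?Y p \<delta>"
  have \<delta>: "0 \<le> \<delta>" "V.T p - \<delta> \<le> pot s (W p) (L - ?X)" by (auto simp: \<delta>_def)
  have B_le: "pos ?B t \<le> W.e p (t - \<delta>)" for t
    using W.pos_canonical[OF \<delta>(1), of p t] W.e_le_X[of ?q "\<delta> + W.T p + W.T ?q - t"] by simp
  have eW: "W.e p (V.T p - \<delta>) \<le> L - ?X"
    using W.e_le[of "L - ?X" "V.T p - \<delta>" p] \<delta>(2) XL by simp
  have "pos ?A t + pos ?B t \<le> L" if t: "0 \<le> t" for t
  proof (cases "t \<le> V.T p")
    case True
    then have "pos ?B t \<le> L - ?X"
      using B_le[of t] W.e_mono[of "t - \<delta>" "V.T p - \<delta>" p] eW by simp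
    then show ?thesis
      using V.pos_canonical_bounds(2)[of 0 p t] by simp
  next
    case False
    \<comment> \<open>The distance that full speed covers since the turn of \<open>A\<close>:
      \<open>B\<close> advances by at most \<open>u\<close>, and \<open>A\<close> has withdrawn by
      \<open>u\<close> or down to \<open>b\<close>.\<close>
    define u where "u = s * (t - V.T p)"
    have u: "0 \<le> u" using False s by (simp add: u_def)
    have "W.e p (t - \<delta>) - W.e p (V.T p - \<delta>) \<le> s * (max 0 (t - \<delta>) - max 0 (V.T p - \<delta>))"
      using False by (intro W.e_Lipschitz) simp
    also have "\<dots> \<le> u"
      unfolding u_def using False s by (intro mult_left_mono) auto
    finally have B1: "pos ?B t \<le> L - ?X + u"
      using B_le[of t] eW by simp
    define x where "x = max b (?X - u)"
    have x: "0 \<le> x" "b \<le> x" "x \<le> ?X" "?X - x \<le> u" using b u by (auto simp: x_def)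
    \<comment> \<open>The piles of the return pad end at \<open>b\<close> or before, so between
      \<open>x\<close> and the turning point the potential counts travel only.\<close>
    have "V.T ?q = ?X / s + (1 - 1 / s) * total_length (V ?q)"
      "pot s (V ?q) x = x / s + (1 - 1 / s) * total_length (V ?q)"
      using pot_above[OF V, of ?q] Vb x by (meson order.trans)+
    moreover have "(?X - x) / s \<le> t - V.T p"
      using x(4) s by (simp add: u_def pos_divide_le_eq mult.commute)
    ultimately have "V.T p + V.T ?q - t \<le> pot s (V ?q) x"
      by (simp add: diff_divide_distrib)
    then have "pos ?A t \<le> x"
      using V.e_le[of x _ ?q] x(1) V.pos_canonical_in[of 0 p t] False by simp
    then show ?thesis
      using B1 W.pos_canonical_bounds(2)[OF \<delta>(1), of p t] b by (auto simp: x_def max_def split: if_splits)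
  qed
  then have "compatible L ?A ?B" by (simp add: compatible_def)
  note pair = unimodal_pair_canonical[OF s less_imp_le[OF L] V W ne order_refl \<delta>(1) this]
  have "\<delta> + solo_time s W \<le> max (solo_time s W) ((2 * ?X + 2 * ?Y - L) / s +
      (1 - 1 / s) * (total_length (V p) + total_length (W ?q)))"
  proof (cases "\<delta> = 0")
    case False
    then have "\<delta> = V.T p - pot s (W p) (L - ?X)" by (simp add: \<delta>_def)
    moreover have "V.T p = ?X / s + (1 - 1 / s) * total_length (V p)"
      using pot_above[OF V extent_ge] .
    moreover have "pot s (W p) (L - ?X) = (L - ?X) / s + (1 - 1 / s) * total_length (W p)"
      using pot_above[OF W Wp] .
    moreover have "W.T p = ?Y / s + (1 - 1 / s) * total_length (W p)"
      using pot_above[OF W extent_ge] .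
    moreover have "W.T ?q = ?Y / s + (1 - 1 / s) * total_length (W ?q)"
      using pot_above[OF W extent_ge] .
    ultimately have "\<delta> + solo_time s W = (2 * ?X + 2 * ?Y - L) / s +
        (1 - 1 / s) * (total_length (V p) + total_length (W ?q))"
      by (simp only: solo_time_other[of s W p])
        (simp add: diff_divide_distrib add_divide_distrib distrib_left)
    then show ?thesis by simp
  qed simp
  then show ?thesis
    using pair by - (rule exI[of _ ?A], rule exI[of _ ?B], auto)
qed

text \<open>The workload f(L) of the whole instance, written in terms of the two shares (see
  \<open>potential_L\<close>).\<close>

definition workload_bound :: "real \<Rightarrow> real \<Rightarrow> (pad \<Rightarrow> (real \<times> real) list) \<Rightarrow> (pad \<Rightarrow> (real \<times> real) list) \<Rightarrow> real"
  where "workload_bound s L V W = 2 * L / s + (1 - 1 / s) *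
    (total_length (V P1) + total_length (V P2) + total_length (W P1) + total_length (W P2))"

lemma solo_time_le_workload:
  assumes s: "1 \<le> s" and L: "0 < L"
    and V: "\<And>q. pile_chain 0 L (V q)" and W: "\<And>q. pile_chain 0 L (W q)"
  shows "solo_time s V \<le> workload_bound s L V W"
  unfolding workload_bound_def solo_time_eq[OF V]
  using extent_le_length[where W = V, OF V] L s
    total_length_nonneg[OF W[of P1]] total_length_nonneg[OF W[of P2]]
  by (intro add_mono[OF divide_right_mono mult_left_mono]) auto

lemma workload_bound_commute: "workload_bound s L V W = workload_bound s L W V"
  by (simp add: workload_bound_def algebra_simps)

text \<open>\<open>key\<close> compares the bound of \<open>follow\<close> with f(L). As
  \<open>extent W \<le> L - b\<close>, the distance term
  \<open>2 * extent V + 2 * extent W - L\<close> is at most \<open>2 * (extent V - b) + L\<close>;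
  what exceeds \<open>2 * L\<close> is paid for by the return work of \<open>V\<close>, which f(L)
  contains in addition.\<close>

lemma crossing_bound:
  assumes s: "1 \<le> s" and L: "0 < L"
    and V: "\<And>q. pile_chain 0 L (V q)" and W: "\<And>q. pile_chain 0 L (W q)"
    and ne: "\<not> idle V"
    and b: "0 \<le> b" "b \<le> extent V" "extent W \<le> L - b"
    and Vb: "\<And>l r. (l, r) \<in> set (V (other p)) \<Longrightarrow> r \<le> b"
    and Wp: "\<And>l r. (l, r) \<in> set (W p) \<Longrightarrow> r \<le> L - extent V"
    and key: "2 * (extent V - b) \<le> L + (s - 1) * total_length (V (other p))"
  shows "\<exists>A B. unimodal_pair s L V W A B \<and> pair_makespan A B \<le> workload_bound s L V W"
proof -
  have solo: "solo_time s V \<le> workload_bound s L V W" "solo_time s W \<le> workload_bound s L V W"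
    using solo_time_le_workload[OF s L V W] solo_time_le_workload[OF s L W V]
    by (simp_all add: workload_bound_commute)
  consider "idle W" | "extent V + extent W \<le> L" | "\<not> idle W" "L < extent V + extent W" by linarith
  then show ?thesis
  proof cases
    case 1
    then obtain A B where "unimodal_pair s L V W B A" "pair_makespan B A = solo_time s V"
      using idle_partner[where V = W and W = V, OF s L V 1 ne]
      by (auto simp: unimodal_pair_commute[of s L W V] pair_makespan_commute)
    then show ?thesis
      using solo by - (rule exI[of _ B], rule exI[of _ A], simp)
  next
    case 2
    then show ?thesis
      using no_conflict[where V = V and W = W, OF s L V W _ 2] ne solo by fastforce
  next
    case 3
    have "(2 * extent V + 2 * extent W - L) / s \<le> (2 * L + (s - 1) * total_length (V (other p))) / s"
      using key b s by (intro divide_right_mono) auto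
    also have "\<dots> = 2 * L / s + (1 - 1 / s) * total_length (V (other p))"
      using s by (simp add: field_simps)
    finally have "(2 * extent V + 2 * extent W - L) / s +
        (1 - 1 / s) * (total_length (V p) + total_length (W (other p))) \<le>
        2 * L / s + (1 - 1 / s) * (total_length (V (other p)) + total_length (V p) + total_length (W (other p)))"
      by (simp add: distrib_left)
    also have "\<dots> \<le> 2 * L / s + (1 - 1 / s) *
        (total_length (V (other p)) + total_length (V p) + total_length (W (other p)) + total_length (W p))"
      using s total_length_nonneg[OF W] by (intro add_left_mono mult_left_mono) auto
    also have "\<dots> = workload_bound s L V W"
      unfolding workload_bound_def by (cases p) (simp_all add: algebra_simps)
    finally show ?thesis
      using follow[where V = V and W = W and p = p and b = b, OF s L V W ne 3(1) b 3(2) Vb Wp] solo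
      by fastforce
  qed
qed

section \<open>Schedules as pairs of trips\<close>

definition mirror :: "real \<Rightarrow> rpath \<Rightarrow> rpath" where
  "mirror L H = \<lparr>pos = \<lambda>t. L - pos H t, breaks = breaks H, acts = map flip (acts H)\<rparr>"

fun coord :: "reclaim_inst \<Rightarrow> reclaimer \<Rightarrow> real \<Rightarrow> real" where
  "coord I R0 x = x"
| "coord I R1 x = real_of_int (plen I) - x"

fun view :: "reclaim_inst \<Rightarrow> reclaimer \<Rightarrow> rpath \<Rightarrow> rpath" where
  "view I R0 H = H"
| "view I R1 H = mirror (real_of_int (plen I)) H"

fun near :: "reclaim_inst \<Rightarrow> reclaimer \<Rightarrow> nat \<Rightarrow> real" where
  "near I R0 j = real_of_int (lpos I j)"
| "near I R1 j = real_of_int (plen I) - real_of_int (rpos I j)"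

fun far :: "reclaim_inst \<Rightarrow> reclaimer \<Rightarrow> nat \<Rightarrow> real" where
  "far I R0 j = real_of_int (rpos I j)"
| "far I R1 j = real_of_int (plen I) - real_of_int (lpos I j)"

text \<open>The indices are reversed for R1, so that for both reclaimers the list is ordered by
  distance from home.\<close>

fun pile_list :: "reclaim_inst \<Rightarrow> reclaimer \<Rightarrow> pad \<Rightarrow> nat list" where
  "pile_list I R0 P1 = [1..<Suc (num1 I)]"
| "pile_list I R0 P2 = [Suc (num1 I)..<Suc (num I)]"
| "pile_list I R1 P1 = rev [1..<Suc (num1 I)]"
| "pile_list I R1 P2 = rev [Suc (num1 I)..<Suc (num I)]"

text \<open>With the constant assignment to \<open>k\<close> this lists all piles of the pad in the
  coordinates of \<open>k\<close>; \<open>potential\<close> is built from that case.\<close>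

definition work :: "reclaim_inst \<Rightarrow> (nat \<Rightarrow> reclaimer) \<Rightarrow> reclaimer \<Rightarrow> pad \<Rightarrow> (real \<times> real) list" where
  "work I a k q = map (\<lambda>j. (near I k j, far I k j)) (filter (\<lambda>j. a j = k) (pile_list I k q))"

fun swap :: "reclaimer \<Rightarrow> reclaimer" where
  "swap R0 = R1"
| "swap R1 = R0"

lemma swap_swap [simp]: "swap (swap k) = k"
  by (cases k) auto

lemma swap_neq [simp]: "swap k \<noteq> k"
  by (cases k) auto

lemma neq_iff_swap: "k' \<noteq> k \<longleftrightarrow> k' = swap k"
  by (cases k; cases k') auto

lemma mirror_mirror [simp]: "mirror L (mirror L H) = H"
  by (simp add: mirror_def o_def)

lemma view_view [simp]: "view I k (view I k H) = H"
  by (cases k) auto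

lemma finish_view [simp]: "finish (view I k H) = finish H"
  by (cases k) (auto simp: mirror_def finish_def)

lemma pos_view: "pos (view I k H) t = coord I k (pos H t)"
  by (cases k) (auto simp: mirror_def)

lemma breaks_view [simp]: "breaks (view I k H) = breaks H"
  by (cases k) (auto simp: mirror_def)

lemma coord_coord [simp]: "coord I k (coord I k x) = x"
  by (cases k) auto

lemma inj_coord: "inj (coord I k)"
  by (metis coord_coord injI)

lemma length_acts_view [simp]: "length (acts (view I k H)) = length (acts H)"
  by (cases k) (auto simp: mirror_def)

lemma reclaiming_piece_view [simp]: "reclaiming_piece (view I k H) i p \<longleftrightarrow> reclaiming_piece H i p"
proof -
  have "(\<exists>d. flip a = Reclaim p d) \<longleftrightarrow> (\<exists>d. a = Reclaim p d)" for a
    by (cases a) auto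
  then show ?thesis
    by (cases k) (simp_all add: mirror_def reclaiming_piece_def cong: conj_cong)
qed

lemma piece_range_view: "piece_range (view I k H) i = coord I k ` piece_range H i"
  by (auto simp: piece_range_def pos_view image_image)

lemma reclaimed_view: "reclaimed (view I k H) p = coord I k ` reclaimed H p"
  by (auto simp: reclaimed_def piece_range_view)

lemma coord_pile: "coord I k ` pile I j = {near I k j..far I k j}"
proof (cases k)
  case R1
  have "coord I R1 = (\<lambda>x. real_of_int (plen I) - x)" by auto
  then show ?thesis by (simp add: R1 pile_def)
qed (simp add: pile_def)

lemma trip_view: "reclaimer_path I k H \<longleftrightarrow> trip (speed I) (real_of_int (plen I)) (view I k H)"
proof (cases k)
  case R0
  then show ?thesis by (simp add: reclaimer_path_def trip_def)
next
  case R1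
  let ?L = "real_of_int (plen I)" and ?n = "length (acts H)"
  have "slope (speed I) (map flip (acts H) ! i) = - slope (speed I) (acts H ! i)" if "i < ?n" for i
    using that by simp
  moreover have "?L - x = ?L - y + - m * u \<longleftrightarrow> x = y + m * u" for x y m u :: real
    by auto
  ultimately have "(\<forall>i<?n. \<forall>t\<in>{breaks H ! i..breaks H ! Suc i}. ?L - pos H t =
        ?L - pos H (breaks H ! i) + slope (speed I) (map flip (acts H) ! i) * (t - breaks H ! i)) \<longleftrightarrow>
      (\<forall>i<?n. \<forall>t\<in>{breaks H ! i..breaks H ! Suc i}. pos H t =
        pos H (breaks H ! i) + slope (speed I) (acts H ! i) * (t - breaks H ! i))"
    by (metis (no_types, lifting))
  moreover have "(0 \<le> ?L - x \<and> ?L - x \<le> ?L) \<longleftrightarrow> (0 \<le> x \<and> x \<le> ?L)"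
    "?L - x = 0 \<longleftrightarrow> x = ?L" for x :: real
    by auto
  ultimately show ?thesis
    unfolding reclaimer_path_def trip_def R1 view.simps mirror_def finish_def rpath.simps length_map home.simps
    by (simp only:)
qed

lemma heading_flip: "heading (flip a) = map_option flip_dir (heading a)"
  by (cases a) auto

lemma map_filter_flip:
  "List.map_filter heading (map flip xs) = map flip_dir (List.map_filter heading xs)"
  by (induction xs) (auto simp: heading_flip split: option.split)

lemma turns_once_view: "turns_once R0 (view I k H) \<longleftrightarrow> turns_once k H"
proof (cases k)
  case R1
  have flip_set: "flip_dir ` A = {flip_dir d} \<longleftrightarrow> A = {d}" for A d
  proof
    assume "flip_dir ` A = {flip_dir d}"
    then have "flip_dir ` flip_dir ` A = {d}" by simp
    then show "A = {d}" by (simp add: image_image)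
  qed simp
  have "(\<exists>us vs. map flip_dir xs = us @ vs \<and> set us = {Rightward} \<and> set vs = {Leftward}) \<longleftrightarrow>
      (\<exists>us vs. xs = us @ vs \<and> set us = {Leftward} \<and> set vs = {Rightward})" for xs
  proof
    assume "\<exists>us vs. map flip_dir xs = us @ vs \<and> set us = {Rightward} \<and> set vs = {Leftward}"
    then obtain us vs where "xs = us @ vs" "flip_dir ` set us = {flip_dir Leftward}"
      "flip_dir ` set vs = {flip_dir Rightward}"
      by (auto simp: map_eq_append_conv)
    then show "\<exists>us vs. xs = us @ vs \<and> set us = {Leftward} \<and> set vs = {Rightward}"
      unfolding flip_set by blast
  next
    assume "\<exists>us vs. xs = us @ vs \<and> set us = {Leftward} \<and> set vs = {Rightward}"
    then obtain us vs where "xs = us @ vs" "set us = {Leftward}" "set vs = {Rightward}" by blast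
    then show "\<exists>us vs. map flip_dir xs = us @ vs \<and> set us = {Rightward} \<and> set vs = {Leftward}"
      by - (rule exI[of _ "map flip_dir us"], rule exI[of _ "map flip_dir vs"], simp)
  qed
  then show ?thesis
    by (simp add: R1 turns_once_def mirror_def map_filter_flip)
qed simp

lemma Reclaim_view: "Reclaim q d \<in> set (acts (view I k H)) \<longleftrightarrow>
    Reclaim q (case k of R0 \<Rightarrow> d | R1 \<Rightarrow> flip_dir d) \<in> set (acts H)"
proof (cases k)
  case R1
  have "Reclaim q d \<in> flip ` A \<longleftrightarrow> Reclaim q (flip_dir d) \<in> A" for A
    by (metis (no_types, lifting) flip.simps(3) flip_flip image_iff)
  then show ?thesis by (simp add: R1 mirror_def)
qed simp

lemma set_pile_list [simp]: "set (pile_list I k q) = piles I q"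
  by (cases k; cases q) auto

lemma distinct_pile_list [simp]: "distinct (pile_list I k q)"
  by (cases k; cases q) auto

lemma set_work: "set (work I a k q) = {(near I k j, far I k j) |j. j \<in> piles I q \<and> a j = k}"
  by (auto simp: work_def)

lemma total_length_work:
  "total_length (work I a k q) = (\<Sum>j\<in>{j \<in> piles I q. a j = k}. real_of_int (rpos I j) - real_of_int (lpos I j))"
proof -
  have "total_length (work I a k q) = (\<Sum>j\<leftarrow>filter (\<lambda>j. a j = k) (pile_list I k q). far I k j - near I k j)"
    by (simp add: total_length_def work_def o_def)
  also have "\<dots> = (\<Sum>j\<in>set (filter (\<lambda>j. a j = k) (pile_list I k q)). far I k j - near I k j)"
    by (rule sum_list_distinct_conv_sum_set) simp
  also have "\<dots> = (\<Sum>j\<in>{j \<in> piles I q. a j = k}. real_of_int (rpos I j) - real_of_int (lpos I j))"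
    by (rule sum.cong) (cases k; auto)+
  finally show ?thesis .
qed

lemma finite_piles [simp]: "finite (piles I q)"
  by (cases q) auto

lemma total_length_work_split:
  "total_length (work I a R0 q) + total_length (work I a R1 q) = total_length (work I (\<lambda>_. k) k q)"
proof -
  have "{j \<in> piles I q. k = k} = {j \<in> piles I q. a j = R0} \<union> {j \<in> piles I q. a j = R1}"
    using reclaimer.exhaust by auto
  moreover have "{j \<in> piles I q. a j = R0} \<inter> {j \<in> piles I q. a j = R1} = {}"
    by auto
  ultimately show ?thesis
    unfolding total_length_work by (simp only:) (rule sum.union_disjoint[symmetric], auto)
qed

lemma measure_chain:
  assumes "pile_chain a X xs" "u \<le> v"
  shows "measure lborel ((\<Union>(l, r)\<in>set xs. {l..r}) \<inter> {u..v}) = covered_length xs v - covered_length xs u"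
  using assms
proof (induction xs arbitrary: a)
  case Nil
  then show ?case by simp
next
  case (Cons z xs)
  obtain l r where z: "z = (l, r)" by (cases z)
  have c: "a \<le> l" "l < r" "pile_chain r X xs"
    using Cons.prems by (auto simp: z pile_chain_Cons)
  let ?A = "{l..r} \<inter> {u..v}" and ?B = "(\<Union>(l, r)\<in>set xs. {l..r}) \<inter> {u..v}"
  \<comment> \<open>Neighbouring piles may touch in \<open>r\<close>, so they are disjoint only up
    to a null set.\<close>
  have "AE x in lborel. x \<notin> ?A \<or> x \<notin> ?B"
    using AE_lborel_singleton[of r]
  proof (rule AE_mp)
    show "AE x in lborel. x \<noteq> r \<longrightarrow> x \<notin> ?A \<or> x \<notin> ?B"
      using c(3) by (intro AE_I2) (force simp: pile_chain_def)
  qed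
  moreover have "?A \<in> fmeasurable lborel" "?B \<in> fmeasurable lborel"
    using bounded_subset[OF bounded_closed_interval[of u v]] sets.finite_UN[of "set xs" "\<lambda>(l, r). {l..r}" borel]
    by (auto simp: fmeasurable_def intro!: emeasure_bounded_finite[unfolded infinity_ennreal_def])
  ultimately have "measure lborel (?A \<union> ?B) = measure lborel ?A + measure lborel ?B"
    by (rule measure_Un_AE)
  moreover have "measure lborel ?A = (max l (min v r) - l) - (max l (min u r) - l)"
    using c Cons.prems by (auto simp: Int_atLeastAtMost max_def min_def)
  moreover have "(\<Union>(l, r)\<in>set (z # xs). {l..r}) \<inter> {u..v} = ?A \<union> ?B"
    by (auto simp: z)
  ultimately show ?case
    using Cons.IH[OF c(3) Cons.prems(2)] by (simp add: z)
qed

lemma measure_reflect: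
  assumes "S \<in> sets borel"
  shows "measure lborel ((\<lambda>x. c - x) ` S) = measure lborel (S :: real set)"
proof -
  have img: "(\<lambda>x. c - x) ` S = (\<lambda>x. c + (-1) * x) -` S"
  proof (intro equalityI subsetI)
    fix x assume "x \<in> (\<lambda>x. c + (-1) * x) -` S"
    then show "x \<in> (\<lambda>x. c - x) ` S"
      by (intro image_eqI[of _ _ "c - x"]) auto
  qed auto
  have "lborel = density (distr lborel borel (\<lambda>x. c + (-1) * x)) (\<lambda>_. ennreal \<bar>-1\<bar>)"
    by (rule lborel_real_affine) simp
  also have "\<dots> = distr lborel borel (\<lambda>x. c + (-1) * x)"
    by (simp add: density_1)
  finally have "measure lborel S = measure (distr lborel borel (\<lambda>x. c + (-1) * x)) S"
    by metis
  also have "\<dots> = measure lborel ((\<lambda>x. c + (-1) * x) -` S \<inter> space lborel)"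
    using assms by (intro measure_distr) auto
  finally show ?thesis using img by simp
qed

lemma occupied_eq: "occupied I q = (\<Union>(l, r)\<in>set (work I (\<lambda>_. R0) R0 q). {l..r})"
  by (auto simp: occupied_def set_work pile_def)

text \<open>On the pad this is \<open>f_left\<close> for R0, and for R1 it is \<open>g_right\<close>
  as a function of the distance from the right end.\<close>

definition potential :: "reclaim_inst \<Rightarrow> reclaimer \<Rightarrow> real \<Rightarrow> real" where
  "potential I k x = pot (speed I) (work I (\<lambda>_. k) k P1) x + pot (speed I) (work I (\<lambda>_. k) k P2) x"

locale reclaim_instance =
  fixes I :: reclaim_inst
  assumes valid: "valid_inst I"
begin

abbreviation "s \<equiv> speed I"
abbreviation "L \<equiv> real_of_int (plen I)"

lemma speed_ge_1: "1 \<le> s" and L_pos: "0 < L"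
  using valid by (auto simp: valid_inst_def)

lemma piles_subset: "j \<in> piles I q \<Longrightarrow> j \<in> stockpiles I"
  using valid by (cases q) (auto simp: valid_inst_def stockpiles_def)

lemma stockpile_pad: "j \<in> stockpiles I \<Longrightarrow> \<exists>q. j \<in> piles I q"
  unfolding stockpiles_def by (metis atLeastAtMost_iff greaterThanAtMost_iff not_le piles.simps)

lemma pad_unique: "j \<in> piles I p \<Longrightarrow> j \<in> piles I q \<Longrightarrow> p = q"
  by (cases p; cases q) auto

lemma pile_bounds:
  assumes "j \<in> stockpiles I"
  shows "0 \<le> near I k j" "near I k j < far I k j" "far I k j \<le> L"
proof -
  have "0 \<le> lpos I j \<and> lpos I j < rpos I j \<and> rpos I j \<le> plen I"
    using valid assms by (auto simp: valid_inst_def)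
  then show "0 \<le> near I k j" "near I k j < far I k j" "far I k j \<le> L"
    by (cases k; simp)+
qed

lemma piles_apart:
  assumes "i \<in> piles I q" "j \<in> piles I q" "i \<noteq> j"
  shows "far I k i \<le> near I k j \<or> far I k j \<le> near I k i"
proof -
  have *: "rpos I i \<le> lpos I j" if "i \<in> piles I q" "j \<in> piles I q" "i < j" for i j
    using valid that unfolding valid_inst_def by blast
  have "rpos I i \<le> lpos I j \<or> rpos I j \<le> lpos I i"
    using *[of i j] *[of j i] assms by linarith
  then show ?thesis by (cases k) auto
qed

lemma pile_eqD:
  assumes "i \<in> piles I q" "j \<in> piles I q" "near I k i = near I k j" "far I k i = far I k j"
  shows "i = j"
  using piles_apart[OF assms(1,2), of k] assms(3,4) pile_bounds(2)[OF piles_subset[OF assms(1)], of k]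
  by auto

lemma chain_work: "pile_chain 0 L (work I a k q)"
proof -
  have mono: "far I R0 i \<le> near I R0 j" "far I R1 j \<le> near I R1 i"
    if "i \<in> piles I q" "j \<in> piles I q" "i < j" for i j
    using valid that unfolding valid_inst_def by simp_all
  have "sorted_wrt (\<lambda>i j. far I k i \<le> near I k j) (pile_list I k q)"
  proof (cases k)
    case R0
    have "sorted_wrt (<) (pile_list I R0 q)" by (cases q) (auto simp del: upt_Suc)
    then have "sorted_wrt (\<lambda>i j. far I R0 i \<le> near I R0 j) (pile_list I R0 q)"
      by (rule sorted_wrt_mono_rel[rotated]) (use mono in auto)
    then show ?thesis by (simp add: R0)
  next
    case R1
    have "pile_list I R1 q = rev (pile_list I R0 q)" by (cases q) auto
    moreover have "sorted_wrt (<) (pile_list I R0 q)" by (cases q) (auto simp del: upt_Suc)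
    then have "sorted_wrt (\<lambda>j i. far I R1 i \<le> near I R1 j) (pile_list I R0 q)"
      by (rule sorted_wrt_mono_rel[rotated]) (use mono in auto)
    ultimately show ?thesis by (simp add: R1 sorted_wrt_rev)
  qed
  then have "sorted_wrt (\<lambda>i j. far I k i \<le> near I k j) (filter (\<lambda>j. a j = k) (pile_list I k q))"
    by (rule sorted_wrt_filter)
  then show ?thesis
    unfolding pile_chain_def using pile_bounds[OF piles_subset]
    by (auto simp: work_def sorted_wrt_map)
qed

lemma reclaims_pile_view:
  "reclaims_pile I H i j \<longleftrightarrow> (\<exists>q. reclaiming_piece (view I k H) i q \<and> j \<in> piles I q \<and>
     piece_range (view I k H) i = {near I k j..far I k j})"
  unfolding reclaims_pile_def piece_range_view coord_pile[symmetric] inj_image_eq_iff[OF inj_coord]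
  by simp

text \<open>The share of a single reclaimer in \<open>unimodal_schedule\<close>. Uniqueness of the
  pieces is left out here and recovered from the monotone phases.\<close>

definition doing :: "(nat \<Rightarrow> reclaimer) \<Rightarrow> reclaimer \<Rightarrow> rpath \<Rightarrow> bool" where
  "doing a k H \<longleftrightarrow> reclaimer_path I k H \<and> turns_once k H \<and>
     (\<exists>p. \<forall>q d. Reclaim q d \<in> set (acts H) \<longrightarrow> d = (if q = p then outward k else inward k)) \<and>
     (\<forall>i q. reclaiming_piece H i q \<longrightarrow> (\<exists>j. a j = k \<and> reclaims_pile I H i j)) \<and>
     (\<forall>j\<in>stockpiles I. a j = k \<longrightarrow> (\<exists>i. reclaims_pile I H i j))"

text \<open>A piece determines its pad, and on one pad distinct piles of positive length are
  distinct intervals.\<close>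

lemma same_piece_same_pile:
  assumes "reclaims_pile I H i j" "reclaims_pile I H i j'"
  shows "j = j'"
proof -
  obtain q q' where q: "reclaiming_piece H i q" "j \<in> piles I q" "piece_range H i = {near I R0 j..far I R0 j}"
    "reclaiming_piece H i q'" "j' \<in> piles I q'" "piece_range H i = {near I R0 j'..far I R0 j'}"
    using assms unfolding reclaims_pile_view[of H i _ R0] by auto
  moreover from this have "q = q'" by (auto simp: reclaiming_piece_def)
  moreover have "near I R0 j < far I R0 j" "near I R0 j' < far I R0 j'"
    using q pile_bounds(2) piles_subset by blast+
  ultimately show ?thesis
    using pile_eqD[of j q j' R0] by (auto simp: Icc_eq_Icc)
qed

text \<open>The outward direction of R1 is leftward; \<open>view\<close> flips it, so that the
  condition on the labels looks the same for both reclaimers.\<close>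

lemma doing_iff: "doing a k H \<longleftrightarrow> (\<exists>p. unimodal_trip s L (work I a k) p (view I k H))"
proof -
  have mode: "(\<forall>q d. Reclaim q d \<in> set (acts H) \<longrightarrow> d = (if q = p then outward k else inward k)) \<longleftrightarrow>
      (\<forall>q d. Reclaim q d \<in> set (acts (view I k H)) \<longrightarrow> d = (if q = p then Rightward else Leftward))" for p
  proof (cases k)
    case R1
    show ?thesis
    proof (intro iffI allI impI)
      fix q d
      assume *: "\<forall>q d. Reclaim q d \<in> set (acts H) \<longrightarrow> d = (if q = p then outward k else inward k)"
        and "Reclaim q d \<in> set (acts (view I k H))"
      then have "Reclaim q (flip_dir d) \<in> set (acts H)" by (simp only: Reclaim_view) (simp add: R1)
      then have "flip_dir d = (if q = p then outward k else inward k)" using * by blast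
      then have "flip_dir d = (if q = p then Leftward else Rightward)" by (simp add: R1)
      then show "d = (if q = p then Rightward else Leftward)" by (cases d) (auto split: if_splits)
    next
      fix q d
      assume *: "\<forall>q d. Reclaim q d \<in> set (acts (view I k H)) \<longrightarrow> d = (if q = p then Rightward else Leftward)"
        and "Reclaim q d \<in> set (acts H)"
      then have "Reclaim q (flip_dir d) \<in> set (acts (view I k H))" by (simp only: Reclaim_view) (simp add: R1)
      then have "flip_dir d = (if q = p then Rightward else Leftward)" using * by blast
      then show "d = (if q = p then outward k else inward k)" by (cases d) (auto simp: R1 split: if_splits)
    qed
  qed simp
  have pieces: "(\<exists>(l, r)\<in>set (work I a k q). piece_range (view I k H) i = {l..r}) \<longleftrightarrow>
      (\<exists>j. a j = k \<and> reclaims_pile I H i j)" if piece: "reclaiming_piece H i q" for i q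
  proof -
    have "reclaiming_piece H i q' \<longleftrightarrow> q' = q" for q'
      using piece by (auto simp: reclaiming_piece_def)
    then show ?thesis
      unfolding reclaims_pile_view[of H i _ k] set_work by auto
  qed
  have piles: "(\<forall>q. \<forall>(l, r)\<in>set (work I a k q). \<exists>i. reclaiming_piece (view I k H) i q \<and>
      piece_range (view I k H) i = {l..r}) \<longleftrightarrow>
      (\<forall>j\<in>stockpiles I. a j = k \<longrightarrow> (\<exists>i. reclaims_pile I H i j))"
  proof (intro iffI ballI impI allI)
    fix j
    assume *: "\<forall>q. \<forall>(l, r)\<in>set (work I a k q). \<exists>i. reclaiming_piece (view I k H) i q \<and>
      piece_range (view I k H) i = {l..r}" and j: "j \<in> stockpiles I" "a j = k"
    obtain q where q: "j \<in> piles I q" using stockpile_pad[OF j(1)] by blast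
    then have "(near I k j, far I k j) \<in> set (work I a k q)" using j by (auto simp: set_work)
    then show "\<exists>i. reclaims_pile I H i j"
      using * q unfolding reclaims_pile_view[of H _ j k] by blast
  next
    fix q z
    assume *: "\<forall>j\<in>stockpiles I. a j = k \<longrightarrow> (\<exists>i. reclaims_pile I H i j)" and "z \<in> set (work I a k q)"
    then obtain j where j: "z = (near I k j, far I k j)" "j \<in> piles I q" "a j = k"
      by (auto simp: set_work)
    have "\<exists>i. reclaims_pile I H i j" using * j piles_subset by blast
    then obtain i q' where "reclaiming_piece (view I k H) i q'" "j \<in> piles I q'"
      "piece_range (view I k H) i = {near I k j..far I k j}"
      unfolding reclaims_pile_view[of H _ j k] by blast
    then show "case z of (l, r) \<Rightarrow> \<exists>i. reclaiming_piece (view I k H) i q \<and> piece_range (view I k H) i = {l..r}"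
      using j pad_unique[of j q q'] by auto
  qed
  show ?thesis
    unfolding doing_def unimodal_trip_def mode piles turns_once_view trip_view[symmetric]
    using pieces by auto
qed

text \<open>That exactly one piece traverses a given pile follows from the conditions on the single
  trips: only the assigned reclaimer can do so, because a piece belongs to one pile only, and it
  does so once, by \<open>unimodal_trip_unique_piece\<close>.\<close>

lemma unimodal_schedule_iff:
  "unimodal_schedule I a \<sigma> \<longleftrightarrow>
    unimodal_pair s L (work I a R0) (work I a R1) (view I R0 (\<sigma> R0)) (view I R1 (\<sigma> R1))"
proof -
  have clash: "clash_free_schedule I \<sigma> \<longleftrightarrow> (\<forall>k. reclaimer_path I k (\<sigma> k)) \<and>
      compatible L (view I R0 (\<sigma> R0)) (view I R1 (\<sigma> R1))"
    unfolding clash_free_schedule_def compatible_def pos_view by (simp add: algebra_simps)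
  have "unimodal_schedule I a \<sigma> \<longleftrightarrow>
      (\<forall>k. doing a k (\<sigma> k)) \<and> compatible L (view I R0 (\<sigma> R0)) (view I R1 (\<sigma> R1))"
  proof
    assume U: "unimodal_schedule I a \<sigma>"
    have "doing a k (\<sigma> k)" for k
    proof -
      have np: "nonpreemptive_schedule I \<sigma>" and
        assigned: "\<And>j k. j \<in> stockpiles I \<Longrightarrow> (\<exists>i. reclaims_pile I (\<sigma> k) i j) \<longleftrightarrow> a j = k"
        using U unfolding unimodal_schedule_def by blast+
      have "\<exists>j. a j = k \<and> reclaims_pile I (\<sigma> k) i j" if piece: "reclaiming_piece (\<sigma> k) i q" for i q
      proof -
        obtain j where j: "reclaims_pile I (\<sigma> k) i j"
          using np piece unfolding nonpreemptive_schedule_def by blast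
        then have "j \<in> stockpiles I" using piles_subset by (auto simp: reclaims_pile_def)
        then show ?thesis using assigned j by blast
      qed
      moreover have "reclaimer_path I k (\<sigma> k)"
        using np by (simp add: nonpreemptive_schedule_def clash)
      ultimately show ?thesis
        using U assigned unfolding doing_def unimodal_schedule_def by blast
    qed
    then show "(\<forall>k. doing a k (\<sigma> k)) \<and> compatible L (view I R0 (\<sigma> R0)) (view I R1 (\<sigma> R1))"
      using U by (simp add: unimodal_schedule_def nonpreemptive_schedule_def clash)
  next
    assume D: "(\<forall>k. doing a k (\<sigma> k)) \<and> compatible L (view I R0 (\<sigma> R0)) (view I R1 (\<sigma> R1))"
    have assigned: "a j = k" if j: "reclaims_pile I (\<sigma> k) i j" for i j k
    proof -
      obtain q where "reclaiming_piece (\<sigma> k) i q" using j by (auto simp: reclaims_pile_def)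
      then obtain j' where "a j' = k" "reclaims_pile I (\<sigma> k) i j'"
        using D unfolding doing_def by blast
      then show ?thesis using same_piece_same_pile[OF j] by blast
    qed
    have unique: "i = i'" if both: "reclaims_pile I (\<sigma> k) i j" "reclaims_pile I (\<sigma> k) i' j" for i i' j k
    proof -
      obtain p where p: "unimodal_trip s L (work I a k) p (view I k (\<sigma> k))"
        using D doing_iff by blast
      obtain q q' where "reclaiming_piece (view I k (\<sigma> k)) i q" "j \<in> piles I q"
        "piece_range (view I k (\<sigma> k)) i = {near I k j..far I k j}"
        "reclaiming_piece (view I k (\<sigma> k)) i' q'" "j \<in> piles I q'"
        "piece_range (view I k (\<sigma> k)) i' = {near I k j..far I k j}"
        using both unfolding reclaims_pile_view[of "\<sigma> k" _ j k] by blast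
      then show ?thesis
        using unimodal_trip_unique_piece[OF p speed_ge_1] pad_unique[of j q q']
          pile_bounds(2)[OF piles_subset] by metis
    qed
    have served: "\<exists>i. reclaims_pile I (\<sigma> (a j)) i j" if "j \<in> stockpiles I" for j
      using D that unfolding doing_def by blast
    have "\<exists>!q. reclaims_pile I (\<sigma> (fst q)) (snd q) j" if j: "j \<in> stockpiles I" for j
    proof -
      obtain i where i: "reclaims_pile I (\<sigma> (a j)) i j" using served[OF j] by blast
      show ?thesis
      proof (rule ex1I[of _ "(a j, i)"])
        fix q assume "reclaims_pile I (\<sigma> (fst q)) (snd q) j"
        then show "q = (a j, i)"
          using assigned[of "fst q" "snd q" j] unique[of "a j" i j "snd q"] i by (cases q) auto
      qed (use i in simp)
    qed
    then have "nonpreemptive_schedule I \<sigma>"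
      using D unfolding nonpreemptive_schedule_def clash doing_def by blast
    then show "unimodal_schedule I a \<sigma>"
      using D assigned served unfolding unimodal_schedule_def doing_def by blast
  qed
  also have "\<dots> \<longleftrightarrow> unimodal_pair s L (work I a R0) (work I a R1) (view I R0 (\<sigma> R0)) (view I R1 (\<sigma> R1))"
    unfolding doing_iff unimodal_pair_def by (metis (full_types) reclaimer.exhaust)
  finally show ?thesis .
qed

lemma makespan_eq: "makespan \<sigma> = pair_makespan (view I R0 (\<sigma> R0)) (view I R1 (\<sigma> R1))"
  by (simp add: makespan_def pair_makespan_def del: view.simps)

lemma schedule_of_pair:
  assumes "unimodal_pair s L (work I a R0) (work I a R1) A B"
  obtains \<sigma> where "unimodal_schedule I a \<sigma>" "makespan \<sigma> = pair_makespan A B"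
proof
  let ?\<sigma> = "\<lambda>k. case k of R0 \<Rightarrow> A | R1 \<Rightarrow> view I R1 B"
  show "unimodal_schedule I a ?\<sigma>"
    using assms by (simp add: unimodal_schedule_iff del: view.simps(2))
  show "makespan ?\<sigma> = pair_makespan A B"
    by (simp add: makespan_eq del: view.simps(2))
qed

lemma makespan_nonneg: "clash_free_schedule I \<sigma> \<Longrightarrow> 0 \<le> makespan \<sigma>"
  using trip_finish_nonneg trip_view[of I R0 "\<sigma> R0"]
  by (fastforce simp: clash_free_schedule_def makespan_def max_def)

lemma bdd_below_unimodal: "bdd_below (makespan ` {\<sigma>. unimodal_schedule I a \<sigma>})"
  by (rule bdd_belowI[of _ 0])
    (auto simp: unimodal_schedule_def nonpreemptive_schedule_def makespan_nonneg)

lemma unimodal_opt_le: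
  assumes "unimodal_pair s L (work I a R0) (work I a R1) A B"
  shows "unimodal_opt I a \<le> pair_makespan A B"
  using schedule_of_pair[OF assms] cInf_lower[OF _ bdd_below_unimodal[of a]]
  unfolding unimodal_opt_def by (metis (mono_tags, lifting) imageI mem_Collect_eq)

lemma not_both_idle: "\<not> (idle (work I a R0) \<and> idle (work I a R1))"
proof -
  have "1 \<in> stockpiles I" using valid by (simp add: valid_inst_def stockpiles_def)
  then obtain q where "1 \<in> piles I q" using stockpile_pad by blast
  then have "work I a (a 1) q \<noteq> []" using set_work[of I a "a 1" q] by force
  then show ?thesis by (cases "a 1") (auto simp: idle_def)
qed

lemma unimodal_opt_attained: "\<exists>\<sigma>. unimodal_schedule I a \<sigma> \<and> makespan \<sigma> = unimodal_opt I a"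
proof -
  obtain A B where AB: "unimodal_pair s L (work I a R0) (work I a R1) A B"
    and least: "\<And>A' B'. unimodal_pair s L (work I a R0) (work I a R1) A' B' \<Longrightarrow> pair_makespan A B \<le> pair_makespan A' B'"
    using unimodal_pair_attained[OF speed_ge_1 L_pos chain_work chain_work not_both_idle] by blast
  obtain \<sigma> where \<sigma>: "unimodal_schedule I a \<sigma>" "makespan \<sigma> = pair_makespan A B"
    using schedule_of_pair[OF AB] .
  have "unimodal_opt I a = makespan \<sigma>"
    unfolding unimodal_opt_def
  proof (rule cInf_eq_minimum)
    show "makespan \<sigma> \<in> makespan ` {\<sigma>. unimodal_schedule I a \<sigma>}" using \<sigma> by blast
    show "makespan \<sigma> \<le> x" if "x \<in> makespan ` {\<sigma>. unimodal_schedule I a \<sigma>}" for x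
      using that least \<sigma>(2) by (auto simp: unimodal_schedule_iff makespan_eq simp del: view.simps)
  qed
  then show ?thesis using \<sigma> by metis
qed

end

section \<open>A lower bound for preemptive schedules\<close>

lemma fmeasurable_Icc: "{u..v :: real} \<in> fmeasurable lborel"
  using fmeasurable_cbox[of u v] by simp

lemma covered_length_filter_le:
  "covered_length (map f (filter P js)) x \<le> covered_length (map f js) x"
  by (induction js) (auto simp: covered_length_def split: prod.split)

lemma trip_has_max:
  assumes H: "trip s L H" and s: "1 \<le> s"
  obtains t where "0 \<le> t" "\<And>t'. 0 \<le> t' \<Longrightarrow> pos H t' \<le> pos H t"
proof -
  let ?P = "(\<lambda>m. pos H (breaks H ! m)) ` {..length (acts H)}"
  have "Max ?P \<in> ?P" by (rule Max_in) auto
  then obtain m where m: "m \<le> length (acts H)" "Max ?P = pos H (breaks H ! m)"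
    by (elim imageE) simp
  have t: "0 \<le> breaks H ! m"
    using trip_breaks_mono[OF H, of 0 m] trip_breaks_0[OF H] m by simp
  have "pos H t' \<le> pos H (breaks H ! m)" if t': "0 \<le> t'" for t'
  proof (cases "t' \<le> finish H")
    case True
    then obtain m' where "m' \<le> length (acts H)" "pos H t' \<le> pos H (breaks H ! m')"
      using obtain_break[OF H s t'] by blast
    moreover from this have "pos H (breaks H ! m') \<le> Max ?P" by (intro Max_ge) auto
    ultimately show ?thesis using m by simp
  next
    case False
    then show ?thesis using trip_after[OF H, of t'] trip_nonneg[OF H t] by simp
  qed
  then show thesis using that t by blast
qed

lemma reclaimed_fmeasurable:
  assumes "trip s L (view I k H)"
  shows "reclaimed H p \<in> fmeasurable lborel"
proof -
  have "piece_range H i \<in> fmeasurable lborel" if "reclaiming_piece H i p" for i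
  proof -
    obtain y z where "piece_range (view I k H) i = closed_segment y z"
      using trip_piece_range[OF assms] \<open>reclaiming_piece H i p\<close> by (auto simp: reclaiming_piece_def)
    then obtain u v where uv: "piece_range (view I k H) i = {u..v}"
      by (metis closed_segment_eq_real_ivl)
    have "piece_range H i = coord I k ` {u..v}"
      using piece_range_view[of I k "view I k H" i] uv by simp
    moreover have "coord I R1 = (\<lambda>x. real_of_int (plen I) - x)" "coord I R0 = (\<lambda>x. x)" by auto
    ultimately show ?thesis
      by (cases k) (simp_all add: fmeasurable_Icc)
  qed
  moreover have "finite {i. reclaiming_piece H i p}"
    by (rule finite_subset[of _ "{..<length (acts H)}"]) (auto simp: reclaiming_piece_def)
  ultimately show ?thesis
    unfolding reclaimed_def by (intro fmeasurable.finite_UN) auto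
qed

lemma measure_coord: "S \<in> sets borel \<Longrightarrow> measure lborel (coord I k ` S) = measure lborel S"
proof (cases k)
  case R1
  have "coord I R1 = (\<lambda>x. real_of_int (plen I) - x)" by auto
  then show "S \<in> sets borel \<Longrightarrow> ?thesis" by (simp add: R1 measure_reflect)
qed simp

text \<open>Derives \<open>key\<close> of \<open>crossing_bound\<close> from the pair rule. In the
  coordinates of the chosen reclaimer \<open>x\<close> stands for x*, \<open>l\<close> and
  \<open>r\<close> for the ends of the pile that reaches farther, \<open>l'\<close> for the near end
  of its partner, and \<open>b\<close> for the separator on the other pad. With \<open>u\<close> and
  \<open>v\<close> the parts before x* and \<open>m\<close> the overlap, the rule yields
  \<open>m \<le> s * v\<close> if \<open>u \<le> v\<close>, and
  \<open>m - u \<le> (s - 1) * v\<close> otherwise; adding \<open>m + v \<le> L\<close> or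
  \<open>m + u \<le> L\<close>, respectively, gives the claim.\<close>

lemma crossing_arith:
  fixes s L x b t :: real
  assumes s: "1 \<le> s" and "l \<le> x" "l' \<le> x" "x \<le> b" "b \<le> r"
    and L: "r - l \<le> L" "r - l' \<le> L" and t: "x - l' \<le> t"
    and verdict: "(r - x) + (b - x) + (r - b) / s \<le> (x - l) + (x - l') + \<bar>l - l'\<bar> / s"
  shows "2 * (r - b) \<le> L + (s - 1) * t"
proof -
  define u v c m where "u = x - l" and "v = x - l'" and "c = b - x" and "m = r - b"
  have nn: "0 \<le> u" "0 \<le> v" "0 \<le> c" "0 \<le> m" and bounds: "u + m \<le> L" "v + m \<le> L"
    using assms by (auto simp: u_def v_def c_def m_def)
  have "\<bar>u - v\<bar> = \<bar>l - l'\<bar>" by (simp add: u_def v_def)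
  then have "m + 2 * c + m / s \<le> u + v + \<bar>u - v\<bar> / s"
    using verdict by (simp add: u_def v_def c_def m_def)
  then have "m + m / s \<le> u + v + \<bar>u - v\<bar> / s" using nn by simp
  then have "s * (m + m / s) \<le> s * (u + v + \<bar>u - v\<bar> / s)"
    using s by (intro mult_left_mono) auto
  then have key: "(s + 1) * m \<le> s * (u + v) + \<bar>u - v\<bar>"
    using s by (simp add: algebra_simps)
  have "(s - 1) * v \<le> (s - 1) * t"
    using s t by (intro mult_left_mono) (auto simp: v_def)
  moreover have "2 * m \<le> L + (s - 1) * v"
  proof (cases "u \<le> v")
    case True
    have "(s - 1) * u \<le> (s - 1) * v" using s True by (intro mult_left_mono) auto
    then have "(s + 1) * m \<le> 2 * (s * v)" using key True by (simp add: algebra_simps)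
    also have "\<dots> \<le> (s + 1) * (s * v)" using s nn by (intro mult_right_mono) auto
    finally have "m \<le> s * v" using s by simp
    then show ?thesis using bounds by (simp add: algebra_simps)
  next
    case False
    then have "(s + 1) * (m - u) \<le> (s - 1) * v" using key by (simp add: algebra_simps)
    also have "\<dots> \<le> (s + 1) * ((s - 1) * v)"
      using s nn mult_right_mono[of 1 "s + 1" "(s - 1) * v"] by simp
    finally have "m - u \<le> (s - 1) * v" using s by simp
    then show ?thesis using bounds by simp
  qed
  ultimately show ?thesis by (simp add: m_def)
qed

section \<open>The functions f and g as potentials, and the lower bound\<close>

context reclaim_instance
begin

lemma work_all: "work I (\<lambda>_. k) k q = map (\<lambda>j. (near I k j, far I k j)) (pile_list I k q)"
  by (simp add: work_def)

lemma potential_diff_ge: "x \<le> y \<Longrightarrow> potential I k x + 2 * (y - x) / s \<le> potential I k y"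
  using pot_diff_ge[OF speed_ge_1, of x y "work I (\<lambda>_. k) k P1"]
    pot_diff_ge[OF speed_ge_1, of x y "work I (\<lambda>_. k) k P2"]
  by (simp add: potential_def diff_divide_distrib)

lemma potential_diff_le: "x \<le> y \<Longrightarrow> potential I k y - potential I k x \<le> 2 * (y - x)"
  using pot_diff_le[OF speed_ge_1 _ chain_work, of x y "\<lambda>_. k" k P1]
    pot_diff_le[OF speed_ge_1 _ chain_work, of x y "\<lambda>_. k" k P2] by (simp add: potential_def)

lemma potential_mono: "x \<le> y \<Longrightarrow> potential I k x \<le> potential I k y"
  using potential_diff_ge[of x y k] speed_ge_1 by (smt (verit) divide_nonneg_pos)

lemma potential_strict_mono: "x < y \<Longrightarrow> potential I k x < potential I k y"
  using potential_diff_ge[of x y k] speed_ge_1 by (smt (verit) divide_pos_pos)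

lemma potential_0: "potential I k 0 = 0"
  by (simp add: potential_def pot_0[OF chain_work])

lemma continuous_potential: "continuous_on A (potential I k)"
proof (rule continuous_on_subset[OF lipschitz_on_continuous_on[where L = 2] subset_UNIV])
  show "2-lipschitz_on UNIV (potential I k)"
  proof (rule lipschitz_onI)
    show "dist (potential I k x) (potential I k y) \<le> 2 * dist x y" for x y
      using potential_diff_le[of x y k] potential_diff_le[of y x k]
        potential_mono[of x y k] potential_mono[of y x k]
      by (cases "x \<le> y") (auto simp: dist_real_def)
  qed simp
qed

lemma pot_above_L: "pot s (work I a k q) L = L / s + (1 - 1 / s) * total_length (work I a k q)"
  by (rule pot_above[OF chain_work]) (use chain_work[of a k q] in \<open>auto simp: pile_chain_def\<close>)

lemma potential_L: "potential I k L = workload_bound s L (work I a R0) (work I a R1)"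
  unfolding potential_def pot_above_L workload_bound_def
    total_length_work_split[of I a P1, symmetric] total_length_work_split[of I a P2, symmetric]
  by (simp add: algebra_simps)

text \<open>What R1 has covered up to distance \<open>L - x\<close> is exactly what lies beyond
  \<open>x\<close> as seen by R0.\<close>

lemma covered_length_reflect:
  "covered_length (work I (\<lambda>_. R1) R1 q) (L - x) =
    total_length (work I (\<lambda>_. R0) R0 q) - covered_length (work I (\<lambda>_. R0) R0 q) x"
proof -
  have rev: "pile_list I R1 q = rev (pile_list I R0 q)" by (cases q) auto
  have "covered_length (work I (\<lambda>_. R1) R1 q) (L - x) =
      (\<Sum>j\<leftarrow>pile_list I R0 q. max (near I R1 j) (min (L - x) (far I R1 j)) - near I R1 j)"
    by (simp add: covered_length_def work_all rev o_def rev_map[symmetric] del: near.simps far.simps)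
  also have "\<dots> = (\<Sum>j\<leftarrow>pile_list I R0 q. (far I R0 j - near I R0 j) -
      (max (near I R0 j) (min x (far I R0 j)) - near I R0 j))"
    using pile_bounds(2)[OF piles_subset, of _ q R0]
    by (intro arg_cong[where f = sum_list] map_cong refl) (auto simp: max_def min_def intro: less_imp_le)
  also have "\<dots> = total_length (work I (\<lambda>_. R0) R0 q) - covered_length (work I (\<lambda>_. R0) R0 q) x"
    by (simp add: covered_length_def total_length_def work_all o_def sum_list_subtractf)
  finally show ?thesis .
qed

lemma potential_reflect: "potential I R1 (L - x) = potential I R0 L - potential I R0 x"
  unfolding potential_def pot_above_L
  by (simp add: pot_def covered_length_reflect algebra_simps diff_divide_distrib)

lemma measure_occupied:
  assumes "u \<le> v"
  shows "measure lborel (occupied I q \<inter> {u..v}) =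
    covered_length (work I (\<lambda>_. R0) R0 q) v - covered_length (work I (\<lambda>_. R0) R0 q) u"
  unfolding occupied_eq by (rule measure_chain[OF chain_work assms])

lemma covered_length_L: "covered_length (work I a k q) L = total_length (work I a k q)"
  using covered_length_above[of "work I a k q" L] chain_work[of a k q]
  by (auto simp: pile_chain_def total_length_def)

lemma measure_occupied_coord:
  assumes "0 \<le> x"
  shows "measure lborel (occupied I q \<inter> {y. 0 \<le> coord I k y \<and> coord I k y \<le> x}) =
    covered_length (work I (\<lambda>_. k) k q) x"
proof (cases k)
  case R0
  have "{y. 0 \<le> coord I k y \<and> coord I k y \<le> x} = {0..x}" by (auto simp: R0)
  then show ?thesis
    using measure_occupied[OF assms, of q] covered_length_below[OF chain_work, of 0 "\<lambda>_. R0" R0 q]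
    by (simp add: R0)
next
  case R1
  have "{y. 0 \<le> coord I k y \<and> coord I k y \<le> x} = {L - x..L}" by (auto simp: R1)
  then show ?thesis
    using measure_occupied[of "L - x" L q] covered_length_reflect[of q "L - x"] assms
    by (simp add: R1 covered_length_L)
qed

lemma occupied_borel: "occupied I q \<in> sets borel"
  unfolding occupied_def pile_def by (intro sets.finite_UN) auto

text \<open>Give every point the weight 2/s for travel and add 1 - 1/s for each pad on which it is
  occupied: this makes 2 on Q2, 1 + 1/s on Q1 and 2/s on E. Summed over all points, the additional
  terms count the lengths of S1 and S2 separately.\<close>

lemma workload_eq:
  assumes "0 \<le> u" "u \<le> v" "v \<le> L"
  shows "workload I {u..v} = potential I R0 v - potential I R0 u"
proof -
  define A where "A = {u..v}"
  define S T where "S = occupied I P1 \<inter> A" and "T = occupied I P2 \<inter> A"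
  have A: "A \<in> fmeasurable lborel" by (simp add: A_def fmeasurable_Icc)
  have ST: "S \<in> fmeasurable lborel" "T \<in> fmeasurable lborel" "S \<subseteq> A" "T \<subseteq> A"
    using fmeasurable_Int_fmeasurable[OF A, of "occupied I P1"]
      fmeasurable_Int_fmeasurable[OF A, of "occupied I P2"] occupied_borel
    by (auto simp: S_def T_def Int_commute[of _ A])
  have borel: "S \<in> sets borel" "T \<in> sets borel"
    using fmeasurableD[OF ST(1)] fmeasurableD[OF ST(2)] by simp_all
  have "measure lborel (S \<union> T) = measure lborel S + measure lborel T - measure lborel (S \<inter> T)"
    using ST by (intro measure_Un3) auto
  moreover have "measure lborel (A - (S \<union> T)) = measure lborel A - measure lborel (S \<union> T)"
    using A ST borel by (intro measurable_measure_Diff) auto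
  moreover have "measure lborel ((S \<union> T) - (S \<inter> T)) = measure lborel (S \<union> T) - measure lborel (S \<inter> T)"
    using ST borel by (intro measurable_measure_Diff) auto
  moreover have "(S - T) \<union> (T - S) = (S \<union> T) - (S \<inter> T)" by auto
  moreover have "workload I A = 2 * measure lborel (S \<inter> T) +
      (1 + 1 / s) * measure lborel ((S - T) \<union> (T - S)) + 2 * measure lborel (A - (S \<union> T)) / s"
  proof -
    have "occupied I P1 \<inter> occupied I P2 \<inter> A = S \<inter> T"
      "((occupied I P1 - occupied I P2) \<union> (occupied I P2 - occupied I P1)) \<inter> A = (S - T) \<union> (T - S)"
      "({0..L} - (occupied I P1 \<union> occupied I P2)) \<inter> A = A - (S \<union> T)"
      using assms by (auto simp: S_def T_def A_def)
    then show ?thesis by (simp add: workload_def Let_def)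
  qed
  moreover have "measure lborel A = v - u" using assms by (simp add: A_def)
  ultimately have "workload I A = 2 * (v - u) / s + (1 - 1 / s) * (measure lborel S + measure lborel T)"
    by (simp only:) (simp add: algebra_simps add_divide_distrib diff_divide_distrib)
  then show ?thesis
    unfolding S_def T_def A_def measure_occupied[OF assms(2)]
    by (simp add: potential_def pot_def algebra_simps diff_divide_distrib)
qed

text \<open>The sum of f and g is constant, so they agree where f has half of its total. Such a
  point exists by the intermediate value theorem and is unique by strict monotonicity, so the
  description in \<open>xstar\<close> denotes it.\<close>

lemma xstar_props: "0 \<le> xstar I" "xstar I \<le> L" "2 * potential I R0 (xstar I) = potential I R0 L"
proof -
  have fg: "f_left I x = potential I R0 x" "g_right I x = potential I R0 L - potential I R0 x"
    if "x \<in> {0..L}" for x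
    using workload_eq[of 0 x] workload_eq[of x L] that by (auto simp: f_left_def g_right_def potential_0)
  obtain x where x: "0 \<le> x" "x \<le> L" "potential I R0 x = potential I R0 L / 2"
    using IVT'[of "potential I R0" 0 "potential I R0 L / 2" L] continuous_potential
      potential_mono[of 0 L R0] L_pos by (auto simp: potential_0)
  have "xstar I = x"
    unfolding xstar_def
  proof (rule the_equality)
    show "x \<in> {0..L} \<and> f_left I x = g_right I x" using x fg[of x] by simp
    show "y = x" if y: "y \<in> {0..L} \<and> f_left I y = g_right I y" for y
      using fg[of y] y x(3) potential_strict_mono[of x y R0] potential_strict_mono[of y x R0]
      by (cases x y rule: linorder_cases) auto
  qed
  then show "0 \<le> xstar I" "xstar I \<le> L" "2 * potential I R0 (xstar I) = potential I R0 L"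
    using x by auto
qed

abbreviation "mid k \<equiv> coord I k (xstar I)"

lemma mid_bounds: "0 \<le> mid k" "mid k \<le> L"
  using xstar_props by (cases k; simp)+

lemma mid_swap: "mid (swap k) = L - mid k"
  by (cases k) auto

lemma potential_L_eq: "potential I k L = potential I R0 L"
  using potential_L[of k "\<lambda>_. R0"] potential_L[of R0 "\<lambda>_. R0"] by simp

lemma potential_mid: "2 * potential I k (mid k) = potential I R0 L"
  using xstar_props(3) by (cases k) (auto simp: potential_reflect)

lemma xstar_in_pile: "xstar I \<in> pile I j \<longleftrightarrow> near I k j \<le> mid k \<and> mid k \<le> far I k j"
  by (cases k) (auto simp: pile_def)

lemma near_less_mid:
  assumes "rule_assignment I a" "j \<in> stockpiles I" "a j = k"
  shows "near I k j < mid k"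
proof (rule ccontr)
  assume "\<not> near I k j < mid k"
  moreover have "real_of_int (rpos I j) \<le> xstar I \<longrightarrow> a j = R0"
    "xstar I \<le> real_of_int (lpos I j) \<longrightarrow> a j = R1"
    using assms(1,2) unfolding rule_assignment_def by blast+
  ultimately show False using assms(3) by (cases k) auto
qed

lemma far_le_mid:
  assumes "rule_assignment I a" "j \<in> stockpiles I" "far I k j \<le> mid k"
  shows "a j = k"
proof -
  have "real_of_int (rpos I j) \<le> xstar I \<longrightarrow> a j = R0"
    "xstar I \<le> real_of_int (lpos I j) \<longrightarrow> a j = R1"
    using assms(1,2) unfolding rule_assignment_def by blast+
  then show ?thesis using assms(3) by (cases k) auto
qed

lemma solo_time_le_potential:
  assumes "\<And>q j. j \<in> piles I q \<Longrightarrow> a j = k \<Longrightarrow> far I k j \<le> x" "0 \<le> x"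
  shows "solo_time s (work I a k) \<le> potential I k x"
proof -
  have ext: "extent (work I a k) \<le> x"
    using assms by (intro extent_le) (auto simp: set_work)
  have "pot s (work I a k q) (extent (work I a k)) \<le> pot s (work I (\<lambda>_. k) k q) x" for q
  proof -
    have "covered_length (work I a k q) x \<le> covered_length (work I (\<lambda>_. k) k q) x"
      unfolding work_all unfolding work_def by (rule covered_length_filter_le)
    then have "pot s (work I a k q) x \<le> pot s (work I (\<lambda>_. k) k q) x"
      unfolding pot_def using speed_ge_1 by (intro add_left_mono mult_left_mono) auto
    then show ?thesis
      using pot_mono[OF speed_ge_1 ext, of "work I a k q"] by simp
  qed
  then show ?thesis by (simp add: solo_time_def potential_def add_mono)
qed

text \<open>Let \<open>X k\<close> be the farthest reach of \<open>k\<close>. If the reaches meet,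
  the two costs add up to at least f(L). Otherwise each reclaimer alone handles everything within
  its reach, so the potential of its reach is at most the makespan, and it remains to see whether a
  reach includes x*.\<close>

lemma preemptive_lower_bound:
  assumes \<sigma>: "preemptive_schedule I \<sigma>" and a: "rule_assignment I a"
  shows "potential I R0 L \<le> 2 * makespan \<sigma> \<or>
    (\<forall>p. xstar I \<notin> occupied I p) \<and> (\<forall>k. solo_time s (work I a k) \<le> makespan \<sigma>)"
proof -
  have trip: "trip s L (view I k (\<sigma> k))" for k
    using \<sigma> by (simp add: preemptive_schedule_def clash_free_schedule_def trip_view)
  have "\<exists>x. (\<forall>t\<ge>0. coord I k (pos (\<sigma> k) t) \<le> x) \<and> (\<exists>t\<ge>0. x = pos (view I k (\<sigma> k)) t)" for k
    using trip_has_max[OF trip[of k] speed_ge_1] unfolding pos_view by metis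
  then obtain X where X: "\<And>k t. 0 \<le> t \<Longrightarrow> coord I k (pos (\<sigma> k) t) \<le> X k"
    "\<And>k. \<exists>t\<ge>0. X k = pos (view I k (\<sigma> k)) t"
    by metis
  have X_nonneg: "0 \<le> X k" for k
    using X(2)[of k] trip_nonneg[OF trip] by auto
  let ?R = "\<lambda>k p. reclaimed (\<sigma> k) p"
  have R: "?R k p \<in> fmeasurable lborel" for k p
    by (rule reclaimed_fmeasurable[OF trip])
  then have R_borel: "?R k p \<in> sets borel" for k p
    using fmeasurableD by fastforce
  have R_view: "measure lborel (reclaimed (view I k (\<sigma> k)) p) = measure lborel (?R k p)" for k p
    by (simp add: reclaimed_view measure_coord R_borel)
  have cost: "2 * X k / s + (1 - 1 / s) * (measure lborel (?R k P1) + measure lborel (?R k P2)) \<le> makespan \<sigma>" for k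
  proof -
    obtain t where t: "0 \<le> t" "X k = pos (view I k (\<sigma> k)) t" using X(2) by blast
    have "finish (\<sigma> k) \<le> makespan \<sigma>" by (cases k) (auto simp: makespan_def)
    then show ?thesis
      using trip_cost[OF trip[of k] speed_ge_1 t(1)] t(2) by (simp add: R_view)
  qed
  have cover: "\<exists>k. x \<in> ?R k p" if "x \<in> occupied I p" for x p
    using \<sigma> that unfolding preemptive_schedule_def reclaimed_def by blast
  have R_le: "coord I k x \<le> X k" if x: "x \<in> ?R k p" for x k p
  proof -
    obtain i where "reclaiming_piece (\<sigma> k) i p" "x \<in> piece_range (\<sigma> k) i"
      using x by (auto simp: reclaimed_def)
    then obtain t where "x = pos (\<sigma> k) t" "breaks (\<sigma> k) ! i \<le> t" "i < length (acts (\<sigma> k))"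
      by (auto simp: piece_range_def reclaiming_piece_def)
    moreover have "0 \<le> breaks (\<sigma> k) ! i"
      using trip_breaks_mono[OF trip[of k], of 0 i] trip_breaks_0[OF trip[of k]] calculation(3) by simp
    ultimately show ?thesis using X(1) by auto
  qed
  show ?thesis
  proof (cases "L \<le> X R0 + X R1")
    \<comment> \<open>Every occupied point is reclaimed by someone, so on each pad the reclaimed
      lengths add up to at least the total.\<close>
    case True
    have "total_length (work I (\<lambda>_. R0) R0 p) \<le> measure lborel (?R R0 p) + measure lborel (?R R1 p)" for p
    proof -
      have "total_length (work I (\<lambda>_. R0) R0 p) = measure lborel (occupied I p \<inter> {0..L})"
        using measure_occupied[of 0 L p] L_pos covered_length_below[OF chain_work, of 0 "\<lambda>_. R0" R0 p]
        by (simp add: covered_length_L)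
      also have "\<dots> \<le> measure lborel (?R R0 p \<union> ?R R1 p)"
      proof (rule measure_mono_fmeasurable)
        show "occupied I p \<inter> {0..L} \<subseteq> ?R R0 p \<union> ?R R1 p"
          using cover by (metis (full_types) Int_iff UnCI reclaimer.exhaust subsetI)
      qed (use R R_borel occupied_borel in auto)
      also have "\<dots> \<le> measure lborel (?R R0 p) + measure lborel (?R R1 p)"
        using R_borel by (intro measure_Un_le) auto
      finally show ?thesis .
    qed
    from this[of P1] this[of P2] True have
      "2 * L / s + (1 - 1 / s) * (total_length (work I (\<lambda>_. R0) R0 P1) + total_length (work I (\<lambda>_. R0) R0 P2))
      \<le> 2 * (X R0 + X R1) / s + (1 - 1 / s) * ((measure lborel (?R R0 P1) + measure lborel (?R R1 P1)) +
        (measure lborel (?R R0 P2) + measure lborel (?R R1 P2)))"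
      using speed_ge_1 by (intro add_mono divide_right_mono mult_left_mono) auto
    also have "\<dots> \<le> 2 * makespan \<sigma>"
      using cost[of R0] cost[of R1] by (simp add: algebra_simps add_divide_distrib)
    finally have "potential I R0 L \<le> 2 * makespan \<sigma>"
      unfolding potential_def pot_above_L by (simp add: algebra_simps)
    then show ?thesis ..
  next
    case False
    then have apart: "X k + X (swap k) < L" for k by (cases k) auto
    have coord_swap: "coord I (swap k) x = L - coord I k x" for k x by (cases k) auto
    \<comment> \<open>A point within the reach of \<open>k\<close> is out of reach for the other
      reclaimer.\<close>
    have pot_le: "potential I k (X k) \<le> makespan \<sigma>" for k
    proof -
      have "covered_length (work I (\<lambda>_. k) k p) (X k) \<le> measure lborel (?R k p)" for p
        unfolding measure_occupied_coord[OF X_nonneg, symmetric]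
      proof (rule measure_mono_fmeasurable)
        show "occupied I p \<inter> {y. 0 \<le> coord I k y \<and> coord I k y \<le> X k} \<subseteq> ?R k p"
        proof
          fix x assume x: "x \<in> occupied I p \<inter> {y. 0 \<le> coord I k y \<and> coord I k y \<le> X k}"
          then obtain k' where k': "x \<in> ?R k' p" using cover by blast
          have "k' = k"
            using R_le[OF k'] x apart[of k] coord_swap[of k x] neq_iff_swap[of k' k] by fastforce
          then show "x \<in> ?R k p" using k' by simp
        qed
        have "{y. 0 \<le> coord I R0 y \<and> coord I R0 y \<le> X R0} = {0..X R0}"
          "{y. 0 \<le> coord I R1 y \<and> coord I R1 y \<le> X R1} = {L - X R1..L}"
          by auto
        then have "{y. 0 \<le> coord I k y \<and> coord I k y \<le> X k} \<in> sets borel"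
          by (cases k) simp_all
        then show "occupied I p \<inter> {y. 0 \<le> coord I k y \<and> coord I k y \<le> X k} \<in> sets lborel"
          using occupied_borel by auto
      qed (rule R)
      from this[of P1] this[of P2] have
        "2 * X k / s + (1 - 1 / s) * (covered_length (work I (\<lambda>_. k) k P1) (X k) + covered_length (work I (\<lambda>_. k) k P2) (X k))
         \<le> 2 * X k / s + (1 - 1 / s) * (measure lborel (?R k P1) + measure lborel (?R k P2))"
        using speed_ge_1 by (intro add_left_mono mult_left_mono) auto
      then show ?thesis
        using cost[of k] by (simp add: potential_def pot_def algebra_simps)
    qed
    show ?thesis
    proof (cases "\<exists>k. mid k \<le> X k")
      case True
      then obtain k where "mid k \<le> X k" by blast
      \<comment> \<open>At x* the potential of either reclaimer is half of f(L).\<close>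
      then have "potential I R0 L \<le> 2 * makespan \<sigma>"
        using potential_mono[of "mid k" "X k" k] potential_mid[of k] pot_le[of k] by simp
      then show ?thesis ..
    next
      case no: False
      have free: "xstar I \<notin> occupied I p" for p
        using cover[of "xstar I" p] R_le no by blast
      have "solo_time s (work I a k) \<le> makespan \<sigma>" for k
      proof -
        \<comment> \<open>The far end of this pile lies before x* as seen from \<open>k\<close>.
          Someone reclaims it, and the other reclaimer does not even reach x*, so \<open>k\<close>
          gets that far.\<close>
        have "far I k j \<le> X k" if j: "j \<in> piles I q" "a j = k" for q j
        proof -
          have "xstar I \<notin> pile I j" using free[of q] j by (auto simp: occupied_def)
          then have far: "far I k j < mid k"
            using near_less_mid[OF a piles_subset[OF j(1)] j(2)] by (auto simp: xstar_in_pile[of j k])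
          have "near I k j < far I k j" by (rule pile_bounds(2)[OF piles_subset[OF j(1)]])
          then have "coord I k (far I k j) \<in> pile I j"
            by (cases k) (auto simp: pile_def)
          then obtain k' where k': "coord I k (far I k j) \<in> ?R k' q"
            using cover j(1) by (auto simp: occupied_def)
          have "k' = k"
          proof (rule ccontr)
            assume "k' \<noteq> k"
            then have "k' = swap k" by (simp add: neq_iff_swap)
            then have "L - far I k j < mid (swap k)"
              using R_le[OF k'] no coord_swap[of k "coord I k (far I k j)"] by (metis coord_coord not_le order.strict_trans1)
            then show False using far by (simp add: mid_swap)
          qed
          then show ?thesis using R_le[OF k'] by simp
        qed
        then show ?thesis
          using solo_time_le_potential[of a k "X k"] pot_le[of k] X_nonneg[of k] by fastforce
      qed
      then show ?thesis using free by blast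
    qed
  qed
qed

end

section \<open>The assignment rules\<close>

context reclaim_instance
begin

definition crosses :: "nat \<Rightarrow> bool" where
  "crosses j \<longleftrightarrow> real_of_int (lpos I j) < xstar I \<and> xstar I < real_of_int (rpos I j)"

text \<open>The comparison of the pair rule as seen from \<open>k\<close>. In favour of R1 the rule
  is strict; the weak inequality treats both reclaimers alike.\<close>

definition balanced :: "reclaimer \<Rightarrow> nat \<Rightarrow> nat \<Rightarrow> bool" where
  "balanced k i j \<longleftrightarrow>
     (far I k i - mid k) + (far I k j - mid k) + \<bar>far I k i - far I k j\<bar> / s
     \<le> (mid k - near I k i) + (mid k - near I k j) + \<bar>near I k i - near I k j\<bar> / s"

lemma crosses_coord: "crosses j \<longleftrightarrow> near I k j < mid k \<and> mid k < far I k j"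
  by (cases k) (auto simp: crosses_def)

lemma balanced_commute: "balanced k i j \<longleftrightarrow> balanced k j i"
  by (simp add: balanced_def abs_minus_commute add_ac)

lemma verdict_single_balanced: "verdict_single I j = k \<Longrightarrow> far I k j - mid k \<le> mid k - near I k j"
  by (cases k) (auto simp: verdict_single_def Let_def split: if_splits)

lemma verdict_pair_balanced: "verdict_pair I i j = k \<Longrightarrow> balanced k i j"
  by (cases k) (auto simp: verdict_pair_def balanced_def Let_def abs_minus_commute split: if_splits)

lemma crosses_unique:
  assumes "crosses j" "j \<in> piles I p" "i \<in> piles I p" "xstar I \<in> pile I i"
  shows "i = j"
  using piles_apart[OF assms(2,3), of R0] assms(1,4) by (auto simp: crosses_def pile_def)

definition pairs :: "(nat \<times> nat) set" where
  "pairs = {(i, i'). i \<in> piles I P1 \<and> i' \<in> piles I P2 \<and> xstar I \<in> pile I i \<and> xstar I \<in> pile I i'}"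

lemma rule_assignment_iff: "rule_assignment I a \<longleftrightarrow>
   (\<forall>j\<in>stockpiles I. (real_of_int (rpos I j) \<le> xstar I \<longrightarrow> a j = R0) \<and>
                      (xstar I \<le> real_of_int (lpos I j) \<longrightarrow> a j = R1)) \<and>
   (\<forall>j. {i \<in> stockpiles I. xstar I \<in> pile I i} = {j} \<longrightarrow> a j = verdict_single I j) \<and>
   (\<forall>j\<in>stockpiles I. crosses j \<and> (\<exists>(i, i')\<in>pairs. j \<in> {i, i'}) \<longrightarrow>
      (\<exists>(i, i')\<in>pairs. j \<in> {i, i'} \<and> a j = verdict_pair I i i'))"
  unfolding rule_assignment_def crosses_def pairs_def Let_def by (simp only: conj_assoc)

text \<open>Two piles of the other pad may touch x*, one from each side, and give different
  verdicts. The rules guarantee the inequality for some partner, which need not be the given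
  \<open>i\<close>.\<close>

lemma pair_balanced:
  assumes a: "rule_assignment I a" and j: "j \<in> piles I p" "crosses j"
    and i: "i \<in> piles I (other p)" "xstar I \<in> pile I i"
  shows "\<exists>i'\<in>piles I (other p). xstar I \<in> pile I i' \<and> balanced (a j) j i'"
proof -
  have "xstar I \<in> pile I j" using j(2) by (auto simp: crosses_def pile_def)
  then have "\<exists>(u, u')\<in>pairs. j \<in> {u, u'}"
    using i j by (cases p) (auto simp: pairs_def)
  then have "\<exists>(u, u')\<in>pairs. j \<in> {u, u'} \<and> a j = verdict_pair I u u'"
    using a j piles_subset[OF j(1)] unfolding rule_assignment_iff by blast
  then obtain u u' where u: "(u, u') \<in> pairs" "j \<in> {u, u'}" "a j = verdict_pair I u u'"
    by blast
  have "balanced (a j) u u'" using verdict_pair_balanced u(3) by simp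
  moreover have "u \<in> piles I P1" "u' \<in> piles I P2" "xstar I \<in> pile I u" "xstar I \<in> pile I u'"
    using u(1) by (auto simp: pairs_def)
  ultimately show ?thesis
    using u(2) pad_unique[OF j(1), of P1] pad_unique[OF j(1), of P2] balanced_commute[of "a j" u u']
    by (cases p) auto
qed

text \<open>The cases follow the precedence of the rules: position relative to x*, then an
  arbitrarily chosen pair, then the single rule. A pile that alone contains x* is in no pair, since
  partners are different piles, and if x* is one of its ends, the single rule agrees with the first
  one.\<close>

lemma rule_assignment_exists: "\<exists>a. rule_assignment I a"
proof -
  define pair where "pair j = (SOME q. q \<in> pairs \<and> j \<in> {fst q, snd q})" for j
  define a where "a j = (if real_of_int (rpos I j) \<le> xstar I then R0
    else if xstar I \<le> real_of_int (lpos I j) then R1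
    else if \<exists>q\<in>pairs. j \<in> {fst q, snd q} then verdict_pair I (fst (pair j)) (snd (pair j))
    else verdict_single I j)" for j
  have "rule_assignment I a"
    unfolding rule_assignment_iff
  proof (intro conjI ballI allI impI)
    fix j assume j: "j \<in> stockpiles I"
    show "a j = R0" if "real_of_int (rpos I j) \<le> xstar I"
      using that by (simp add: a_def)
    show "a j = R1" if "xstar I \<le> real_of_int (lpos I j)"
      using that pile_bounds(2)[OF j, of R0] by (simp add: a_def)
  next
    fix j assume j: "{i \<in> stockpiles I. xstar I \<in> pile I i} = {j}"
    then have js: "j \<in> stockpiles I" "xstar I \<in> pile I j" by auto
    have "\<not> (\<exists>q\<in>pairs. j \<in> {fst q, snd q})"
    proof
      assume "\<exists>q\<in>pairs. j \<in> {fst q, snd q}"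
      then obtain u u' where u: "(u, u') \<in> pairs" by auto
      then have "u \<in> {i \<in> stockpiles I. xstar I \<in> pile I i}" "u' \<in> {i \<in> stockpiles I. xstar I \<in> pile I i}"
        using piles_subset[of u P1] piles_subset[of u' P2] by (auto simp: pairs_def)
      then have "u = u'" unfolding j by simp
      then show False using u pad_unique[of u P1 P2] by (auto simp: pairs_def)
    qed
    then show "a j = verdict_single I j"
      using js pile_bounds(2)[OF js(1), of R0] by (auto simp: a_def verdict_single_def pile_def Let_def)
  next
    fix j assume j: "j \<in> stockpiles I" "crosses j \<and> (\<exists>(i, i')\<in>pairs. j \<in> {i, i'})"
    then have ex: "\<exists>q. q \<in> pairs \<and> j \<in> {fst q, snd q}" by fastforce
    then have "pair j \<in> pairs \<and> j \<in> {fst (pair j), snd (pair j)}"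
      unfolding pair_def by (rule someI_ex)
    moreover have "a j = verdict_pair I (fst (pair j)) (snd (pair j))"
      using j ex by (auto simp: a_def crosses_def)
    ultimately show "\<exists>(i, i')\<in>pairs. j \<in> {i, i'} \<and> a j = verdict_pair I i i'"
      by (intro bexI[of _ "pair j"]) (auto simp: case_prod_beta)
  qed
  then show ?thesis by blast
qed

section \<open>Trips that obey the assignment rules\<close>

lemma near_swap: "near I (swap k) j = L - far I k j"
  and far_swap: "far I (swap k) j = L - near I k j"
  by (cases k; simp)+

lemma unimodal_pair_swap:
  assumes "\<exists>A B. unimodal_pair s L (work I a k) (work I a (swap k)) A B \<and> pair_makespan A B \<le> c"
  shows "\<exists>A B. unimodal_pair s L (work I a R0) (work I a R1) A B \<and> pair_makespan A B \<le> c"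
proof (cases k)
  case R1
  then obtain A B where "unimodal_pair s L (work I a R0) (work I a R1) B A" "pair_makespan B A \<le> c"
    using assms unimodal_pair_commute[of s L "work I a R0" "work I a R1"] pair_makespan_commute
    by fastforce
  then show ?thesis by blast
qed (use assms in simp)

text \<open>On pad \<open>p\<close> the crossing pile is the farthest one of \<open>k\<close>, and
  by the choice of \<open>b\<close> it determines the extent of \<open>k\<close>. On the other pad
  \<open>b\<close> separates the two shares. With this \<open>crossing_bound\<close> applies, with
  \<open>k\<close> as the reclaimer that does not wait.\<close>

lemma crossing_pair:
  assumes a: "rule_assignment I a"
    and j: "j \<in> piles I p" "crosses j" "a j = k"
    and b: "mid k \<le> b" "b \<le> far I k j"
    and mine: "\<And>i. i \<in> piles I (other p) \<Longrightarrow> a i = k \<Longrightarrow> far I k i \<le> b"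
    and others: "\<And>i. i \<in> piles I (other p) \<Longrightarrow> a i \<noteq> k \<Longrightarrow> b \<le> near I k i"
    and key: "2 * (far I k j - b) \<le> L + (s - 1) * total_length (work I a k (other p))"
  shows "\<exists>A B. unimodal_pair s L (work I a R0) (work I a R1) A B \<and> pair_makespan A B \<le> potential I R0 L"
proof -
  have crosses: "near I k j < mid k" "mid k < far I k j" using j(2) crosses_coord by auto
  have mem: "(near I k j, far I k j) \<in> set (work I a k p)"
    using j by (auto simp: set_work)
  have mine': "far I k i \<le> far I k j" if "i \<in> piles I p" "a i = k" for i
    using piles_apart[OF that(1) j(1), of k] near_less_mid[OF a piles_subset[OF that(1)] that(2)] crosses
    by fastforce
  \<comment> \<open>Such a pile extends beyond x* as seen from \<open>k\<close>, so it lies behind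
    the crossing pile and not in front of it.\<close>
  have others': "far I k j \<le> near I k i" if i: "i \<in> piles I p" "a i \<noteq> k" for i
  proof -
    have "near I (swap k) i < mid (swap k)"
      using near_less_mid[OF a piles_subset[OF i(1)]] i(2) neq_iff_swap by simp
    then have "mid k < far I k i" by (simp add: near_swap mid_swap)
    moreover have "i \<noteq> j" using i j by auto
    ultimately show ?thesis using piles_apart[OF i(1) j(1), of k] crosses by auto
  qed
  have ext: "extent (work I a k) = far I k j"
  proof (rule antisym)
    show "extent (work I a k) \<le> far I k j"
    proof (rule extent_le)
      fix q l r assume "(l, r) \<in> set (work I a k q)"
      then obtain i where "r = far I k i" "i \<in> piles I q" "a i = k" by (auto simp: set_work)
      then show "r \<le> far I k j"
        using mine' mine[of i] b by (cases "q = p") (auto simp: neq_iff_other)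
    qed (use crosses mid_bounds[of k] in simp)
  qed (rule extent_ge[where W = "work I a k", OF mem])
  have swapped: "r \<le> (if q = p then L - far I k j else L - b)"
    if lr: "(l, r) \<in> set (work I a (swap k) q)" for l r q
  proof -
    obtain i where "r = far I (swap k) i" "i \<in> piles I q" "a i = swap k"
      using lr by (auto simp: set_work)
    then show ?thesis
      using others'[of i] others[of i] by (auto simp: far_swap neq_iff_other)
  qed
  have "\<not> idle (work I a k)" using mem unfolding idle_def by (metis empty_iff empty_set)
  have "\<exists>A B. unimodal_pair s L (work I a k) (work I a (swap k)) A B \<and>
      pair_makespan A B \<le> workload_bound s L (work I a k) (work I a (swap k))"
  proof (rule crossing_bound[OF speed_ge_1 L_pos, where b = b and p = p])
    show "extent (work I a (swap k)) \<le> L - b"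
      using swapped b pile_bounds(3)[OF piles_subset[OF j(1)], of k]
      by (intro extent_le) (fastforce split: if_splits)+
    show "0 \<le> b" using mid_bounds[of k] b by simp
    show "r \<le> b" if "(l, r) \<in> set (work I a k (other p))" for l r
      using that mine by (auto simp: set_work)
    show "r \<le> L - extent (work I a k)" if "(l, r) \<in> set (work I a (swap k) p)" for l r
      using swapped[OF that] ext by simp
  qed (use chain_work key b ext \<open>\<not> idle (work I a k)\<close> in auto)
  moreover have "workload_bound s L (work I a k) (work I a (swap k)) = potential I R0 L"
    using potential_L[of R0 a] by (cases k) (auto simp: workload_bound_commute)
  ultimately show ?thesis using unimodal_pair_swap by simp
qed

lemma total_length_ge:
  assumes "i \<in> piles I q" "a i = k"
  shows "far I k i - near I k i \<le> total_length (work I a k q)"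
proof -
  have "(\<Sum>j\<in>{i}. real_of_int (rpos I j) - real_of_int (lpos I j)) \<le> total_length (work I a k q)"
    unfolding total_length_work
    using assms pile_bounds(2)[OF piles_subset, of _ q R0]
    by (intro sum_mono2) (auto intro: less_imp_le)
  then show ?thesis by (cases k) auto
qed

text \<open>The pile \<open>i\<close> crosses x* as well, has the same reclaimer and ends no later
  than \<open>j\<close>, so its far end serves as the separator \<open>b\<close> on its pad.\<close>

lemma crossing_pair_both:
  assumes a: "rule_assignment I a"
    and j: "j \<in> piles I p" "crosses j" and i: "i \<in> piles I (other p)" "crosses i"
    and "a i = a j" "balanced (a j) j i" and le: "far I (a j) i \<le> far I (a j) j"
  shows "\<exists>A B. unimodal_pair s L (work I a R0) (work I a R1) A B \<and> pair_makespan A B \<le> potential I R0 L"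
proof -
  define k where "k = a j"
  have in_j: "near I k j < mid k" "mid k < far I k j" using j(2) crosses_coord by auto
  have in_i: "near I k i < mid k" "mid k < far I k i" using i(2) crosses_coord by auto
  show ?thesis
  proof (rule crossing_pair[OF a j, where k = k and b = "far I k i"])
    fix i' assume i': "i' \<in> piles I (other p)"
    note apart = piles_apart[OF i' i(1), of k]
    show "far I k i' \<le> far I k i" if "a i' = k"
      using apart near_less_mid[OF a piles_subset[OF i'] that] in_i by (cases "i' = i") auto
    show "far I k i \<le> near I k i'" if ne: "a i' \<noteq> k"
    proof -
      have "near I (swap k) i' < mid (swap k)"
        using near_less_mid[OF a piles_subset[OF i']] ne neq_iff_swap by simp
      then have "mid k < far I k i'" by (simp add: near_swap mid_swap)
      moreover have "i' \<noteq> i" using ne assms by (auto simp: k_def)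
      ultimately show ?thesis using apart in_i by auto
    qed
  next
    have "0 \<le> near I k j" "far I k j \<le> L" "0 \<le> near I k i"
      using pile_bounds[OF piles_subset[OF j(1)], of k] pile_bounds[OF piles_subset[OF i(1)], of k] by auto
    moreover have "far I k i - near I k i \<le> total_length (work I a k (other p))"
      using total_length_ge[OF i(1), of a "a j"] assms by (simp add: k_def)
    moreover have "(far I k j - mid k) + (far I k i - mid k) + (far I k j - far I k i) / s
        \<le> (mid k - near I k j) + (mid k - near I k i) + \<bar>near I k j - near I k i\<bar> / s"
      using assms by (simp add: balanced_def k_def)
    ultimately show "2 * (far I k j - far I k i) \<le> L + (s - 1) * total_length (work I a k (other p))"
      using in_i in_j le[folded k_def]
      by (intro crossing_arith[OF speed_ge_1, of "near I k j" "mid k" "near I k i"]) auto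
  qed (use in_i le k_def in auto)
qed

text \<open>Nothing on the other pad has x* in its interior, so x* itself separates the shares
  there. If nothing there touches x*, the single rule leaves at most half of the crossing pile
  beyond x*, and twice that is at most \<open>L\<close>. Otherwise the pair rule has been applied
  with a touching partner.\<close>

lemma crossing_pair_single:
  assumes a: "rule_assignment I a"
    and j: "j \<in> piles I p" "crosses j" and alone: "\<And>i. i \<in> piles I (other p) \<Longrightarrow> \<not> crosses i"
  shows "\<exists>A B. unimodal_pair s L (work I a R0) (work I a R1) A B \<and> pair_makespan A B \<le> potential I R0 L"
proof -
  define k where "k = a j"
  have in_j: "near I k j < mid k" "mid k < far I k j" using j(2) crosses_coord by auto
  have bounds: "0 \<le> near I k j" "far I k j \<le> L"
    using pile_bounds[OF piles_subset[OF j(1)], of k] by auto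
  have tl: "0 \<le> (s - 1) * total_length (work I a k (other p))"
    using speed_ge_1 total_length_nonneg[OF chain_work] by simp
  have key: "2 * (far I k j - mid k) \<le> L + (s - 1) * total_length (work I a k (other p))"
  proof (cases "\<exists>i\<in>piles I (other p). xstar I \<in> pile I i")
    case False
    have "{i \<in> stockpiles I. xstar I \<in> pile I i} = {j}"
    proof (intro equalityI subsetI)
      fix i assume i: "i \<in> {i \<in> stockpiles I. xstar I \<in> pile I i}"
      then obtain q where "i \<in> piles I q" using stockpile_pad by blast
      then show "i \<in> {j}"
        using i False crosses_unique[OF j(2,1)] by (cases "q = p") (auto simp: neq_iff_other)
    qed (use j piles_subset in \<open>auto simp: crosses_def pile_def\<close>)
    then have "a j = verdict_single I j" using a by (simp add: rule_assignment_iff)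
    then have "far I k j - mid k \<le> mid k - near I k j"
      using verdict_single_balanced k_def by simp
    then show ?thesis using bounds in_j tl by simp
  next
    case True
    then obtain i where i: "i \<in> piles I (other p)" "xstar I \<in> pile I i" "balanced k j i"
      using pair_balanced[OF a j] k_def by blast
    have i_near: "near I k i \<le> mid k" "mid k \<le> far I k i"
      using i(2) by (auto simp: xstar_in_pile[of i k])
    have "far I k i = mid k \<or> near I k i = mid k"
      using i_near alone[OF i(1)] crosses_coord[of i k] by auto
    \<comment> \<open>A partner that ends at x* goes to \<open>k\<close> by the first rule and
      counts as its work; one that starts at x* has no part before it.\<close>
    then have "mid k - near I k i \<le> total_length (work I a k (other p))"
    proof
      assume "far I k i = mid k"
      then show ?thesis
        using total_length_ge[OF i(1), of a k] far_le_mid[OF a piles_subset[OF i(1)], of k] by simp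
    qed (use total_length_nonneg[OF chain_work] in simp)
    \<comment> \<open>Replacing the far end of the partner by x* only lowers the left side of the
      rule, by the triangle inequality and because 1/s is at most 1.\<close>
    moreover have "(far I k j - mid k) / s \<le> (far I k i - mid k) + \<bar>far I k j - far I k i\<bar> / s"
    proof -
      have "(far I k j - mid k) / s \<le> (far I k i - mid k) / s + \<bar>far I k j - far I k i\<bar> / s"
        using speed_ge_1 by (simp add: add_divide_distrib[symmetric] divide_right_mono)
      moreover have "(far I k i - mid k) / s \<le> far I k i - mid k"
        using mult_left_mono[of 1 s "far I k i - mid k"] speed_ge_1 i_near
        by (simp add: pos_divide_le_eq)
      ultimately show ?thesis by simp
    qed
    ultimately show ?thesis
      using in_j i_near bounds i(3) pile_bounds(1)[OF piles_subset[OF i(1)], of k]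
      by (intro crossing_arith[OF speed_ge_1, of "near I k j" "mid k" "near I k i"]) (auto simp: balanced_def)
  qed
  show ?thesis
  proof (rule crossing_pair[OF a j, where k = k and b = "mid k"])
    fix i assume i: "i \<in> piles I (other p)"
    show "far I k i \<le> mid k" if "a i = k"
      using near_less_mid[OF a piles_subset[OF i] that] alone[OF i] crosses_coord[of i k] by auto
    show "mid k \<le> near I k i" if "a i \<noteq> k"
    proof -
      have "near I (swap k) i < mid (swap k)"
        using near_less_mid[OF a piles_subset[OF i]] that neq_iff_swap by simp
      then have "mid k < far I k i" by (simp add: near_swap mid_swap)
      then show ?thesis using alone[OF i] crosses_coord[of i k] by auto
    qed
  qed (use in_j key k_def in auto)
qed

text \<open>If two piles cross, each is the only pile on its pad that contains x*. So there is just
  one pair, both piles get its verdict, and the one that reaches farther takes the place of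
  \<open>j\<close>.\<close>

lemma crossing_pair_exists:
  assumes a: "rule_assignment I a" and j: "j \<in> stockpiles I" "crosses j"
  shows "\<exists>A B. unimodal_pair s L (work I a R0) (work I a R1) A B \<and> pair_makespan A B \<le> potential I R0 L"
proof -
  obtain p where p: "j \<in> piles I p" using stockpile_pad[OF j(1)] by blast
  show ?thesis
  proof (cases "\<exists>i\<in>piles I (other p). crosses i")
    case False
    then show ?thesis using crossing_pair_single[OF a p j(2)] by blast
  next
    case True
    then obtain i where i: "i \<in> piles I (other p)" "crosses i" by blast
    have in_pile: "xstar I \<in> pile I i" "xstar I \<in> pile I j"
      using i(2) j(2) by (auto simp: crosses_def pile_def)
    have "balanced (a j) j i"
      using pair_balanced[OF a p j(2) i(1) in_pile(1)] crosses_unique[OF i(2,1)] by blast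
    moreover have "a i = a j"
    proof -
      define u u' where "u = (if p = P1 then j else i)" and "u' = (if p = P1 then i else j)"
      have only: "z = (u, u')" if "z \<in> pairs" for z
        using that crosses_unique[OF i(2,1)] crosses_unique[OF j(2) p]
        by (cases p) (auto simp: pairs_def u_def u'_def)
      have mem: "(u, u') \<in> pairs"
        using p i in_pile by (cases p) (auto simp: pairs_def u_def u'_def)
      have "a v = verdict_pair I u u'" if v: "v \<in> stockpiles I" "crosses v" "v \<in> {u, u'}" for v
      proof -
        have "\<exists>(w, w')\<in>pairs. v \<in> {w, w'}" using mem v(3) by blast
        then have "\<exists>(w, w')\<in>pairs. v \<in> {w, w'} \<and> a v = verdict_pair I w w'"
          using a v unfolding rule_assignment_iff by blast
        then show ?thesis using only by blast
      qed
      from this[of i] this[of j] show ?thesis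
        using i j piles_subset by (auto simp: u_def u'_def)
    qed
    ultimately show ?thesis
      using crossing_pair_both[OF a p j(2) i] crossing_pair_both[OF a i _ j(2)] p
        balanced_commute[of "a j" j i] by (cases "far I (a j) i \<le> far I (a j) j") auto
  qed
qed

text \<open>Without crossing piles x* bounds the work of both reclaimers, so their ranges do not
  overlap.\<close>

lemma separated_pair_exists:
  assumes a: "rule_assignment I a" and "\<And>j. j \<in> stockpiles I \<Longrightarrow> \<not> crosses j"
  shows "\<exists>A B. unimodal_pair s L (work I a R0) (work I a R1) A B \<and>
    pair_makespan A B \<le> max (solo_time s (work I a R0)) (solo_time s (work I a R1))"
proof (rule no_conflict[OF speed_ge_1 L_pos chain_work chain_work not_both_idle])
  have "extent (work I a k) \<le> mid k" for k
  proof (rule extent_le)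
    fix q l r assume "(l, r) \<in> set (work I a k q)"
    then obtain j where "r = far I k j" "j \<in> piles I q" "a j = k" by (auto simp: set_work)
    then show "r \<le> mid k"
      using near_less_mid[OF a piles_subset] assms(2)[OF piles_subset] crosses_coord[of j k] by fastforce
  qed (rule mid_bounds)
  from this[of R0] this[of R1] show "extent (work I a R0) + extent (work I a R1) \<le> L" by simp
qed

text \<open>A crossing pile makes x* an occupied point, which excludes the gap in
  \<open>preemptive_lower_bound\<close>; then f(L) is an upper bound for the schedule and a lower
  bound for \<open>2 * makespan \<sigma>\<close>. Without crossing piles the larger solo time
  suffices: it is at most f(L), and in the case of a gap at most
  \<open>makespan \<sigma>\<close>.\<close>

theorem unimodal_opt_le_twice:
  assumes a: "rule_assignment I a" and \<sigma>: "preemptive_schedule I \<sigma>"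
  shows "unimodal_opt I a \<le> 2 * makespan \<sigma>"
proof -
  have nonneg: "0 \<le> makespan \<sigma>"
    using \<sigma> makespan_nonneg by (simp add: preemptive_schedule_def)
  note lower = preemptive_lower_bound[OF \<sigma> a]
  show ?thesis
  proof (cases "\<exists>j\<in>stockpiles I. crosses j")
    case True
    then obtain j where j: "j \<in> stockpiles I" "crosses j" by blast
    then obtain q where "j \<in> piles I q" using stockpile_pad by blast
    then have "xstar I \<in> occupied I q"
      using j(2) by (force simp: occupied_def pile_def crosses_def)
    then have "potential I R0 L \<le> 2 * makespan \<sigma>" using lower by blast
    then show ?thesis
      using crossing_pair_exists[OF a j] unimodal_opt_le by fastforce
  next
    case False
    then obtain A B where AB: "unimodal_pair s L (work I a R0) (work I a R1) A B"
      "pair_makespan A B \<le> max (solo_time s (work I a R0)) (solo_time s (work I a R1))"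
      using separated_pair_exists[OF a] by blast
    have "solo_time s (work I a k) \<le> potential I R0 L" for k
      using solo_time_le_potential[of a k L] pile_bounds(3)[OF piles_subset] L_pos potential_L_eq[of k]
      by simp
    from this[of R0] this[of R1] have "max (solo_time s (work I a R0)) (solo_time s (work I a R1)) \<le> potential I R0 L"
      by simp
    moreover have "max (solo_time s (work I a R0)) (solo_time s (work I a R1)) \<le> makespan \<sigma>
        \<or> potential I R0 L \<le> 2 * makespan \<sigma>"
      using lower by auto
    ultimately have "pair_makespan A B \<le> 2 * makespan \<sigma>"
      using AB(2) nonneg by linarith
    then show ?thesis using unimodal_opt_le[OF AB(1)] by simp
  qed
qed

lemma nonpreemptive_imp_preemptive: "nonpreemptive_schedule I \<sigma> \<Longrightarrow> preemptive_schedule I \<sigma>"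
  unfolding preemptive_schedule_def
proof (intro conjI allI ballI)
  assume \<sigma>: "nonpreemptive_schedule I \<sigma>"
  then show "clash_free_schedule I \<sigma>" by (simp add: nonpreemptive_schedule_def)
  fix p x assume "x \<in> occupied I p"
  then obtain j where j: "j \<in> piles I p" "x \<in> pile I j" by (auto simp: occupied_def)
  then obtain q where "reclaims_pile I (\<sigma> (fst q)) (snd q) j"
    using \<sigma> piles_subset unfolding nonpreemptive_schedule_def by blast
  then obtain p' where "reclaiming_piece (\<sigma> (fst q)) (snd q) p'" "j \<in> piles I p'"
    "piece_range (\<sigma> (fst q)) (snd q) = pile I j"
    by (auto simp: reclaims_pile_def)
  then show "\<exists>k i. reclaiming_piece (\<sigma> k) i p \<and> x \<in> piece_range (\<sigma> k) i"
    using j pad_unique[of j p p'] by auto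
qed

lemma opt_bounds:
  assumes a: "rule_assignment I a"
  shows "unimodal_opt I a \<le> 2 * preemptive_opt I" "unimodal_opt I a \<le> 2 * nonpreemptive_opt I"
proof -
  obtain \<sigma> where \<sigma>: "nonpreemptive_schedule I \<sigma>"
    using unimodal_opt_attained[of a] by (auto simp: unimodal_schedule_def)
  have "unimodal_opt I a / 2 \<le> preemptive_opt I"
    unfolding preemptive_opt_def
    using nonpreemptive_imp_preemptive[OF \<sigma>] unimodal_opt_le_twice[OF a]
    by (intro cInf_greatest) (auto simp: mult.commute)
  then show "unimodal_opt I a \<le> 2 * preemptive_opt I" by simp
  have "unimodal_opt I a / 2 \<le> nonpreemptive_opt I"
    unfolding nonpreemptive_opt_def
    using \<sigma> unimodal_opt_le_twice[OF a nonpreemptive_imp_preemptive]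
    by (intro cInf_greatest) (auto simp: mult.commute)
  then show "unimodal_opt I a \<le> 2 * nonpreemptive_opt I" by simp
qed

lemma nonpreemptive_opt_le: "nonpreemptive_schedule I \<sigma> \<Longrightarrow> nonpreemptive_opt I \<le> makespan \<sigma>"
  unfolding nonpreemptive_opt_def
  by (intro cInf_lower bdd_belowI[of _ 0])
    (auto simp: nonpreemptive_schedule_def makespan_nonneg)

lemma nonpreemptive_opt_nonneg: "0 \<le> nonpreemptive_opt I"
proof -
  obtain a \<sigma> where "unimodal_schedule I a \<sigma>"
    using unimodal_opt_attained by blast
  then have "nonpreemptive_schedule I \<sigma>" by (simp add: unimodal_schedule_def)
  then show ?thesis
    unfolding nonpreemptive_opt_def
  proof (intro cInf_greatest)
    fix x assume "x \<in> makespan ` {\<sigma>. nonpreemptive_schedule I \<sigma>}"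
    then show "0 \<le> x" by (auto simp: nonpreemptive_schedule_def makespan_nonneg)
  qed blast
qed

lemma solo_time_le_unimodal_opt: "solo_time s (work I a k) \<le> unimodal_opt I a"
proof -
  obtain \<sigma> where \<sigma>: "unimodal_schedule I a \<sigma>" "makespan \<sigma> = unimodal_opt I a"
    using unimodal_opt_attained by blast
  then obtain p p' where "unimodal_trip s L (work I a R0) p (\<sigma> R0)"
    "unimodal_trip s L (work I a R1) p' (view I R1 (\<sigma> R1))"
    by (auto simp: unimodal_schedule_iff unimodal_pair_def simp del: view.simps(2))
  note solo_time_le_finish[OF this(1) speed_ge_1 chain_work]
    solo_time_le_finish[OF this(2) speed_ge_1 chain_work]
  then have "solo_time s (work I a k) \<le> makespan \<sigma>"
    by (cases k) (auto simp: makespan_def max_def simp del: view.simps)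
  then show ?thesis using \<sigma>(2) by simp
qed

end

section \<open>Tightness\<close>

text \<open>Two stockpiles filling both pads.  Both contain \<open>x\<^sup>*\<close>, so the rules give them to the same
  reclaimer, which then needs time 2, whereas \<open>R1\<close> can travel to \<open>0\<close> first and then reclaim its
  stockpile side by side with \<open>R0\<close>.\<close>

definition twin_inst :: "real \<Rightarrow> reclaim_inst" where
  "twin_inst s = \<lparr>plen = 1, num1 = 1, num = 2, lpos = \<lambda>_. 0, rpos = \<lambda>_. 1, speed = s\<rparr>"

lemma twin_simps [simp]:
  "plen (twin_inst s) = 1" "speed (twin_inst s) = s" "num1 (twin_inst s) = 1" "num (twin_inst s) = 2"
  "lpos (twin_inst s) j = 0" "rpos (twin_inst s) j = 1"
  by (simp_all add: twin_inst_def)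

lemma twin_piles [simp]:
  "piles (twin_inst s) P1 = {1}" "piles (twin_inst s) P2 = {2}" "stockpiles (twin_inst s) = {1, 2}"
  by (auto simp: stockpiles_def)

lemma twin_near_far [simp]: "near (twin_inst s) k j = 0" "far (twin_inst s) k j = 1"
  by (cases k; simp)+

lemma twin_pile_list [simp]: "pile_list (twin_inst s) k P1 = [1]" "pile_list (twin_inst s) k P2 = [2]"
  by (cases k; simp add: upt_rec)+

lemma valid_twin: "1 \<le> s \<Longrightarrow> valid_inst (twin_inst s)"
proof -
  have "i < j \<Longrightarrow> i \<in> piles (twin_inst s) p \<Longrightarrow> j \<in> piles (twin_inst s) p \<Longrightarrow> False" for i j p
    by (cases p) auto
  then show "1 \<le> s \<Longrightarrow> valid_inst (twin_inst s)"
    unfolding valid_inst_def by (auto simp del: piles.simps)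
qed

lemma twin_work:
  "work (twin_inst s) a k P1 = (if a 1 = k then [(0, 1)] else [])"
  "work (twin_inst s) a k P2 = (if a 2 = k then [(0, 1)] else [])"
  by (simp_all add: work_def)

lemma pot_unit: "0 \<le> x \<Longrightarrow> x \<le> 1 \<Longrightarrow> pot s [(0, 1)] x = x"
  by (simp add: pot_def algebra_simps)

lemma pot_empty: "pot s [] x = x / s"
  by (simp add: pot_def)

text \<open>Neither end of the pad is x*, since f is 0 at the left end and f(L) at the right end,
  not half of it. So the two piles form the only pair and stay together, and their reclaimer needs
  time 1 for each leg.\<close>

lemma twin_unimodal_opt:
  assumes s: "1 \<le> s" and a: "rule_assignment (twin_inst s) a"
  shows "2 \<le> unimodal_opt (twin_inst s) a"
proof -
  interpret reclaim_instance "twin_inst s" by unfold_locales (rule valid_twin[OF s])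
  have "0 < potential (twin_inst s) R0 1"
    using potential_strict_mono[of 0 1 R0] by (simp add: potential_0)
  then have "xstar (twin_inst s) \<noteq> 0" "xstar (twin_inst s) \<noteq> 1"
    using xstar_props(3) by (auto simp: potential_0)
  then have x: "0 < xstar (twin_inst s)" "xstar (twin_inst s) < 1"
    using xstar_props(1,2) by auto
  then have "pairs = {(1, 2)}" by (auto simp: pairs_def pile_def)
  then have "a j = verdict_pair (twin_inst s) 1 2" if "j \<in> {1, 2}" for j
    using a that x unfolding rule_assignment_iff by (auto simp: crosses_def)
  then have "a 1 = a 2" by simp
  define k where "k = a 1"
  have w: "work (twin_inst s) a k q = [(0, 1)]" for q
    using \<open>a 1 = a 2\<close> by (cases q) (simp_all add: twin_work k_def)
  then have "extent (work (twin_inst s) a k) = 1" by (simp add: extent_def)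
  then have "solo_time s (work (twin_inst s) a k) = 2"
    by (simp add: solo_time_def w pot_unit)
  then show ?thesis using solo_time_le_unimodal_opt[of a k] by simp
qed

text \<open>Each reclaimer gets one pile. R1 goes out on the pad where it has no work, in time 1/s,
  while R0 waits at home. Then both reclaim, R0 on its way out and R1 on its way back, and R0 needs
  another 1/s to return.\<close>

lemma twin_nonpreemptive_opt:
  assumes s: "1 \<le> s"
  shows "nonpreemptive_opt (twin_inst s) \<le> 1 + 2 / s" "0 \<le> nonpreemptive_opt (twin_inst s)"
proof -
  interpret reclaim_instance "twin_inst s" by unfold_locales (rule valid_twin[OF s])
  define a where "a j = (if j = 1 then R0 else R1)" for j :: nat
  define V W where "V = work (twin_inst s) a R0" and "W = work (twin_inst s) a R1"
  have VW: "V P1 = [(0, 1)]" "V P2 = []" "W P1 = []" "W P2 = [(0, 1)]"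
    by (simp_all add: V_def W_def twin_work a_def)
  have ext: "extent V = 1" "extent W = 1" by (simp_all add: extent_def VW)
  have chain: "pile_chain 0 1 (V q)" "pile_chain 0 1 (W q)" for q
    by (cases q; simp add: VW pile_chain_Cons)+
  have idle: "\<not> idle V" "\<not> idle W" using VW unfolding idle_def by (metis list.distinct(1))+
  interpret V: canonical s V 1 using s chain by unfold_locales auto
  interpret W: canonical s W 1 using s chain by unfold_locales auto
  have solo: "solo_time s V = 1 + 1 / s" "solo_time s W = 1 + 1 / s"
    by (simp_all add: solo_time_def ext VW pot_unit pot_empty)
  let ?A = "canonical_trip s V 1 P1 (1 / s)" and ?B = "canonical_trip s W 1 P1 0"
  have s0: "0 \<le> 1 / s" using s by simp
  have "pos ?A t + pos ?B t \<le> 1" if "0 \<le> t" for t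
  proof -
    consider "t \<le> 1 / s" | "1 / s \<le> t" "t \<le> 1 / s + 1" | "1 / s + 1 \<le> t" by linarith
    then show ?thesis
    proof cases
      case 1
      then show ?thesis
        using V.pos_canonical_out[OF s0, of t P1] V.T_pos[of P1] V.e_before[of "t - 1 / s" P1]
          W.pos_canonical_bounds(2)[of 0 P1 t] by simp
    next
      case 2
      \<comment> \<open>The distances \<open>u\<close> from 0 and \<open>1 - u\<close> from the
        right end describe the same point of the rail: the reclaimers move side by side.\<close>
      define u where "u = t - 1 / s"
      have u: "0 \<le> u" "u \<le> 1" using 2 by (auto simp: u_def)
      have "V.e P1 u \<le> u" using u by (intro V.e_le) (simp_all add: VW pot_unit)
      moreover have "W.e P2 (1 - u) \<le> 1 - u" using u by (intro W.e_le) (simp_all add: VW pot_unit)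
      moreover have "pos ?A t = V.e P1 u"
        using V.pos_canonical_out[OF s0, of t P1] u by (simp add: VW pot_unit u_def)
      moreover have "pos ?B t = W.e P2 (1 - u)"
        using W.pos_canonical_in[of 0 P1 t] u by (simp add: VW pot_unit pot_empty u_def algebra_simps)
      ultimately show ?thesis by simp
    next
      case 3
      then show ?thesis
        using W.pos_canonical_after[of 0 P1 t] V.pos_canonical_bounds(2)[OF s0, of P1 t]
        by (simp add: VW pot_unit pot_empty)
    qed
  qed
  then have "compatible 1 (canonical_trip s V (extent V) P1 (1 / s)) (canonical_trip s W (extent W) P1 0)"
    by (simp add: compatible_def ext)
  note pair = unimodal_pair_canonical[OF s zero_le_one chain(1) chain(2) idle s0 order_refl this]
  have "unimodal_pair s 1 V W ?A ?B"
    using pair(1) by (simp only: ext)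
  then obtain \<sigma> where \<sigma>: "unimodal_schedule (twin_inst s) a \<sigma>" "makespan \<sigma> = pair_makespan ?A ?B"
    using schedule_of_pair[of a ?A ?B, folded V_def W_def] by auto
  have "pair_makespan ?A ?B = 1 + 2 / s"
    using pair(2) s0 by (simp add: ext solo)
  then show "nonpreemptive_opt (twin_inst s) \<le> 1 + 2 / s"
    using nonpreemptive_opt_le[of \<sigma>] \<sigma> by (simp add: unimodal_schedule_def)
  show "0 \<le> nonpreemptive_opt (twin_inst s)" by (rule nonpreemptive_opt_nonneg)
qed

theorem theorem6:
  "(\<forall>I. valid_inst I \<longrightarrow>
      (\<exists>a. rule_assignment I a) \<and>
      (\<forall>a. rule_assignment I a \<longrightarrow>
         (\<exists>\<sigma>. unimodal_schedule I a \<sigma> \<and> makespan \<sigma> = unimodal_opt I a) \<and>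
         unimodal_opt I a \<le> 2 * preemptive_opt I \<and>
         unimodal_opt I a \<le> 2 * nonpreemptive_opt I)) \<and>
   (\<forall>\<epsilon>>0. \<forall>\<^sub>F s in at_top. \<exists>I a.
      valid_inst I \<and> speed I = s \<and> rule_assignment I a \<and>
      unimodal_opt I a \<ge> (2 - \<epsilon>) * nonpreemptive_opt I)"
proof (intro conjI allI impI)
  fix I assume "valid_inst I"
  then interpret reclaim_instance I by unfold_locales
  show "\<exists>a. rule_assignment I a" by (rule rule_assignment_exists)
  fix a assume a: "rule_assignment I a"
  show "\<exists>\<sigma>. unimodal_schedule I a \<sigma> \<and> makespan \<sigma> = unimodal_opt I a"
    by (rule unimodal_opt_attained)
  show "unimodal_opt I a \<le> 2 * preemptive_opt I" "unimodal_opt I a \<le> 2 * nonpreemptive_opt I"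
    by (rule opt_bounds[OF a])+
next
  fix \<epsilon> :: real assume \<epsilon>: "0 < \<epsilon>"
  show "\<forall>\<^sub>F s in at_top. \<exists>I a. valid_inst I \<and> speed I = s \<and> rule_assignment I a \<and>
      unimodal_opt I a \<ge> (2 - \<epsilon>) * nonpreemptive_opt I"
    \<comment> \<open>For \<open>\<epsilon> \<le> 2\<close> the product
      \<open>(2 - \<epsilon>) * (1 + 2 / s)\<close> exceeds 2 by at most
      \<open>4 / s - \<epsilon>\<close>, whence the threshold \<open>4 / \<epsilon>\<close>; the 1
      keeps the speed valid.\<close>
    using eventually_ge_at_top[of "max 1 (4 / \<epsilon>)"]
  proof eventually_elim
    case (elim s)
    then have s: "1 \<le> s" "4 / s \<le> \<epsilon>" using \<epsilon> by (auto simp: field_simps)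
    interpret reclaim_instance "twin_inst s" by unfold_locales (rule valid_twin[OF s(1)])
    obtain a where a: "rule_assignment (twin_inst s) a" using rule_assignment_exists by blast
    have "(2 - \<epsilon>) * nonpreemptive_opt (twin_inst s) \<le> 2"
    proof (cases "\<epsilon> \<le> 2")
      case True
      then have "(2 - \<epsilon>) * nonpreemptive_opt (twin_inst s) \<le> (2 - \<epsilon>) * (1 + 2 / s)"
        using twin_nonpreemptive_opt[OF s(1)] by (intro mult_left_mono) auto
      also have "\<dots> = 2 - \<epsilon> + 4 / s - \<epsilon> * (2 / s)" by (simp add: algebra_simps diff_divide_distrib)
      also have "\<dots> \<le> 2"
      proof -
        have "0 \<le> \<epsilon> * (2 / s)" using s \<epsilon> by simp
        then show ?thesis using s(2) by linarith
      qed
      finally show ?thesis .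
    next
      \<comment> \<open>The factor is negative here, so a nonnegative optimum is enough.\<close>
      case False
      then have "(2 - \<epsilon>) * nonpreemptive_opt (twin_inst s) \<le> 0"
        using twin_nonpreemptive_opt(2)[OF s(1)] by (intro mult_nonpos_nonneg) auto
      then show ?thesis by simp
    qed
    then show ?case
      using twin_unimodal_opt[OF s(1) a] valid_twin[OF s(1)] a
      by (intro exI[of _ "twin_inst s"] exI[of _ a]) simp
  qed
qed

end
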